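(* Let $n\geq 1$, $\sigma>0$, $\mu,\nu>0$, $p,q>1$, let $u_0,v_0\in L^{\infty}(\mathbb{R}^n)\cap L^1(\mathbb{R}^n)$, and assume $\min\{p,q\}>1+\frac{2\sigma}{n}$. Let $\varepsilon_0>0$ and, for $\varepsilon\in(0,\varepsilon_0]$, let $(u,v)$ be the global in-time small data solutions described in the context of the Cauchy problem $$\begin{cases}u_t+(-\Delta)^{\sigma}u+\mu u-\nu v=u^p,&x\in\mathbb{R}^n,\ t>0,\\ v_t+(-\Delta)^{\sigma}v-\mu u+\nu v=v^q,&x\in\mathbb{R}^n,\ t>0,\\ u(0,x)=\varepsilon u_0(x),\ v(0,x)=\varepsilon v_0(x),&x\in\mathbb{R}^n.\end{cases}$$ Then, for any $1\leq m_1,m_2\leq+\infty$ and $w\in\{u,v\}$, $$\lim_{t\to+\infty}t^{\frac{n}{2\sigma}(1-\frac1m)}\left\|w(t,\cdot)-\frac{\gamma}{\mu+\nu}\,G(t,\cdot)\left(\varepsilon P_{u_0+v_0}+\mathcal{P}_{u^p+v^q}\right)\right\|_{L^m}=0,$$ where $m=m_1$ and $\gamma=\nu$ if $w=u$, and $m=m_2$ and $\gamma=\mu$ if $w=v$. In particular, if $\varepsilon P_{u_0+v_0}+\mathcal{P}_{u^p+v^q}\neq0$, then the following optimal large time $L^2$ estimates hold for $w\in\{u,v\}$ and all sufficiently large $t$: $$t^{-\frac{n}{4\sigma}}\left|\varepsilon P_{u_0+v_0}+\mathcal{P}_{u^p+v^q}\right|\lesssim\|w(t,\cdot)\|_{L^2}\lesssim\varepsilon\,t^{-\frac{n}{4\sigma}}\|(u_0,v_0)\|_{(L^{\infty}\cap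 L^1)^2}.$$
   Context: Fourier convention: $\widehat f(\xi)=\int_{\mathbb{R}^n}\mathrm{e}^{-\mathrm{i}x\cdot\xi}f(x)\,\mathrm{d}x$, with inverse $\mathcal{F}^{-1}$. The fractional Laplacian is $(-\Delta)^{\sigma}f=\mathcal{F}^{-1}(|\xi|^{2\sigma}\widehat f)$. The fractional heat kernel is $G(t,x)=\mathcal{F}^{-1}_{\xi\to x}(\mathrm{e}^{-|\xi|^{2\sigma}t})$, and $\mathcal{G}(t,|D|)$ is the Fourier multiplier operator with symbol $\mathrm{e}^{-|\xi|^{2\sigma}t}$, i.e. $\mathcal{G}(t,|D|)f=G(t,\cdot)*f$ for $t>0$ and $\mathcal{G}(0,|D|)=\mathrm{Id}$. The solution operators are $$K_0^u(t,|D|)=\frac{\nu+\mu\mathrm{e}^{-(\mu+\nu)t}}{\mu+\nu}\mathcal{G}(t,|D|),\quad K_1^u(t,|D|)=\frac{\nu-\nu\mathrm{e}^{-(\mu+\nu)t}}{\mu+\nu}\mathcal{G}(t,|D|),$$ $$K_0^v(t,|D|)=\frac{\mu-\mu\mathrm{e}^{-(\mu+\nu)t}}{\mu+\nu}\mathcal{G}(t,|D|),\quad K_1^v(t,|D|)=\frac{\mu+\nu\mathrm{e}^{-(\mu+\nu)t}}{\mu+\nu}\mathcal{G}(t,|D|).$$ Global in-time small data solutions: $\varepsilon_0>0$ is such that for every $\varepsilon\in(0,\varepsilon_0]$ the Cauchy problem has uniquely determined global in-time solutions $(u,v)\in\mathcal{C}([0,+\infty),L^{m_1})\times\mathcal{C}([0,+\infty),L^{m_2})$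 for any $1\leq m_1,m_2\leq+\infty$, which satisfy, for $w\in\{u,v\}$, the equivalent integral equations $$w(t,x)=\varepsilon K_0^w(t,|D|)u_0(x)+\varepsilon K_1^w(t,|D|)v_0(x)+\int_0^t\big(K_0^w(t-\tau,|D|)[u(\tau,x)]^p+K_1^w(t-\tau,|D|)[v(\tau,x)]^q\big)\,\mathrm{d}\tau$$ and the decay estimates $\|w(t,\cdot)\|_{L^m}\lesssim\varepsilon(1+t)^{-\frac{n}{2\sigma}(1-\frac1m)}\|(u_0,v_0)\|_{(L^\infty\cap L^1)^2}$ for all $t\geq0$ ($m=m_1$ if $w=u$, $m=m_2$ if $w=v$). (Such an $\varepsilon_0$ exists under the assumptions of the claim.) Notation: $P_f=\int_{\mathbb{R}^n}f(x)\,\mathrm{d}x$ for $f=f(x)$, and $\mathcal{P}_f=\int_0^{+\infty}\int_{\mathbb{R}^n}f(t,x)\,\mathrm{d}x\,\mathrm{d}t$ for $f=f(t,x)$. Data and solutions are real-valued and are not assumed non-negative; at negative values, the power $s^p$ (respectively $s^q$) is read as either $|s|^p$ or $|s|^{p-1}s$ (respectively $|s|^q$ or $|s|^{q-1}s$), and the statement is meant for each of these readings. The norm is $\|(f,g)\|_{(L^\infty\cap L^1)^2}=\|f\|_{L^\infty}+\|f\|_{L^1}+\|g\|_{L^\infty}+\|g\|_{L^1}$. $A\lesssim B$ means $A\leq CB$ with a constant $C>0$ independent of $t$, $\varepsilon$ and the data (the largeness threshold on $t$ may depend on the solution). *)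

theory Defs
  imports "HOL-Analysis.Analysis" "HOL-Probability.Essential_Supremum"
begin

section \<open>Lebesgue spaces\<close>

text \<open>
  The exponent \<open>m\<close> ranges over \<open>[1, \<infinity>]\<close> inside \<^typ>\<open>ennreal\<close>, where \<open>1 / \<infinity> = 0\<close>. The norm
  takes values in \<^typ>\<open>ennreal\<close>, so it is \<open>\<infinity>\<close> (and not a default value) for a measurable
  function that is not in the space.
\<close>

definition Lnorm :: "ennreal \<Rightarrow> ('a::euclidean_space \<Rightarrow> real) \<Rightarrow> ennreal" where
  "Lnorm m f =
    (if m = \<infinity> then esssup lebesgue (\<lambda>x. ennreal \<bar>f x\<bar>)
     else let I = (\<integral>\<^sup>+ x. ennreal (\<bar>f x\<bar> powr enn2real m) \<partial>lebesgue)
          in if I = \<infinity> then \<infinity> else ennreal (enn2real I powr (1 / enn2real m)))"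

definition Lspace :: "ennreal \<Rightarrow> ('a::euclidean_space \<Rightarrow> real) set" where
  "Lspace m = {f \<in> borel_measurable lebesgue. Lnorm m f < \<infinity>}"

definition data_norm :: "('a::euclidean_space \<Rightarrow> real) \<Rightarrow> ('a \<Rightarrow> real) \<Rightarrow> ennreal" where
  "data_norm f g = Lnorm \<infinity> f + Lnorm 1 f + Lnorm \<infinity> g + Lnorm 1 g"

text \<open>\<open>w \<in> \<C>(I, L\<^sup>m)\<close>, for representatives \<open>w t\<close> of the classes.\<close>

definition continuous_in_L :: "ennreal \<Rightarrow> real set \<Rightarrow> (real \<Rightarrow> 'a::euclidean_space \<Rightarrow> real) \<Rightarrow> bool" where
  "continuous_in_L m I w \<longleftrightarrow>
     (\<forall>t\<in>I. w t \<in> Lspace m) \<and>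
     (\<forall>s\<in>I. ((\<lambda>t. Lnorm m (\<lambda>x. w t x - w s x)) \<longlongrightarrow> 0) (at s within I))"

section \<open>The fractional heat kernel and the solution operators\<close>

definition inverse_fourier :: "('a::euclidean_space \<Rightarrow> complex) \<Rightarrow> 'a \<Rightarrow> complex" where
  "inverse_fourier f x =
     (1 / (2 * pi) ^ DIM('a)) *\<^sub>R (\<integral>\<xi>. exp (\<i> * complex_of_real (x \<bullet> \<xi>)) * f \<xi> \<partial>lebesgue)"

text \<open>The symbol is real and even, so the inverse transform is real-valued and taking the
  real part discards nothing.\<close>

definition heat_kernel :: "real \<Rightarrow> real \<Rightarrow> 'a::euclidean_space \<Rightarrow> real" where
  "heat_kernel \<sigma> t x =
     Re (inverse_fourier (\<lambda>\<xi>. complex_of_real (exp (- (norm \<xi> powr (2 * \<sigma>)) * t))) x)"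

definition heat_op :: "real \<Rightarrow> real \<Rightarrow> ('a::euclidean_space \<Rightarrow> real) \<Rightarrow> 'a \<Rightarrow> real" where
  "heat_op \<sigma> t f =
     (if t = 0 then f else (\<lambda>x. \<integral>y. heat_kernel \<sigma> t (x - y) * f y \<partial>lebesgue))"

definition K0u :: "real \<Rightarrow> real \<Rightarrow> real \<Rightarrow> real \<Rightarrow> ('a::euclidean_space \<Rightarrow> real) \<Rightarrow> 'a \<Rightarrow> real" where
  "K0u \<sigma> \<mu> \<nu> t f x = (\<nu> + \<mu> * exp (- (\<mu> + \<nu>) * t)) / (\<mu> + \<nu>) * heat_op \<sigma> t f x"

definition K1u :: "real \<Rightarrow> real \<Rightarrow> real \<Rightarrow> real \<Rightarrow> ('a::euclidean_space \<Rightarrow> real) \<Rightarrow> 'a \<Rightarrow> real" where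
  "K1u \<sigma> \<mu> \<nu> t f x = (\<nu> - \<nu> * exp (- (\<mu> + \<nu>) * t)) / (\<mu> + \<nu>) * heat_op \<sigma> t f x"

definition K0v :: "real \<Rightarrow> real \<Rightarrow> real \<Rightarrow> real \<Rightarrow> ('a::euclidean_space \<Rightarrow> real) \<Rightarrow> 'a \<Rightarrow> real" where
  "K0v \<sigma> \<mu> \<nu> t f x = (\<mu> - \<mu> * exp (- (\<mu> + \<nu>) * t)) / (\<mu> + \<nu>) * heat_op \<sigma> t f x"

definition K1v :: "real \<Rightarrow> real \<Rightarrow> real \<Rightarrow> real \<Rightarrow> ('a::euclidean_space \<Rightarrow> real) \<Rightarrow> 'a \<Rightarrow> real" where
  "K1v \<sigma> \<mu> \<nu> t f x = (\<mu> + \<nu> * exp (- (\<mu> + \<nu>) * t)) / (\<mu> + \<nu>) * heat_op \<sigma> t f x"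

section \<open>Global in-time small data solutions\<close>

text \<open>The two readings of the power \<open>s\<^sup>p\<close> at negative \<open>s\<close>.\<close>

definition power_readings :: "real \<Rightarrow> (real \<Rightarrow> real) set" where
  "power_readings p = {\<lambda>s. \<bar>s\<bar> powr p, \<lambda>s. \<bar>s\<bar> powr (p - 1) * s}"

text \<open>
  The Cauchy problem
  \<open>u\<^sub>t + (-\<Delta>)\<^sup>\<sigma> u + \<mu> u - \<nu> v = N\<^sub>p(u)\<close>, \<open>v\<^sub>t + (-\<Delta>)\<^sup>\<sigma> v - \<mu> u + \<nu> v = N\<^sub>q(v)\<close>,
  \<open>u(0) = \<epsilon> u\<^sub>0\<close>, \<open>v(0) = \<epsilon> v\<^sub>0\<close> is understood through its equivalent integral equations, which
  hold for every \<open>t \<ge> 0\<close> and almost every \<open>x\<close>. At \<open>t = 0\<close> they are the initial conditions.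
\<close>

definition integral_equations ::
  "real \<Rightarrow> real \<Rightarrow> real \<Rightarrow> (real \<Rightarrow> real) \<Rightarrow> (real \<Rightarrow> real) \<Rightarrow>
   ('a::euclidean_space \<Rightarrow> real) \<Rightarrow> ('a \<Rightarrow> real) \<Rightarrow> real \<Rightarrow>
   (real \<Rightarrow> 'a \<Rightarrow> real) \<Rightarrow> (real \<Rightarrow> 'a \<Rightarrow> real) \<Rightarrow> bool" where
  "integral_equations \<sigma> \<mu> \<nu> Np Nq u0 v0 \<epsilon> u v \<longleftrightarrow>
     (\<forall>t\<ge>0. AE x in lebesgue.
        u t x = \<epsilon> * K0u \<sigma> \<mu> \<nu> t u0 x + \<epsilon> * K1u \<sigma> \<mu> \<nu> t v0 x
          + (LINT \<tau>:{0..t}|lebesgue.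
               K0u \<sigma> \<mu> \<nu> (t - \<tau>) (\<lambda>y. Np (u \<tau> y)) x
             + K1u \<sigma> \<mu> \<nu> (t - \<tau>) (\<lambda>y. Nq (v \<tau> y)) x)) \<and>
     (\<forall>t\<ge>0. AE x in lebesgue.
        v t x = \<epsilon> * K0v \<sigma> \<mu> \<nu> t u0 x + \<epsilon> * K1v \<sigma> \<mu> \<nu> t v0 x
          + (LINT \<tau>:{0..t}|lebesgue.
               K0v \<sigma> \<mu> \<nu> (t - \<tau>) (\<lambda>y. Np (u \<tau> y)) x
             + K1v \<sigma> \<mu> \<nu> (t - \<tau>) (\<lambda>y. Nq (v \<tau> y)) x))"

definition decay_exponent :: "real \<Rightarrow> nat \<Rightarrow> ennreal \<Rightarrow> real" where
  "decay_exponent \<sigma> n m = real n / (2 * \<sigma>) * (1 - enn2real (1 / m))"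

definition decay_estimate ::
  "real \<Rightarrow> (ennreal \<Rightarrow> real) \<Rightarrow> ('a::euclidean_space \<Rightarrow> real) \<Rightarrow> ('a \<Rightarrow> real) \<Rightarrow> real \<Rightarrow>
   (real \<Rightarrow> 'a \<Rightarrow> real) \<Rightarrow> bool" where
  "decay_estimate \<sigma> C u0 v0 \<epsilon> w \<longleftrightarrow>
     (\<forall>m\<ge>1. \<forall>t\<ge>0.
        Lnorm m (w t)
          \<le> ennreal (C m * \<epsilon> * (1 + t) powr (- decay_exponent \<sigma> DIM('a) m)) * data_norm u0 v0)"

text \<open>
  For \<open>m = \<infinity>\<close>, continuity in time is only required on \<open>(0, \<infinity>)\<close>: already \<open>t \<mapsto> G(t,\<cdot>) * u\<^sub>0\<close> is
  in general not continuous at \<open>t = 0\<close> with values in \<open>L\<^sup>\<infinity>\<close>, so demanding continuity there would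
  exclude all but (uniformly) continuous data. Membership in \<open>L\<^sup>\<infinity>\<close> for all \<open>t \<ge> 0\<close> is contained in
  the decay estimates. The constants \<open>C m\<close> depend neither on \<open>t\<close>, \<open>\<epsilon>\<close> nor on the data.
\<close>

definition small_data_solution ::
  "real \<Rightarrow> real \<Rightarrow> real \<Rightarrow> (real \<Rightarrow> real) \<Rightarrow> (real \<Rightarrow> real) \<Rightarrow> (ennreal \<Rightarrow> real) \<Rightarrow>
   ('a::euclidean_space \<Rightarrow> real) \<Rightarrow> ('a \<Rightarrow> real) \<Rightarrow> real \<Rightarrow>
   (real \<Rightarrow> 'a \<Rightarrow> real) \<Rightarrow> (real \<Rightarrow> 'a \<Rightarrow> real) \<Rightarrow> bool" where
  "small_data_solution \<sigma> \<mu> \<nu> Np Nq C u0 v0 \<epsilon> u v \<longleftrightarrow>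
     (\<forall>w\<in>{u, v}.
        (\<forall>m. 1 \<le> m \<and> m < \<infinity> \<longrightarrow> continuous_in_L m {0..} w) \<and>
        continuous_in_L \<infinity> {0<..} w \<and>
        decay_estimate \<sigma> C u0 v0 \<epsilon> w) \<and>
     integral_equations \<sigma> \<mu> \<nu> Np Nq u0 v0 \<epsilon> u v"

definition admissible_smallness ::
  "real \<Rightarrow> real \<Rightarrow> real \<Rightarrow> (real \<Rightarrow> real) \<Rightarrow> (real \<Rightarrow> real) \<Rightarrow> (ennreal \<Rightarrow> real) \<Rightarrow>
   ('a::euclidean_space \<Rightarrow> real) \<Rightarrow> ('a \<Rightarrow> real) \<Rightarrow> real \<Rightarrow> bool" where
  "admissible_smallness \<sigma> \<mu> \<nu> Np Nq C u0 v0 \<epsilon>0 \<longleftrightarrow>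
     0 < \<epsilon>0 \<and>
     (\<forall>\<epsilon>\<in>{0<..\<epsilon>0}. \<exists>u v. small_data_solution \<sigma> \<mu> \<nu> Np Nq C u0 v0 \<epsilon> u v \<and>
        (\<forall>u' v'. small_data_solution \<sigma> \<mu> \<nu> Np Nq C u0 v0 \<epsilon> u' v' \<longrightarrow>
           (\<forall>t\<ge>0. (AE x in lebesgue. u' t x = u t x) \<and> (AE x in lebesgue. v' t x = v t x))))"

text \<open>The inner integral depends only on the class of \<open>f t\<close>, so no joint measurability of the
  chosen representatives is needed in this iterated form.\<close>

definition space_time_integral :: "(real \<Rightarrow> 'a::euclidean_space \<Rightarrow> real) \<Rightarrow> real" where
  "space_time_integral f = (LINT t:{0..}|lebesgue. (\<integral>x. f t x \<partial>lebesgue))"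

definition asymptotic_mass ::
  "(real \<Rightarrow> real) \<Rightarrow> (real \<Rightarrow> real) \<Rightarrow> ('a::euclidean_space \<Rightarrow> real) \<Rightarrow> ('a \<Rightarrow> real) \<Rightarrow> real \<Rightarrow>
   (real \<Rightarrow> 'a \<Rightarrow> real) \<Rightarrow> (real \<Rightarrow> 'a \<Rightarrow> real) \<Rightarrow> real" where
  "asymptotic_mass Np Nq u0 v0 \<epsilon> u v =
     \<epsilon> * (\<integral>x. u0 x + v0 x \<partial>lebesgue) + space_time_integral (\<lambda>t x. Np (u t x) + Nq (v t x))"

end

theory Submission
  imports Defs "HOL-Complex_Analysis.Cauchy_Integral_Formula" "HOL-Real_Asymp.Real_Asymp"
begin

text \<open>
  A solution is a superposition of heat flows \<open>G(t - \<tau>) * f\<close> of integrable functions: the data at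
  \<open>\<tau> = 0\<close>, and the nonlinearities \<open>N(\<tau>)\<close> at all times \<open>\<tau> \<ge> 0\<close>. For one such flow,
  \<open>(G(t - \<tau>) * f)(x) - G(t, x) \<integral>f = \<integral> (G(t - \<tau>, x - y) - G(t, x)) f(y) dy\<close>. After rescaling \<open>x\<close> by
  \<open>t\<^bsup>1/(2\<sigma>)\<^esup>\<close> the bracket compares the profile \<open>G(1, \<cdot>)\<close> with a translate and dilate of it by amounts
  that tend to zero, so the difference is \<open>o(1)\<close> in \<open>L\<^sup>1\<close> and \<open>o(t\<^bsup>-n/(2\<sigma>)\<^esup>)\<close> in \<open>L\<^sup>\<infinity>\<close>
  (\<open>heat_op_asymptotics\<close>). The coefficients of the solution operators converge to \<open>\<gamma> / (\<mu> + \<nu>)\<close>.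

  The decay estimates and \<open>p > 1 + 2\<sigma>/n\<close> give \<open>N(\<tau>)\<close> the size \<open>(1 + \<tau>)\<^bsup>-\<kappa>\<^esup>\<close> in \<open>L\<^sup>1\<close>, with
  \<open>\<kappa> = n(p - 1)/(2\<sigma>) > 1\<close>, and the additional factor \<open>(1 + \<tau>)\<^bsup>-n/(2\<sigma>)\<^esup>\<close> in \<open>L\<^sup>\<infinity>\<close>. Hence the
  integrable weight \<open>(1 + \<tau>)\<^bsup>-\<kappa>\<^esup>\<close> dominates, uniformly in \<open>t\<close>, both the \<open>L\<^sup>1\<close> norm of
  \<open>G(t - \<tau>) * N(\<tau>)\<close> and \<open>t\<^bsup>n/(2\<sigma>)\<^esup>\<close> times its supremum, and dominated convergence in \<open>\<tau>\<close> over
  \<open>[0, \<infinity>)\<close> turns the asymptotics of each flow into the asymptotics of the Duhamel integral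
  (\<open>duhamel_asymptotics\<close>). All exponents between \<open>1\<close> and \<open>\<infinity>\<close> follow from the two endpoints by
  interpolation (\<open>Lnorm_interpolation\<close>). For the \<open>L\<^sup>2\<close> bounds, \<open>\<parallel>G(t)\<parallel>\<close> is exactly a positive
  multiple of \<open>t\<^bsup>-n/(4\<sigma>)\<^esup>\<close>, which the error cannot cancel for large \<open>t\<close>; the upper bound is a decay
  estimate of the solution.

  The analytic input is that \<open>G(1, \<cdot>)\<close> is integrable (\<open>heat_kernel_one_decay\<close>). For general \<open>\<sigma>\<close> the
  kernel has no sign and the symbol \<open>exp (-|\<xi>|\<^bsup>2\<sigma>\<^esup>)\<close> is not smooth at the origin. Taking \<open>n + 1\<close>
  finite differences of the symbol in a coordinate direction \<open>b\<close> with step \<open>h = \<pi> / |x\<^sub>b|\<close> multiplies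
  the Fourier integral at \<open>x\<close> by \<open>(-2)\<^bsup>n+1\<^esup>\<close>, so \<open>|G(1, x)|\<close> is at most the \<open>L\<^sup>1\<close> norm of
  that difference. Away from the origin the difference is small by Cauchy estimates on the complexified
  line \<open>\<xi> + \<complex> b\<close>; near the origin it is small because the symbol differs from \<open>1\<close> by at most
  \<open>|\<xi>|\<^bsup>2\<sigma>\<^esup>\<close>. Together they give \<open>h\<^bsup>n+\<delta>\<^esup>\<close> times an integrable function of \<open>\<xi>\<close>, hence decay
  \<open>|x\<^sub>b|\<^bsup>-n-\<delta>\<^esup>\<close> for every coordinate, which is integrable.
\<close>

section \<open>Iterated finite differences\<close>

definition fdiff :: "'a::plus \<Rightarrow> ('a \<Rightarrow> 'b::minus) \<Rightarrow> 'a \<Rightarrow> 'b" where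
  "fdiff h f x = f (x + h) - f x"

text \<open>
  A Cauchy estimate on discs of radius \<open>\<kappa>\<close> bounds the derivative, and hence a difference of step \<open>h\<close>;
  the price is to shrink the disc by \<open>h + \<kappa>\<close>. Iterating this single step bounds differences of any
  order without computing a higher derivative.
\<close>

lemma fdiff_holomorphic_bound:
  fixes F :: "complex \<Rightarrow> complex"
  assumes hol: "F holomorphic_on ball a R" and bd: "\<And>z. z \<in> ball a R \<Longrightarrow> norm (F z) \<le> M"
    and h: "h \<ge> 0" and k: "\<kappa> > 0" and z: "z \<in> ball a (R - (h + \<kappa>))"
  shows "norm (fdiff (of_real h) F z) \<le> M * (h / \<kappa>)"
proof -
  have der: "norm (deriv F w) \<le> M / \<kappa>" if w: "w \<in> ball a (R - \<kappa>)" for w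
  proof -
    have sub: "cball w \<kappa> \<subseteq> ball a R"
    proof
      fix y assume "y \<in> cball w \<kappa>"
      then show "y \<in> ball a R" using w dist_triangle[of a y w] by auto
    qed
    have "norm ((deriv ^^ 1) F w) \<le> fact 1 * M / \<kappa> ^ 1"
    proof (rule Cauchy_inequality)
      show "F holomorphic_on ball w \<kappa>"
        using hol sub by (meson ball_subset_cball holomorphic_on_subset order_trans)
      show "continuous_on (cball w \<kappa>) F"
        using hol sub by (meson holomorphic_on_imp_continuous_on holomorphic_on_subset)
      show "norm (F x) \<le> M" if "norm (w - x) = \<kappa>" for x
      proof (rule bd)
        have "x \<in> cball w \<kappa>" using that by (simp add: dist_norm)
        then show "x \<in> ball a R" using sub by blast
      qed
    qed (use k in auto)
    then show ?thesis by simp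
  qed
  have "norm (F (z + of_real h) - F z) \<le> M / \<kappa> * norm ((z + of_real h) - z)"
  proof (rule field_differentiable_bound[where S = "ball a (R - \<kappa>)" and f' = "deriv F"])
    show "(F has_field_derivative deriv F w) (at w within ball a (R - \<kappa>))"
      if "w \<in> ball a (R - \<kappa>)" for w
    proof -
      have "w \<in> ball a R" using that k by auto
      then show ?thesis
        using hol by (meson holomorphic_derivI open_ball)
    qed
    show "z \<in> ball a (R - \<kappa>)" using z h by auto
    have "dist a (z + of_real h) \<le> dist a z + h"
      using h dist_triangle[of a "z + of_real h" z] by (simp add: dist_norm)
    then show "z + of_real h \<in> ball a (R - \<kappa>)" using z by auto
  qed (use der in auto)
  then show ?thesis using h by (simp add: fdiff_def mult.commute)
qed

lemma fdiff_holomorphic: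
  assumes hol: "F holomorphic_on ball a R" and h: "h \<ge> 0" and r: "r \<le> R - h"
  shows "fdiff (of_real h) F holomorphic_on ball a r"
  unfolding fdiff_def[abs_def]
proof (intro holomorphic_intros)
  show "F holomorphic_on ball a r" using hol by (rule holomorphic_on_subset) (use h r in auto)
  have "(F \<circ> (\<lambda>z. z + of_real h)) holomorphic_on ball a r"
  proof (rule holomorphic_on_compose_gen[OF _ hol])
    show "(\<lambda>z. z + of_real h) ` ball a r \<subseteq> ball a R"
    proof safe
      fix z assume "z \<in> ball a r"
      then show "z + of_real h \<in> ball a R"
        using h r dist_triangle[of a "z + of_real h" z] by (simp add: dist_norm)
    qed
  qed (intro holomorphic_intros)
  then show "(\<lambda>z. F (z + of_real h)) holomorphic_on ball a r" by (simp add: comp_def)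
qed

lemma iterated_fdiff_holomorphic_bound:
  fixes F :: "complex \<Rightarrow> complex"
  assumes hol: "F holomorphic_on ball a R" and bd: "\<And>z. z \<in> ball a R \<Longrightarrow> norm (F z) \<le> M"
    and h: "h \<ge> 0" and k: "\<kappa> > 0" and z: "z \<in> ball a (R - real N * (h + \<kappa>))"
  shows "norm ((fdiff (of_real h) ^^ N) F z) \<le> M * (h / \<kappa>) ^ N"
  using hol bd z
proof (induction N arbitrary: F R M)
  case 0 then show ?case by auto
next
  case (Suc N)
  have eq: "R - real (Suc N) * (h + \<kappa>) = (R - (h + \<kappa>)) - real N * (h + \<kappa>)"
    by (simp add: algebra_simps)
  have "norm ((fdiff (of_real h) ^^ N) (fdiff (of_real h) F) z) \<le> (M * (h / \<kappa>)) * (h / \<kappa>) ^ N"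
  proof (rule Suc.IH)
    show "fdiff (of_real h) F holomorphic_on ball a (R - (h + \<kappa>))"
      by (rule fdiff_holomorphic[OF Suc.prems(1) h]) (use k in auto)
    show "norm (fdiff (of_real h) F w) \<le> M * (h / \<kappa>)" if "w \<in> ball a (R - (h + \<kappa>))" for w
      by (rule fdiff_holomorphic_bound[OF Suc.prems(1,2) h k that])
    show "z \<in> ball a (R - (h + \<kappa>) - real N * (h + \<kappa>))" using Suc.prems(3) unfolding eq .
  qed
  then show ?case by (simp add: funpow_Suc_right del: funpow.simps)
qed

lemma iterated_fdiff_trivial_bound:
  fixes f :: "'a::real_vector \<Rightarrow> 'b::real_normed_vector"
  assumes "\<And>j. j \<le> N \<Longrightarrow> norm (f (x + real j *\<^sub>R h)) \<le> M"
  shows "norm ((fdiff h ^^ N) f x) \<le> 2 ^ N * M"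
  using assms
proof (induction N arbitrary: f M)
  case 0 then show ?case using 0[of 0] by simp
next
  case (Suc N)
  have "norm ((fdiff h ^^ N) (fdiff h f) x) \<le> 2 ^ N * (2 * M)"
  proof (rule Suc.IH)
    fix j assume j: "j \<le> N"
    have "norm (f (x + real j *\<^sub>R h + h) - f (x + real j *\<^sub>R h)) \<le> M + M"
      by (rule order_trans[OF norm_triangle_ineq4 add_mono])
         (use Suc.prems[of "Suc j"] Suc.prems[of j] j in \<open>auto simp: algebra_simps\<close>)
    then show "norm (fdiff h f (x + real j *\<^sub>R h)) \<le> 2 * M" by (simp add: fdiff_def)
  qed
  then show ?case by (simp add: funpow_Suc_right algebra_simps del: funpow.simps)
qed

lemma iterated_fdiff_shift_const:
  fixes f :: "'a::plus \<Rightarrow> 'b::ab_group_add"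
  shows "(fdiff h ^^ Suc N) (\<lambda>x. f x - c) = (fdiff h ^^ Suc N) f"
proof -
  have "fdiff h (\<lambda>x. f x - c) = fdiff h f" by (auto simp: fdiff_def)
  then show ?thesis by (simp add: funpow_Suc_right del: funpow.simps)
qed

lemma iterated_fdiff_Suc_apply:
  "(fdiff h ^^ Suc N) f x = (fdiff h ^^ N) f (x + h) - (fdiff h ^^ N) f x"
  by (simp add: fdiff_def[of h "(fdiff h ^^ N) f"])

text \<open>
  Differences of \<open>f\<close> in a real direction \<open>b\<close> are differences of any function of one complex
  variable that extends \<open>f\<close> along the line; this makes the Cauchy estimates available for \<open>f\<close>.
\<close>

lemma iterated_fdiff_line:
  fixes f :: "'a::real_vector \<Rightarrow> real" and F :: "complex \<Rightarrow> complex"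
  assumes "\<And>s::real. F (of_real s) = of_real (f (x + s *\<^sub>R b))"
  shows "(fdiff (of_real h) ^^ N) F (of_real s) = of_real ((fdiff (h *\<^sub>R b) ^^ N) f (x + s *\<^sub>R b))"
proof (induction N arbitrary: s)
  case 0 then show ?case using assms by simp
next
  case (Suc N)
  have "(fdiff (of_real h) ^^ N) F (of_real s + of_real h)
      = of_real ((fdiff (h *\<^sub>R b) ^^ N) f (x + s *\<^sub>R b + h *\<^sub>R b))"
    using Suc.IH[of "s + h"] by (simp add: algebra_simps)
  then show ?case using Suc.IH[of s] by (simp only: iterated_fdiff_Suc_apply of_real_diff)
qed

section \<open>Finite differences of the symbol\<close>

text \<open>
  The symbol of the kernel at time \<open>1\<close>; its power with exponent \<open>t\<close> is the symbol at time \<open>t\<close>.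
\<close>

definition frac_symbol :: "real \<Rightarrow> 'a::euclidean_space \<Rightarrow> real" where
  "frac_symbol \<sigma> \<xi> = exp (- (norm \<xi> powr (2 * \<sigma>)))"

lemma norm_exp_minus_minus_one_le:
  fixes y :: complex
  assumes "Re y \<ge> 0"
  shows "norm (exp (- y) - 1) \<le> norm y"
proof -
  have "norm (exp (- y) - exp (- 0)) \<le> 1 * norm (y - 0)"
  proof (rule field_differentiable_bound[where S = "{z. 0 \<le> Re z}" and f' = "\<lambda>z. - exp (- z)"])
    show "((\<lambda>z. exp (- z)) has_field_derivative - exp (- z)) (at z within {z. 0 \<le> Re z})" for z :: complex
      by (auto intro!: derivative_eq_intros)
    show "convex {z. 0 \<le> Re z}" by (rule convex_halfspace_Re_ge)
  qed (use assms in auto)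
  then show ?thesis by simp
qed

text \<open>
  On the line through \<open>\<xi>\<close> in direction \<open>b\<close>, \<open>|\<xi> + z b|\<^sup>2 = |\<xi>|\<^sup>2 v(z)\<close> with \<open>v\<close> a quadratic polynomial,
  \<open>v(0) = 1\<close>. On a disc of radius \<open>\<beta> |\<xi>|\<close>, with \<open>\<beta>\<close> depending on \<open>\<sigma>\<close> alone, \<open>v\<close> stays so close to
  \<open>1\<close> that \<open>v\<^bsup>\<sigma>\<^esup>\<close> has non-negative real part, so the symbol extends holomorphically with modulus at
  most \<open>1\<close>. The second term of the minimum comes from applying the same estimate to the symbol minus
  \<open>1\<close>; it is the gain needed near the origin.
\<close>

lemma frac_symbol_difference_far:
  assumes \<sigma>: "\<sigma> > 0"
  obtains \<beta> where "0 < \<beta>" "\<beta> \<le> 1"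
    and "\<And>N h b \<xi> :: 'a::euclidean_space. norm b = 1 \<Longrightarrow> \<xi> \<noteq> 0 \<Longrightarrow> 0 < h \<Longrightarrow>
      4 * real (Suc N) * h \<le> \<beta> * norm \<xi> \<Longrightarrow>
      \<bar>(fdiff (h *\<^sub>R b) ^^ Suc N) (frac_symbol \<sigma>) \<xi>\<bar>
        \<le> min 1 (2 * norm \<xi> powr (2 * \<sigma>)) * (4 * real (Suc N) * h / (\<beta> * norm \<xi>)) ^ Suc N"
proof -
  have "isCont (\<lambda>v::complex. v powr of_real \<sigma>) 1"
    by (intro continuous_intros) (auto simp: complex_nonpos_Reals_iff)
  then obtain d where d: "d > 0"
    and dd: "\<And>v::complex. norm (v - 1) < d \<Longrightarrow> norm (v powr of_real \<sigma> - 1) < 1 / 2"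
    unfolding continuous_at_eps_delta by (metis dist_norm half_gt_zero powr_one_eq_one zero_less_one)
  \<comment> \<open>then \<open>|v(z) - 1| \<le> 2\<beta> + \<beta>\<^sup>2 \<le> 3\<beta> < d\<close> on the disc of radius \<open>\<beta> |\<xi>|\<close>\<close>
  define \<beta> where "\<beta> = min d 1 / 4"
  have b0: "\<beta> > 0" and b1: "\<beta> \<le> 1 / 4" and bd: "4 * \<beta> \<le> d"
    using d by (auto simp: \<beta>_def)
  show ?thesis
  proof (rule that[OF b0])
    fix N h and b \<xi> :: 'a
    assume nb: "norm b = 1" and x0: "\<xi> \<noteq> 0" and h: "0 < h"
      and hx: "4 * real (Suc N) * h \<le> \<beta> * norm \<xi>"
    define r where "r = norm \<xi>"
    have r: "r > 0" using x0 by (simp add: r_def)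
    define c where "c = \<xi> \<bullet> b"
    have c: "\<bar>c\<bar> \<le> r" using Cauchy_Schwarz_ineq2[of \<xi> b] nb by (simp add: c_def r_def)
    define v :: "complex \<Rightarrow> complex" where "v z = 1 + 2 * of_real c * z / of_real (r\<^sup>2) + z\<^sup>2 / of_real (r\<^sup>2)" for z
    define F where "F z = exp (- (of_real (r powr (2 * \<sigma>)) * v z powr of_real \<sigma>))" for z
    define R where "R = \<beta> * r"
    have R: "R > 0" using b0 r by (simp add: R_def)
    have v1: "norm (v z - 1) < d" "norm (v z - 1) < 1" if z: "z \<in> ball 0 R" for z
    proof -
      have nz: "norm z < \<beta> * r" using z by (simp add: R_def)
      have "norm (v z - 1) \<le> norm (2 * of_real c * z / of_real (r\<^sup>2)) + norm (z\<^sup>2 / of_real (r\<^sup>2))"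
        unfolding v_def using norm_triangle_ineq by (metis (no_types, lifting) add.assoc add_diff_cancel_left')
      also have "\<dots> = 2 * \<bar>c\<bar> * norm z / r\<^sup>2 + (norm z)\<^sup>2 / r\<^sup>2"
        by (simp add: norm_mult norm_divide norm_power)
      also have "\<dots> \<le> 2 * r * (\<beta> * r) / r\<^sup>2 + (\<beta> * r)\<^sup>2 / r\<^sup>2"
        using nz c r b0 by (intro add_mono divide_right_mono mult_mono power_mono) auto
      also have "\<dots> = 2 * \<beta> + \<beta>\<^sup>2"
        using r by (simp add: power2_eq_square)
      also have "\<beta>\<^sup>2 \<le> \<beta> * 1" unfolding power2_eq_square using b0 b1 by (intro mult_left_mono) auto
      finally have "norm (v z - 1) \<le> 3 * \<beta>" by simp
      then show "norm (v z - 1) < d" "norm (v z - 1) < 1" using bd b0 b1 by auto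
    qed
    have rev: "Re (v z) > 0" if "z \<in> ball 0 R" for z
      using v1(2)[OF that] abs_Re_le_cmod[of "v z - 1"] by auto
    define y where "y z = of_real (r powr (2 * \<sigma>)) * v z powr of_real \<sigma>" for z
    have y: "Re (y z) \<ge> 0 \<and> norm (y z) \<le> 2 * r powr (2 * \<sigma>)" if z: "z \<in> ball 0 R" for z
    proof -
      have "norm (v z powr of_real \<sigma> - 1) < 1 / 2" using dd v1(1)[OF z] .
      then have "Re (v z powr of_real \<sigma>) \<ge> 0" "norm (v z powr of_real \<sigma>) \<le> 2"
        using abs_Re_le_cmod[of "v z powr of_real \<sigma> - 1"]
          norm_triangle_ineq2[of "v z powr of_real \<sigma>" 1] by auto
      then show ?thesis
        using mult_right_mono[of "norm (v z powr of_real \<sigma>)" 2 "r powr (2 * \<sigma>)"]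
        by (simp add: y_def norm_mult mult.commute)
    qed
    have Fy: "F z = exp (- y z)" for z by (simp add: F_def y_def)
    have hol: "F holomorphic_on ball 0 R"
      unfolding F_def v_def
    proof (intro holomorphic_intros)
      fix z assume "z \<in> ball (0::complex) R"
      from rev[OF this] show "1 + 2 * of_real c * z / of_real (r\<^sup>2) + z\<^sup>2 / of_real (r\<^sup>2) \<notin> \<real>\<^sub>\<le>\<^sub>0"
        unfolding v_def by (auto simp: complex_nonpos_Reals_iff)
    qed (use r in auto)
    have line: "F (of_real s) = of_real (frac_symbol \<sigma> (\<xi> + s *\<^sub>R b))" for s
    proof -
      define vs where "vs = 1 + 2 * c * s / r\<^sup>2 + s\<^sup>2 / r\<^sup>2"
      have vv: "v (of_real s) = of_real vs" by (simp add: v_def vs_def)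
      have nn: "(norm (\<xi> + s *\<^sub>R b))\<^sup>2 = r\<^sup>2 + 2 * c * s + s\<^sup>2"
        using nb unfolding power2_norm_eq_inner r_def c_def
        by (simp add: inner_add inner_commute power2_eq_square norm_eq_1)
      have rv: "(norm (\<xi> + s *\<^sub>R b))\<^sup>2 = r\<^sup>2 * vs"
        unfolding nn vs_def using r by (simp add: field_simps power2_eq_square)
      have "0 \<le> r\<^sup>2 * vs" unfolding rv[symmetric] by simp
      then have vs0: "vs \<ge> 0" using r by (simp add: zero_le_mult_iff)
      have "norm (\<xi> + s *\<^sub>R b) powr (2 * \<sigma>) = ((norm (\<xi> + s *\<^sub>R b))\<^sup>2) powr \<sigma>"
        by (simp flip: powr_powr)
      also have "\<dots> = (r\<^sup>2) powr \<sigma> * vs powr \<sigma>" unfolding rv using vs0 by (simp add: powr_mult)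
      also have "(r\<^sup>2) powr \<sigma> = r powr (2 * \<sigma>)" using r by (simp flip: powr_powr)
      finally have e: "norm (\<xi> + s *\<^sub>R b) powr (2 * \<sigma>) = r powr (2 * \<sigma>) * vs powr \<sigma>" .
      show ?thesis
        unfolding F_def vv frac_symbol_def e using vs0 by (simp add: powr_of_real flip: exp_of_real)
    qed
    \<comment> \<open>with this radius the \<open>N + 1\<close> Cauchy estimates use up at most half of the disc\<close>
    define \<kappa> where "\<kappa> = R / (4 * real (Suc N))"
    have k: "\<kappa> > 0" using R by (simp add: \<kappa>_def)
    have zb: "0 \<in> ball (0::complex) (R - real (Suc N) * (h + \<kappa>))"
    proof -
      have "real (Suc N) * \<kappa> = R / 4" by (simp add: \<kappa>_def del: of_nat_Suc)
      moreover have "real (Suc N) * h \<le> R / 4" using hx unfolding R_def r_def by linarith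
      ultimately show ?thesis using R by (simp add: distrib_left)
    qed
    have hk: "h / \<kappa> = 4 * real (Suc N) * h / (\<beta> * norm \<xi>)"
      by (simp add: \<kappa>_def R_def r_def)
    have e: "\<bar>(fdiff (h *\<^sub>R b) ^^ Suc N) (frac_symbol \<sigma>) \<xi>\<bar> = norm ((fdiff (of_real h) ^^ Suc N) F 0)"
      using iterated_fdiff_line[where F = F and f = "frac_symbol \<sigma>" and x = \<xi> and b = b and h = h and N = "Suc N" and s = 0]
        line by (simp del: funpow.simps)
    have "norm ((fdiff (of_real h) ^^ Suc N) F 0) \<le> 1 * (h / \<kappa>) ^ Suc N"
    proof (rule iterated_fdiff_holomorphic_bound[OF hol _ less_imp_le[OF h] k zb])
      show "norm (F z) \<le> 1" if "z \<in> ball 0 R" for z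
        using y[OF that] by (simp add: Fy)
    qed
    moreover have "norm ((fdiff (of_real h) ^^ Suc N) (\<lambda>z. F z - 1) 0)
        \<le> 2 * r powr (2 * \<sigma>) * (h / \<kappa>) ^ Suc N"
    proof (rule iterated_fdiff_holomorphic_bound[OF _ _ less_imp_le[OF h] k zb])
      show "norm (F z - 1) \<le> 2 * r powr (2 * \<sigma>)" if "z \<in> ball 0 R" for z
        using norm_exp_minus_minus_one_le[of "y z"] y[OF that] by (simp add: Fy)
    qed (use hol in \<open>auto intro: holomorphic_intros\<close>)
    ultimately show "\<bar>(fdiff (h *\<^sub>R b) ^^ Suc N) (frac_symbol \<sigma>) \<xi>\<bar>
        \<le> min 1 (2 * norm \<xi> powr (2 * \<sigma>)) * (4 * real (Suc N) * h / (\<beta> * norm \<xi>)) ^ Suc N"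
      unfolding e iterated_fdiff_shift_const r_def hk by (auto simp: min_def)
  qed (use b1 in auto)
qed

text \<open>
  With \<open>\<theta> = \<delta>/n\<close>, the \<open>n\<close>-th power at \<open>|\<xi>|\<close> is \<open>|\<xi>|\<^bsup>\<delta>-n\<^esup>\<close> near the origin and \<open>|\<xi>|\<^bsup>-n-\<delta>\<^esup>\<close>
  at infinity. As a function that decreases in \<open>|r|\<close> it is compared with a product over the coordinates,
  which reduces integrability on \<open>\<real>\<^sup>n\<close> to the real line. Its value at \<open>0\<close> is \<open>0\<close>, because
  \<open>0 powr a = 0\<close>, so the comparison requires nonzero coordinates.
\<close>

definition frac_majorant :: "real \<Rightarrow> real \<Rightarrow> real" where
  "frac_majorant \<theta> r = (if \<bar>r\<bar> \<le> 1 then \<bar>r\<bar> powr (\<theta> - 1) else \<bar>r\<bar> powr (- 1 - \<theta>))"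

lemma frac_majorant_nonneg: "0 \<le> frac_majorant \<theta> r"
  by (simp add: frac_majorant_def)

lemma frac_majorant_antimono:
  assumes "0 < \<bar>s\<bar>" "\<bar>s\<bar> \<le> \<bar>r\<bar>" "0 < \<theta>" "\<theta> < 1"
  shows "frac_majorant \<theta> r \<le> frac_majorant \<theta> s"
proof -
  consider "\<bar>r\<bar> \<le> 1" | "\<bar>s\<bar> \<le> 1" "\<bar>r\<bar> > 1" | "\<bar>s\<bar> > 1" by linarith
  then show ?thesis
  proof cases
    case 1 then show ?thesis using assms by (auto simp: frac_majorant_def intro!: powr_mono2')
  next
    case 2
    have "\<bar>r\<bar> powr (- 1 - \<theta>) \<le> 1 powr (- 1 - \<theta>)" using 2 assms by (intro powr_mono2') auto
    moreover have "1 powr (\<theta> - 1) \<le> \<bar>s\<bar> powr (\<theta> - 1)" using 2 assms by (intro powr_mono2') auto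
    ultimately show ?thesis using 2 by (auto simp: frac_majorant_def)
  next
    case 3 then show ?thesis using assms by (auto simp: frac_majorant_def intro!: powr_mono2')
  qed
qed

lemma frac_symbol_minus_one: "\<bar>frac_symbol \<sigma> \<xi> - 1\<bar> \<le> norm \<xi> powr (2 * \<sigma>)"
proof -
  have "1 + (- (norm \<xi> powr (2 * \<sigma>))) \<le> frac_symbol \<sigma> \<xi>"
    unfolding frac_symbol_def by (rule exp_ge_add_one_self)
  moreover have "frac_symbol \<sigma> \<xi> \<le> 1" unfolding frac_symbol_def by simp
  ultimately show ?thesis by linarith
qed

lemma frac_majorant_power:
  assumes "r > 0" "n > 0"
  shows "frac_majorant (\<delta> / real n) r ^ n = (if r \<le> 1 then r powr (\<delta> - real n) else r powr (- (real n + \<delta>)))"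
proof -
  have "(\<delta> / real n - 1) * real n = \<delta> - real n" "(- 1 - \<delta> / real n) * real n = - (real n + \<delta>)"
    using assms by (auto simp: field_simps)
  then show ?thesis using assms by (simp add: frac_majorant_def powr_power mult.commute[of "real n"])
qed

text \<open>
  Two regimes, separated by \<open>|\<xi>| = A h\<close>. Far from the origin the Cauchy estimates give a power
  \<open>(A h / |\<xi>|)\<^bsup>n+1\<^esup>\<close>, of which \<open>n + \<delta>\<close> is used, together with the gain \<open>|\<xi>|\<^bsup>2\<sigma>\<^esup>\<close>. Near the
  origin all points involved have norm at most \<open>B h\<close>, so that the difference is \<open>O(h\<^bsup>2\<sigma>\<^esup>)\<close>. Since
  \<open>\<delta> \<le> \<sigma>\<close>, both are at most \<open>h\<^bsup>n+\<delta>\<^esup>\<close> times the same majorant.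
\<close>

lemma frac_symbol_difference_bound:
  assumes \<sigma>: "\<sigma> > 0" and \<delta>: "0 < \<delta>" "\<delta> \<le> \<sigma>" "\<delta> \<le> 1"
  obtains C h0 where "C > 0" "0 < h0" "h0 \<le> 1"
    and "\<And>h b \<xi> :: 'a::euclidean_space. norm b = 1 \<Longrightarrow> \<xi> \<noteq> 0 \<Longrightarrow> 0 < h \<Longrightarrow> h \<le> h0 \<Longrightarrow>
      \<bar>(fdiff (h *\<^sub>R b) ^^ Suc DIM('a)) (frac_symbol \<sigma>) \<xi>\<bar>
        \<le> C * h powr (real DIM('a) + \<delta>) * frac_majorant (\<delta> / real DIM('a)) (norm \<xi>) ^ DIM('a)"
proof -
  define n where "n = DIM('a)"
  have n: "n > 0" "real n \<ge> 1" by (simp_all add: n_def DIM_positive Suc_leI)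
  obtain \<beta> where b0: "0 < \<beta>" and b1: "\<beta> \<le> 1"
    and far: "\<And>N h b \<xi> :: 'a. norm b = 1 \<Longrightarrow> \<xi> \<noteq> 0 \<Longrightarrow> 0 < h \<Longrightarrow>
      4 * real (Suc N) * h \<le> \<beta> * norm \<xi> \<Longrightarrow>
      \<bar>(fdiff (h *\<^sub>R b) ^^ Suc N) (frac_symbol \<sigma>) \<xi>\<bar>
        \<le> min 1 (2 * norm \<xi> powr (2 * \<sigma>)) * (4 * real (Suc N) * h / (\<beta> * norm \<xi>)) ^ Suc N"
    using frac_symbol_difference_far[OF \<sigma>] by metis
  \<comment> \<open>\<open>|\<xi>| \<ge> A h\<close> is the range of the Cauchy estimates\<close>
  define A where "A = 4 * real (Suc n) / \<beta>"
  have A: "A \<ge> 1" using b0 b1 by (simp add: A_def field_simps)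
  define B where "B = A + real (Suc n)"
  define C1 where "C1 = 2 * A powr (real n + \<delta>)"
  define C2 where "C2 = 2 ^ Suc n * B powr (2 * \<sigma>) * A powr (real n - \<delta>)"
  have C12: "C1 > 0" "C2 > 0" using A by (auto simp: C1_def C2_def B_def)
  define C where "C = C1 + C2"
  show ?thesis
  proof (rule that[of C "1 / A"])
    show "C > 0" using C12 by (simp add: C_def)
    show "0 < 1 / A" "1 / A \<le> 1" using A by auto
    fix h and b \<xi> :: 'a
    assume nb: "norm b = 1" and x0: "\<xi> \<noteq> 0" and h: "0 < h" "h \<le> 1 / A"
    define r where "r = norm \<xi>"
    have r: "r > 0" using x0 by (simp add: r_def)
    have Ah: "A * h \<le> 1" using h A by (simp add: field_simps)
    have h1: "h \<le> 1" using h A by (metis \<open>1 / A \<le> 1\<close> order_trans)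
    let ?k = "frac_majorant (\<delta> / real n) r ^ n"
    let ?D = "\<bar>(fdiff (h *\<^sub>R b) ^^ Suc n) (frac_symbol \<sigma>) \<xi>\<bar>"
    have k0: "?k \<ge> 0" by (simp add: frac_majorant_nonneg)
    have hp: "h powr (real n + \<delta>) \<ge> 0" by simp
    have *: "X \<le> C * h powr (real n + \<delta>) * ?k"
      if "X \<le> C1 * (h powr (real n + \<delta>) * ?k) \<or> X \<le> C2 * (h powr (real n + \<delta>) * ?k)" for X
    proof -
      have "0 \<le> C1 * (h powr (real n + \<delta>) * ?k)" "0 \<le> C2 * (h powr (real n + \<delta>) * ?k)"
        using C12 k0 by (auto intro!: mult_nonneg_nonneg)
      then show ?thesis using that unfolding C_def by (auto simp: algebra_simps)
    qed
    have "?D \<le> C1 * (h powr (real n + \<delta>) * ?k) \<or> ?D \<le> C2 * (h powr (real n + \<delta>) * ?k)"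
    proof (cases "A * h \<le> r")
      case True
      have X1: "A * h / r \<le> 1" "A * h / r > 0" using True r A h by auto
      have "?D \<le> min 1 (2 * r powr (2 * \<sigma>)) * (4 * real (Suc n) * h / (\<beta> * r)) ^ Suc n"
        unfolding r_def by (rule far[OF nb x0 h(1)]) (use True b0 in \<open>simp add: A_def r_def field_simps\<close>)
      also have "4 * real (Suc n) * h / (\<beta> * r) = A * h / r" by (simp add: A_def)
      also have "(A * h / r) ^ Suc n = (A * h / r) powr real (Suc n)" using X1 by (subst powr_realpow) auto
      also have "min 1 (2 * r powr (2 * \<sigma>)) * \<dots> \<le> min 1 (2 * r powr (2 * \<sigma>)) * (A * h / r) powr (real n + \<delta>)"
        using X1 \<delta> by (intro mult_left_mono powr_mono') auto
      also have "(A * h / r) powr (real n + \<delta>) = A powr (real n + \<delta>) * h powr (real n + \<delta>) * r powr (- (real n + \<delta>))"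
        using A h r powr_minus_divide[of r "real n + \<delta>"] by (simp add: powr_divide powr_mult)
      finally have D: "?D \<le> min 1 (2 * r powr (2 * \<sigma>)) * (A powr (real n + \<delta>) * h powr (real n + \<delta>) * r powr (- (real n + \<delta>)))" .
      have "min 1 (2 * r powr (2 * \<sigma>)) * r powr (- (real n + \<delta>)) \<le> 2 * ?k"
      proof (cases "r \<le> 1")
        case True
        have "min 1 (2 * r powr (2 * \<sigma>)) \<le> 2 * r powr (2 * \<delta>)"
          using True r \<delta> by (intro order_trans[OF min.cobounded2] mult_left_mono powr_mono') auto
        then have "min 1 (2 * r powr (2 * \<sigma>)) * r powr (- (real n + \<delta>)) \<le> 2 * r powr (2 * \<delta>) * r powr (- (real n + \<delta>))"
          by (rule mult_right_mono) simp
        also have "\<dots> = 2 * r powr (\<delta> - real n)" by (simp add: powr_add[symmetric])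
        finally show ?thesis using True r n by (simp add: frac_majorant_power)
      next
        case False
        have "min 1 (2 * r powr (2 * \<sigma>)) * r powr (- (real n + \<delta>)) \<le> 1 * r powr (- (real n + \<delta>))"
          by (rule mult_right_mono) auto
        also have "\<dots> \<le> 2 * r powr (- (real n + \<delta>))" by simp
        finally show ?thesis using False r n by (simp add: frac_majorant_power)
      qed
      from mult_left_mono[OF this, of "A powr (real n + \<delta>) * h powr (real n + \<delta>)"] D
      have "?D \<le> C1 * (h powr (real n + \<delta>) * ?k)" by (simp add: C1_def mult_ac)
      then show ?thesis ..
    next
      case False
      then have rA: "r < A * h" by simp
      have "?D = norm ((fdiff (h *\<^sub>R b) ^^ Suc n) (\<lambda>\<xi>. frac_symbol \<sigma> \<xi> - 1) \<xi>)"
        by (simp only: iterated_fdiff_shift_const real_norm_def)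
      also have "\<dots> \<le> 2 ^ Suc n * ((B * h) powr (2 * \<sigma>))"
      proof (rule iterated_fdiff_trivial_bound)
        fix j assume j: "j \<le> Suc n"
        have "norm (\<xi> + real j *\<^sub>R h *\<^sub>R b) \<le> r + real j * h"
          using norm_triangle_ineq[of \<xi> "real j *\<^sub>R h *\<^sub>R b"] nb h by (simp add: r_def)
        also have "\<dots> \<le> A * h + real (Suc n) * h"
          using rA j h by (intro add_mono mult_right_mono) auto
        finally have "norm (\<xi> + real j *\<^sub>R h *\<^sub>R b) \<le> B * h" by (simp add: B_def algebra_simps)
        then show "norm (frac_symbol \<sigma> (\<xi> + real j *\<^sub>R h *\<^sub>R b) - 1) \<le> (B * h) powr (2 * \<sigma>)"
          using \<sigma> by (auto intro!: order_trans[OF frac_symbol_minus_one] powr_mono2)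
      qed
      finally have D: "?D \<le> 2 ^ Suc n * ((B * h) powr (2 * \<sigma>))" .
      have "h powr (2 * \<sigma>) \<le> h powr (2 * \<delta>)" using h h1 \<delta> by (intro powr_mono') auto
      also have "\<dots> = h powr (real n + \<delta>) * h powr (\<delta> - real n)"
        by (simp add: powr_add[symmetric])
      also have "\<dots> \<le> h powr (real n + \<delta>) * (r / A) powr (\<delta> - real n)"
        using r A rA n \<delta> by (intro mult_left_mono powr_mono2') (auto simp: field_simps)
      also have "(r / A) powr (\<delta> - real n) = A powr (real n - \<delta>) * r powr (\<delta> - real n)"
        using r A powr_minus_divide[of A "real n - \<delta>"] by (simp add: powr_divide)
      also have "r powr (\<delta> - real n) = ?k" using rA Ah r n by (simp add: frac_majorant_power)
      finally have hs: "h powr (2 * \<sigma>) \<le> h powr (real n + \<delta>) * (A powr (real n - \<delta>) * ?k)" .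
      have "(B * h) powr (2 * \<sigma>) = B powr (2 * \<sigma>) * h powr (2 * \<sigma>)"
        using A h by (simp add: powr_mult B_def)
      also have "\<dots> \<le> B powr (2 * \<sigma>) * (h powr (real n + \<delta>) * (A powr (real n - \<delta>) * ?k))"
        by (rule mult_left_mono[OF hs]) simp
      finally have "2 ^ Suc n * ((B * h) powr (2 * \<sigma>))
          \<le> 2 ^ Suc n * (B powr (2 * \<sigma>) * (h powr (real n + \<delta>) * (A powr (real n - \<delta>) * ?k)))"
        by (rule mult_left_mono) simp
      also have "\<dots> = C2 * (h powr (real n + \<delta>) * ?k)"
        by (simp add: C2_def mult_ac)
      finally have "?D \<le> C2 * (h powr (real n + \<delta>) * ?k)" using D by (rule order_trans[rotated])
      then show ?thesis ..
    qed
    from *[OF this]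
    show "\<bar>(fdiff (h *\<^sub>R b) ^^ Suc DIM('a)) (frac_symbol \<sigma>) \<xi>\<bar>
        \<le> C * h powr (real DIM('a) + \<delta>) * frac_majorant (\<delta> / real DIM('a)) (norm \<xi>) ^ DIM('a)"
      by (simp only: n_def r_def)
  qed
qed

section \<open>Integrable majorants of product form\<close>

lemma frac_majorant_measurable [measurable]: "frac_majorant \<theta> \<in> borel_measurable borel"
  unfolding frac_majorant_def[abs_def] by measurable

text \<open>
  The exponents \<open>\<theta> - 1\<close> at the origin and \<open>-1 - \<theta>\<close> at infinity lie on the integrable sides of \<open>-1\<close>.
\<close>

lemma nn_integral_frac_majorant_finite:
  assumes "0 < \<theta>"
  shows "(\<integral>\<^sup>+ r. ennreal (frac_majorant \<theta> r) \<partial>lborel) < \<infinity>"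
proof -
  define g where "g x = indicat_real {0..1} x *\<^sub>R x powr (\<theta> - 1) + indicat_real {1..} x *\<^sub>R x powr (- 1 - \<theta>)" for x :: real
  have "(\<lambda>x. x powr (\<theta> - 1)) integrable_on {0..1}"
    using integrable_on_powr_from_0[of "\<theta> - 1" 1] assms by simp
  then have "set_integrable lebesgue {0..1} (\<lambda>x. x powr (\<theta> - 1))"
    by (intro nonnegative_absolutely_integrable_1) auto
  then have 1: "integrable lborel (\<lambda>x. indicat_real {0..1} x *\<^sub>R x powr (\<theta> - 1))"
    unfolding set_integrable_def by (subst (asm) integrable_completion) auto
  have "(\<lambda>x. x powr (- 1 - \<theta>)) integrable_on {1..}"
    using has_integral_powr_to_inf[of "- 1 - \<theta>" 1] assms by (auto simp: integrable_on_def)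
  then have "set_integrable lebesgue {1..} (\<lambda>x. x powr (- 1 - \<theta>))"
    by (intro nonnegative_absolutely_integrable_1) auto
  then have 2: "integrable lborel (\<lambda>x. indicat_real {1..} x *\<^sub>R x powr (- 1 - \<theta>))"
    unfolding set_integrable_def by (subst (asm) integrable_completion) auto
  have g: "integrable lborel g" unfolding g_def using 1 2 by (rule Bochner_Integration.integrable_add)
  have g': "integrable lborel (\<lambda>x. g (- x))"
    using lborel_integrable_real_affine[OF g, of "-1" 0] by simp
  have "integrable lborel (frac_majorant \<theta>)"
  proof (rule Bochner_Integration.integrable_bound[OF Bochner_Integration.integrable_add[OF g g']])
    show "AE x in lborel. norm (frac_majorant \<theta> x) \<le> norm (g x + g (- x))"
      by (rule AE_I2) (auto simp: frac_majorant_def g_def indicator_def)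
  qed simp
  then show ?thesis
    using frac_majorant_nonneg by (simp add: integrable_iff_bounded)
qed

definition product_majorant :: "real \<Rightarrow> 'a::euclidean_space \<Rightarrow> real" where
  "product_majorant \<theta> x = (\<Prod>b\<in>Basis. frac_majorant \<theta> (x \<bullet> b))"

lemma product_majorant_nonneg: "0 \<le> product_majorant \<theta> x"
  by (simp add: product_majorant_def frac_majorant_nonneg prod_nonneg)

lemma product_majorant_measurable [measurable]: "product_majorant \<theta> \<in> borel_measurable borel"
  unfolding product_majorant_def[abs_def] by measurable

lemma integrable_product_majorant:
  assumes "0 < \<theta>"
  shows "integrable lborel (product_majorant \<theta> :: 'a::euclidean_space \<Rightarrow> real)"
proof -
  have "(\<integral>\<^sup>+ x. ennreal (product_majorant \<theta> (x::'a)) \<partial>lborel)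
      = (\<integral>\<^sup>+ x. (\<Prod>b\<in>Basis. ennreal (frac_majorant \<theta> ((x::'a) \<bullet> b))) \<partial>lborel)"
    by (simp add: product_majorant_def prod_ennreal frac_majorant_nonneg)
  also have "\<dots> = (\<Prod>b\<in>(Basis::'a set). (\<integral>\<^sup>+ r. ennreal (frac_majorant \<theta> r) \<partial>lborel))"
    by (rule nn_integral_lborel_prod) auto
  also have "\<dots> < \<infinity>"
    using nn_integral_frac_majorant_finite[OF assms] by (simp add: power_less_top_ennreal less_top)
  finally show ?thesis
    by (simp add: integrable_iff_bounded product_majorant_nonneg)
qed

lemma AE_coordinates_nonzero: "AE x in lborel. \<forall>b\<in>Basis. (x::'a::euclidean_space) \<bullet> b \<noteq> 0"
proof -
  have "AE x in lborel. (x::'a) \<bullet> b \<noteq> 0" if "b \<in> Basis" for b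
  proof -
    have "negligible {x::'a. x \<bullet> b = 0}" by (rule negligible_standard_hyperplane[OF that])
    moreover have "closed {x::'a. x \<bullet> b = 0}" by (intro closed_Collect_eq continuous_intros)
    ultimately have "{x::'a. x \<bullet> b = 0} \<in> null_sets lborel"
      by (simp add: negligible_iff_null_sets null_sets_completion_iff borel_closed)
    from AE_not_in[OF this] show ?thesis by simp
  qed
  then show ?thesis by (intro AE_finite_allI) auto
qed

lemma frac_majorant_norm_le_product:
  fixes x :: "'a::euclidean_space"
  assumes "\<forall>b\<in>Basis. x \<bullet> b \<noteq> 0" "0 < \<theta>" "\<theta> < 1"
  shows "frac_majorant \<theta> (norm x) ^ DIM('a) \<le> product_majorant \<theta> x"
proof -
  have "(\<Prod>b\<in>(Basis::'a set). frac_majorant \<theta> (norm x)) \<le> (\<Prod>b\<in>Basis. frac_majorant \<theta> (x \<bullet> b))"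
    using assms by (intro prod_mono conjI frac_majorant_nonneg frac_majorant_antimono)
      (auto simp: Basis_le_norm)
  then show ?thesis by (simp add: product_majorant_def)
qed

lemma frac_symbol_measurable [measurable]: "frac_symbol \<sigma> \<in> borel_measurable borel"
  unfolding frac_symbol_def[abs_def] by measurable

lemma frac_symbol_pos: "0 < frac_symbol \<sigma> \<xi>" and frac_symbol_le_1: "frac_symbol \<sigma> \<xi> \<le> 1"
  by (simp_all add: frac_symbol_def)

text \<open>
  One term of the exponential series already dominates any power.
\<close>

lemma exp_powr_decay:
  assumes "\<sigma> > 0" "c > 0" "e \<ge> 0"
  obtains C where "C > 0" "\<And>r::real. r > 1 \<Longrightarrow> exp (- (c * r powr (2 * \<sigma>))) \<le> C * r powr (- e)"
proof -
  obtain m :: nat where m: "real m \<ge> e / (2 * \<sigma>)" using real_arch_simple by blast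
  show ?thesis
  proof (rule that[of "fact m / c ^ m"])
    show "0 < fact m / c ^ m" using assms by simp
    fix r :: real assume r: "r > 1"
    define y where "y = c * r powr (2 * \<sigma>)"
    have y: "y > 0" using assms r by (simp add: y_def)
    have "(\<Sum>k\<in>{m}. y ^ k /\<^sub>R fact k) \<le> exp y"
      unfolding exp_def using y
      by (intro sum_le_suminf[OF summable_exp_generic]) auto
    then have "y ^ m / fact m \<le> exp y" by (simp add: divide_inverse mult.commute)
    then have "exp (- y) \<le> fact m / y ^ m"
      using y by (simp add: exp_minus field_simps)
    also have "\<dots> = fact m / c ^ m * r powr (- (real m * (2 * \<sigma>)))"
      using r powr_minus_divide[of r "real m * (2 * \<sigma>)"]
      by (simp add: y_def power_mult_distrib powr_power)
    also have "r powr (- (real m * (2 * \<sigma>))) \<le> r powr (- e)"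
      using m assms r by (intro powr_mono) (auto simp: field_simps)
    finally show "exp (- (c * r powr (2 * \<sigma>))) \<le> fact m / c ^ m * r powr (- e)"
      using assms by (simp add: y_def divide_right_mono mult_left_mono)
  qed
qed

lemma integrable_frac_symbol_powr:
  assumes "\<sigma> > 0" "c > 0"
  shows "integrable lborel (\<lambda>\<xi>::'a::euclidean_space. frac_symbol \<sigma> \<xi> powr c)"
proof -
  define n where "n = DIM('a)"
  have n: "n > 0" by (simp add: n_def)
  define \<theta> where "\<theta> = (1 / 2) / real n"
  have th: "0 < \<theta>" "\<theta> < 1" using n by (auto simp: \<theta>_def field_simps)
  obtain C where C: "C > 0" "\<And>r::real. r > 1 \<Longrightarrow> exp (- (c * r powr (2 * \<sigma>))) \<le> C * r powr (- (real n + 1 / 2))"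
    using exp_powr_decay[OF assms, of "real n + 1 / 2"] by auto
  have bd: "frac_symbol \<sigma> \<xi> powr c \<le> (1 + C) * frac_majorant \<theta> (norm \<xi>) ^ n" if "\<xi> \<noteq> 0" for \<xi> :: 'a
  proof -
    have e: "frac_symbol \<sigma> \<xi> powr c = exp (- (c * norm \<xi> powr (2 * \<sigma>)))"
      by (simp add: frac_symbol_def powr_def)
    have k0: "frac_majorant \<theta> (norm \<xi>) ^ n \<ge> 0" by (simp add: frac_majorant_nonneg)
    show ?thesis
    proof (cases "norm \<xi> \<le> 1")
      case True
      have "1 = 1 powr (1 / 2 - real n)" by simp
      also have "\<dots> \<le> norm \<xi> powr (1 / 2 - real n)"
        using True that n by (intro powr_mono2') auto
      also have "\<dots> = frac_majorant \<theta> (norm \<xi>) ^ n"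
        unfolding \<theta>_def using True that n by (subst frac_majorant_power) auto
      finally have "1 \<le> frac_majorant \<theta> (norm \<xi>) ^ n" .
      moreover have "frac_symbol \<sigma> \<xi> powr c \<le> 1" unfolding e using assms by simp
      ultimately have "frac_symbol \<sigma> \<xi> powr c \<le> 1 * frac_majorant \<theta> (norm \<xi>) ^ n" by simp
      also have "\<dots> \<le> (1 + C) * frac_majorant \<theta> (norm \<xi>) ^ n" using C k0 by (intro mult_right_mono) auto
      finally show ?thesis .
    next
      case False
      have "frac_symbol \<sigma> \<xi> powr c \<le> C * frac_majorant \<theta> (norm \<xi>) ^ n"
        unfolding e \<theta>_def using C(2)[of "norm \<xi>"] False that n by (subst frac_majorant_power) auto
      also have "\<dots> \<le> (1 + C) * frac_majorant \<theta> (norm \<xi>) ^ n" using k0 by (intro mult_right_mono) auto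
      finally show ?thesis .
    qed
  qed
  show ?thesis
  proof (rule Bochner_Integration.integrable_bound)
    show "integrable lborel (\<lambda>\<xi>::'a. (1 + C) * product_majorant \<theta> \<xi>)"
      by (intro integrable_mult_right integrable_product_majorant th)
    show "AE \<xi>::'a in lborel. norm (frac_symbol \<sigma> \<xi> powr c) \<le> norm ((1 + C) * product_majorant \<theta> \<xi>)"
      using AE_coordinates_nonzero
    proof eventually_elim
      case (elim \<xi>)
      then have "\<xi> \<noteq> 0" by auto
      from bd[OF this] have "frac_symbol \<sigma> \<xi> powr c \<le> (1 + C) * frac_majorant \<theta> (norm \<xi>) ^ n" .
      also have "\<dots> \<le> (1 + C) * product_majorant \<theta> \<xi>"
        using frac_majorant_norm_le_product[OF elim th] C(1) by (intro mult_left_mono) (auto simp: n_def)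
      finally show ?case by (simp add: abs_of_nonneg product_majorant_nonneg C(1) less_imp_le)
    qed
  qed measurable
qed

section \<open>Decay of the kernel at time one\<close>

definition fourier_integral :: "('a::euclidean_space \<Rightarrow> real) \<Rightarrow> 'a \<Rightarrow> complex" where
  "fourier_integral g x = (\<integral>\<xi>. exp (\<i> * complex_of_real (x \<bullet> \<xi>)) * of_real (g \<xi>) \<partial>lborel)"

lemma integrable_fourier_integrand:
  fixes g :: "'a::euclidean_space \<Rightarrow> real"
  assumes "integrable lborel g"
  shows "integrable lborel (\<lambda>\<xi>. exp (\<i> * complex_of_real (x \<bullet> \<xi>)) * of_real (g \<xi>))"
proof (rule Bochner_Integration.integrable_bound[OF assms])
  have [measurable]: "g \<in> borel_measurable borel" using assms by auto
  show "(\<lambda>\<xi>. exp (\<i> * complex_of_real (x \<bullet> \<xi>)) * of_real (g \<xi>)) \<in> borel_measurable lborel"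
    by measurable
qed (auto simp: norm_mult)

lemma norm_fourier_integral_le:
  assumes "integrable lborel g"
  shows "norm (fourier_integral g x) \<le> (\<integral>\<xi>. \<bar>g \<xi>\<bar> \<partial>lborel)"
proof -
  have "norm (fourier_integral g x) \<le> (\<integral>\<xi>. norm (exp (\<i> * complex_of_real (x \<bullet> \<xi>)) * of_real (g \<xi>)) \<partial>lborel)"
    unfolding fourier_integral_def by (rule integral_norm_bound)
  then show ?thesis by (simp add: norm_mult)
qed

lemma integrable_lborel_translation:
  fixes g :: "'a::euclidean_space \<Rightarrow> 'b::{banach, second_countable_topology}"
  shows "integrable lborel g \<Longrightarrow> integrable lborel (\<lambda>x. g (x + h))"
  using integrable_distr_eq[of "(+) h" lborel borel g]
  unfolding lborel_distr_plus by (simp add: add.commute borel_measurable_integrable)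

lemma integral_lborel_translation:
  fixes g :: "'a::euclidean_space \<Rightarrow> 'b::{banach, second_countable_topology}"
  assumes "g \<in> borel_measurable borel"
  shows "(\<integral>x. g (x + h) \<partial>lborel) = (\<integral>x. g x \<partial>lborel)"
  using integral_distr[of "(+) h" lborel borel g] assms
  unfolding lborel_distr_plus by (simp add: add.commute)

text \<open>
  Translation by \<open>h\<close> becomes multiplication by a phase.
\<close>

lemma fourier_integral_fdiff:
  assumes g: "integrable lborel g"
  shows "integrable lborel (fdiff h g)"
    and "fourier_integral (fdiff h g) x = (exp (- \<i> * complex_of_real (x \<bullet> h)) - 1) * fourier_integral g x"
proof -
  have gh: "integrable lborel (\<lambda>\<xi>. g (\<xi> + h))" by (rule integrable_lborel_translation[OF g])
  then show "integrable lborel (fdiff h g)" unfolding fdiff_def[abs_def] using g by simp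
  have [measurable]: "g \<in> borel_measurable borel" using g by auto
  let ?e = "\<lambda>\<xi>. exp (\<i> * complex_of_real (x \<bullet> \<xi>)) * of_real (g \<xi>)"
  have "fourier_integral (fdiff h g) x =
      (\<integral>\<xi>. exp (\<i> * complex_of_real (x \<bullet> \<xi>)) * of_real (g (\<xi> + h)) - ?e \<xi> \<partial>lborel)"
    unfolding fourier_integral_def by (simp add: fdiff_def right_diff_distrib)
  also have "\<dots> = (\<integral>\<xi>. exp (\<i> * complex_of_real (x \<bullet> \<xi>)) * of_real (g (\<xi> + h)) \<partial>lborel) - fourier_integral g x"
    unfolding fourier_integral_def
    by (rule Bochner_Integration.integral_diff) (intro integrable_fourier_integrand gh g)+
  also have "(\<integral>\<xi>. exp (\<i> * complex_of_real (x \<bullet> \<xi>)) * of_real (g (\<xi> + h)) \<partial>lborel)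
      = (\<integral>\<xi>. exp (- \<i> * complex_of_real (x \<bullet> h)) * ?e (\<xi> + h) \<partial>lborel)"
    by (rule Bochner_Integration.integral_cong) (auto simp: inner_add_right distrib_left simp flip: exp_add mult.assoc)
  also have "\<dots> = exp (- \<i> * complex_of_real (x \<bullet> h)) * (\<integral>\<xi>. ?e (\<xi> + h) \<partial>lborel)"
    by simp
  also have "(\<integral>\<xi>. ?e (\<xi> + h) \<partial>lborel) = fourier_integral g x"
    unfolding fourier_integral_def by (rule integral_lborel_translation[of ?e]) measurable
  finally show "fourier_integral (fdiff h g) x = (exp (- \<i> * complex_of_real (x \<bullet> h)) - 1) * fourier_integral g x"
    by (simp add: left_diff_distrib)
qed

lemma fourier_integral_iterated_fdiff:
  assumes g: "integrable lborel g"
  shows "integrable lborel ((fdiff h ^^ N) g)"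
    and "fourier_integral ((fdiff h ^^ N) g) x
      = (exp (- \<i> * complex_of_real (x \<bullet> h)) - 1) ^ N * fourier_integral g x"
proof (induction N)
  case 0
  { case 1 show ?case using g by simp }
  { case 2 show ?case by simp }
next
  case (Suc N)
  { case 1 show ?case using fourier_integral_fdiff(1)[OF Suc(1)] by simp }
  { case 2 show ?case using fourier_integral_fdiff(2)[OF Suc(1)] Suc(2) by simp }
qed

lemma frac_symbol_powr_one: "(\<lambda>\<xi>. frac_symbol \<sigma> \<xi> powr 1) = frac_symbol \<sigma>"
  by (rule ext) (simp add: frac_symbol_def)

lemma integrable_frac_symbol:
  assumes "\<sigma> > 0" shows "integrable lborel (frac_symbol \<sigma> :: 'a::euclidean_space \<Rightarrow> real)"
  using integrable_frac_symbol_powr[OF assms, of 1, where 'a = 'a] unfolding frac_symbol_powr_one by simp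

text \<open>
  For the step \<open>h = \<pi> / |x\<^sub>b|\<close> the phase \<open>exp (-i x \<bullet> h b)\<close> is \<open>-1\<close>, so each difference doubles the
  Fourier integral in modulus. Small \<open>|x\<^sub>b|\<close>, for which \<open>h\<close> would be too large, are covered by
  the trivial bound.
\<close>

lemma fourier_frac_symbol_decay:
  fixes \<sigma> :: real
  assumes \<sigma>: "\<sigma> > 0"
  obtains C \<delta> where "C > 0" "0 < \<delta>" "\<delta> < 1"
    and "\<And>(x::'a::euclidean_space) b. b \<in> Basis \<Longrightarrow>
      norm (fourier_integral (frac_symbol \<sigma>) x) \<le> C * max 1 \<bar>x \<bullet> b\<bar> powr (- (real DIM('a) + \<delta>))"
proof -
  define n where "n = DIM('a)"
  have n: "real n \<ge> 1" by (simp add: n_def DIM_positive Suc_leI)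
  \<comment> \<open>strictly below \<open>1\<close>, so that \<open>\<theta> = \<delta>/n < 1\<close> also for \<open>n = 1\<close>\<close>
  define \<delta> where "\<delta> = min \<sigma> (1 / 2)"
  have d: "0 < \<delta>" "\<delta> \<le> \<sigma>" "\<delta> \<le> 1" "\<delta> < 1" using \<sigma> by (auto simp: \<delta>_def)
  have th: "0 < \<delta> / real n" "\<delta> / real n < 1" using d n by (auto simp: field_simps)
  let ?f = "frac_symbol \<sigma> :: 'a \<Rightarrow> real"
  note fi = integrable_frac_symbol[OF \<sigma>, where 'a = 'a]
  obtain C h0 where C: "C > 0" and h0: "0 < h0" "h0 \<le> 1"
    and diff: "\<And>h b \<xi> :: 'a. norm b = 1 \<Longrightarrow> \<xi> \<noteq> 0 \<Longrightarrow> 0 < h \<Longrightarrow> h \<le> h0 \<Longrightarrow>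
      \<bar>(fdiff (h *\<^sub>R b) ^^ Suc n) ?f \<xi>\<bar>
        \<le> C * h powr (real n + \<delta>) * frac_majorant (\<delta> / real n) (norm \<xi>) ^ n"
    using frac_symbol_difference_bound[OF \<sigma> d(1-3), where 'a = 'a] unfolding n_def by metis
  define I where "I = (\<integral>\<xi>. product_majorant (\<delta> / real n) (\<xi>::'a) \<partial>lborel)"
  have I: "I \<ge> 0" unfolding I_def by (intro integral_nonneg_AE AE_I2 product_majorant_nonneg)
  define J where "J = (\<integral>\<xi>. \<bar>?f \<xi>\<bar> \<partial>lborel)"
  have J: "J \<ge> 0" unfolding J_def by (intro integral_nonneg_AE AE_I2) simp
  \<comment> \<open>\<open>|x\<^sub>b| \<ge> X0\<close> makes the step \<open>\<pi> / |x\<^sub>b|\<close> at most \<open>h0\<close>\<close>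
  define X0 where "X0 = pi / h0"
  have X0: "X0 \<ge> 1" using h0 pi_ge_two by (simp add: X0_def field_simps)
  have far: "norm (fourier_integral ?f x) \<le> C * I * pi powr (real n + \<delta>) * \<bar>x \<bullet> b\<bar> powr (- (real n + \<delta>))"
    if b: "b \<in> Basis" and xb: "\<bar>x \<bullet> b\<bar> \<ge> X0" for x b
  proof -
    define h where "h = pi / \<bar>x \<bullet> b\<bar>"
    have pos: "\<bar>x \<bullet> b\<bar> > 0" using xb X0 by linarith
    have h: "0 < h" "h \<le> h0" using pos xb h0 by (auto simp: h_def X0_def field_simps)
    have "x \<bullet> (h *\<^sub>R b) = pi \<or> x \<bullet> (h *\<^sub>R b) = - pi"
      using pos by (auto simp: h_def field_simps abs_if)
    then have e: "exp (- \<i> * complex_of_real (x \<bullet> (h *\<^sub>R b))) = -1"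
      by (elim disjE; simp only:; simp add: exp_minus)
    have "2 ^ Suc n * norm (fourier_integral ?f x) = norm (fourier_integral ((fdiff (h *\<^sub>R b) ^^ Suc n) ?f) x)"
      unfolding fourier_integral_iterated_fdiff(2)[OF fi] e by (simp add: norm_mult norm_power)
    also have "\<dots> \<le> (\<integral>\<xi>. \<bar>(fdiff (h *\<^sub>R b) ^^ Suc n) ?f \<xi>\<bar> \<partial>lborel)"
      by (rule norm_fourier_integral_le[OF fourier_integral_iterated_fdiff(1)[OF fi]])
    also have "\<dots> \<le> (\<integral>\<xi>. C * h powr (real n + \<delta>) * product_majorant (\<delta> / real n) (\<xi>::'a) \<partial>lborel)"
    proof (rule integral_mono_AE)
      show "integrable lborel (\<lambda>\<xi>. \<bar>(fdiff (h *\<^sub>R b) ^^ Suc n) ?f \<xi>\<bar>)"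
        by (intro integrable_abs fourier_integral_iterated_fdiff(1)[OF fi])
      show "integrable lborel (\<lambda>\<xi>::'a. C * h powr (real n + \<delta>) * product_majorant (\<delta> / real n) \<xi>)"
        by (intro integrable_mult_right integrable_product_majorant th)
      show "AE \<xi> in lborel. \<bar>(fdiff (h *\<^sub>R b) ^^ Suc n) ?f \<xi>\<bar>
          \<le> C * h powr (real n + \<delta>) * product_majorant (\<delta> / real n) \<xi>"
        using AE_coordinates_nonzero
      proof eventually_elim
        case (elim \<xi>)
        then have "\<xi> \<noteq> 0" using b by auto
        have "\<bar>(fdiff (h *\<^sub>R b) ^^ Suc n) ?f \<xi>\<bar> \<le> C * h powr (real n + \<delta>) * frac_majorant (\<delta> / real n) (norm \<xi>) ^ n"
          by (rule diff[OF _ \<open>\<xi> \<noteq> 0\<close> h]) (simp add: b)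
        also have "\<dots> \<le> C * h powr (real n + \<delta>) * product_majorant (\<delta> / real n) \<xi>"
          using frac_majorant_norm_le_product[OF elim th] C by (intro mult_left_mono) (auto simp: n_def)
        finally show ?case .
      qed
    qed
    also have "\<dots> = C * h powr (real n + \<delta>) * I" by (simp add: I_def)
    finally have "2 ^ Suc n * norm (fourier_integral ?f x) \<le> C * h powr (real n + \<delta>) * I" .
    moreover have "1 * norm (fourier_integral ?f x) \<le> 2 ^ Suc n * norm (fourier_integral ?f x)"
      by (intro mult_right_mono one_le_power) auto
    ultimately have "norm (fourier_integral ?f x) \<le> C * h powr (real n + \<delta>) * I" by linarith
    also have "h powr (real n + \<delta>) = pi powr (real n + \<delta>) * \<bar>x \<bullet> b\<bar> powr (- (real n + \<delta>))"
      using pos powr_minus_divide[of "\<bar>x \<bullet> b\<bar>" "real n + \<delta>"] by (simp add: h_def powr_divide)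
    finally show ?thesis by (simp add: mult_ac)
  qed
  define C3 where "C3 = C * I * pi powr (real n + \<delta>) + J * X0 powr (real n + \<delta>) + 1"
  have C3: "C3 > 0" using C I J by (simp add: C3_def add_nonneg_pos)
  show ?thesis
  proof (rule that[OF C3 d(1) d(4)])
    fix x b :: 'a assume b: "b \<in> Basis"
    let ?p = "max 1 \<bar>x \<bullet> b\<bar> powr (- (real n + \<delta>))"
    have "norm (fourier_integral ?f x) \<le> C3 * ?p"
    proof (cases "\<bar>x \<bullet> b\<bar> \<ge> X0")
      case True
      then have "norm (fourier_integral ?f x) \<le> C * I * pi powr (real n + \<delta>) * ?p"
        using far[OF b True] X0 by (simp add: max_def)
      also have "\<dots> \<le> C3 * ?p"
        using J by (intro mult_right_mono) (auto simp: C3_def)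
      finally show ?thesis .
    next
      case False
      have "norm (fourier_integral ?f x) \<le> J * 1"
        using norm_fourier_integral_le[OF fi] by (simp add: J_def)
      also have "\<dots> \<le> J * (X0 powr (real n + \<delta>) * ?p)"
      proof (rule mult_left_mono[OF _ J])
        have "X0 powr (- (real n + \<delta>)) \<le> ?p"
          using False X0 d n by (intro powr_mono2') auto
        then have "X0 powr (real n + \<delta>) * X0 powr (- (real n + \<delta>)) \<le> X0 powr (real n + \<delta>) * ?p"
          by (rule mult_left_mono) simp
        then show "1 \<le> X0 powr (real n + \<delta>) * ?p" using X0 by (simp flip: powr_add)
      qed
      also have "\<dots> \<le> C3 * ?p"
        unfolding mult.assoc[symmetric] using C I by (intro mult_right_mono) (auto simp: C3_def)
      finally show ?thesis .
    qed
    then show "norm (fourier_integral ?f x) \<le> C3 * max 1 \<bar>x \<bullet> b\<bar> powr (- (real DIM('a) + \<delta>))"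
      by (simp only: n_def)
  qed
qed

text \<open>
  The geometric mean of the coordinate bounds \<open>|x\<^sub>b|\<^bsup>-n-\<delta>\<^esup>\<close>, cut off at \<open>1\<close>. Unlike the
  majorant of the differences it has no singularity, and it changes only by a constant factor under
  bounded translations.
\<close>

definition kernel_majorant :: "real \<Rightarrow> 'a::euclidean_space \<Rightarrow> real" where
  "kernel_majorant \<theta> x = (\<Prod>b\<in>Basis. max 1 \<bar>x \<bullet> b\<bar> powr (- (1 + \<theta>)))"

lemma kernel_majorant_nonneg: "0 \<le> kernel_majorant \<theta> x"
  by (simp add: kernel_majorant_def prod_nonneg)

lemma kernel_majorant_measurable [measurable]: "kernel_majorant \<theta> \<in> borel_measurable borel"
  unfolding kernel_majorant_def[abs_def] by measurable

lemma integrable_kernel_majorant: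
  assumes "0 < \<theta>" "\<theta> < 1"
  shows "integrable lborel (kernel_majorant \<theta> :: 'a::euclidean_space \<Rightarrow> real)"
proof (rule Bochner_Integration.integrable_bound[OF integrable_product_majorant[OF assms(1)]])
  show "AE x::'a in lborel. norm (kernel_majorant \<theta> x) \<le> norm (product_majorant \<theta> x)"
    using AE_coordinates_nonzero
  proof eventually_elim
    case (elim x)
    have "max 1 \<bar>s\<bar> powr (- (1 + \<theta>)) \<le> frac_majorant \<theta> s" if "s \<noteq> 0" for s :: real
    proof (cases "\<bar>s\<bar> \<le> 1")
      case True
      have "1 powr (\<theta> - 1) \<le> \<bar>s\<bar> powr (\<theta> - 1)" using True that assms by (intro powr_mono2') auto
      then show ?thesis using True by (simp add: frac_majorant_def max_def)
    qed (simp add: frac_majorant_def max_def)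
    then have "kernel_majorant \<theta> x \<le> product_majorant \<theta> x"
      unfolding kernel_majorant_def product_majorant_def using elim by (intro prod_mono) auto
    then show ?case by (simp add: kernel_majorant_nonneg product_majorant_nonneg)
  qed
qed measurable

text \<open>
  This provides one integrable bound for all translates and dilates of the kernel that are close to it.
\<close>

lemma kernel_majorant_shift_scale:
  fixes x y :: "'a::euclidean_space"
  assumes c: "1 / 2 \<le> c" and y: "norm y \<le> 1" and th: "0 < \<theta>"
  shows "kernel_majorant \<theta> (c *\<^sub>R (x - y)) \<le> (4 powr (1 + \<theta>)) ^ DIM('a) * kernel_majorant \<theta> x"
proof -
  have "max 1 \<bar>(c *\<^sub>R (x - y)) \<bullet> b\<bar> powr (- (1 + \<theta>)) \<le> 4 powr (1 + \<theta>) * max 1 \<bar>x \<bullet> b\<bar> powr (- (1 + \<theta>))"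
    if b: "b \<in> Basis" for b
  proof -
    have yb: "\<bar>y \<bullet> b\<bar> \<le> 1" using Basis_le_norm[OF b, of y] y by linarith
    have "(1 / 2) * \<bar>x \<bullet> b - y \<bullet> b\<bar> \<le> c * \<bar>x \<bullet> b - y \<bullet> b\<bar>" using c by (intro mult_right_mono) auto
    then have "(1 / 2) * (\<bar>x \<bullet> b\<bar> - 1) \<le> \<bar>(c *\<^sub>R (x - y)) \<bullet> b\<bar>"
      using yb c by (simp add: inner_diff_left abs_mult)
    then have "max 1 \<bar>x \<bullet> b\<bar> / 4 \<le> max 1 \<bar>(c *\<^sub>R (x - y)) \<bullet> b\<bar>" by (auto simp: max_def)
    then have "max 1 \<bar>(c *\<^sub>R (x - y)) \<bullet> b\<bar> powr (- (1 + \<theta>)) \<le> (max 1 \<bar>x \<bullet> b\<bar> / 4) powr (- (1 + \<theta>))"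
      using th by (intro powr_mono2') auto
    also have "\<dots> = 4 powr (1 + \<theta>) * max 1 \<bar>x \<bullet> b\<bar> powr (- (1 + \<theta>))"
      using powr_minus_divide[of 4 "1 + \<theta>"] by (simp add: powr_divide)
    finally show ?thesis .
  qed
  then have "kernel_majorant \<theta> (c *\<^sub>R (x - y)) \<le> (\<Prod>b\<in>(Basis::'a set). 4 powr (1 + \<theta>) * max 1 \<bar>x \<bullet> b\<bar> powr (- (1 + \<theta>)))"
    unfolding kernel_majorant_def by (intro prod_mono) auto
  then show ?thesis by (simp add: kernel_majorant_def prod.distrib)
qed

lemma heat_kernel_eq_fourier_integral:
  fixes x :: "'a::euclidean_space"
  shows "heat_kernel \<sigma> t x = Re (fourier_integral (\<lambda>\<xi>. frac_symbol \<sigma> \<xi> powr t) x) / (2 * pi) ^ DIM('a)"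
proof -
  have e: "frac_symbol \<sigma> \<xi> powr t = exp (- (norm \<xi> powr (2 * \<sigma>)) * t)" for \<xi> :: 'a
    by (simp add: frac_symbol_def powr_def)
  show ?thesis
    unfolding heat_kernel_def inverse_fourier_def fourier_integral_def e
    by (subst integral_completion) (auto simp: divide_inverse mult.commute)
qed

text \<open>
  The bound by the power of a single coordinate is used for the largest one; it is then the smallest of
  all these bounds and is at most their geometric mean.
\<close>

lemma heat_kernel_one_decay:
  fixes \<sigma> :: real
  assumes \<sigma>: "\<sigma> > 0"
  obtains C \<theta> where "C > 0" "0 < \<theta>" "\<theta> < 1"
    and "\<And>x::'a::euclidean_space. \<bar>heat_kernel \<sigma> 1 x\<bar> \<le> C * kernel_majorant \<theta> x"
proof -
  define n where "n = DIM('a)"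
  have n: "real n \<ge> 1" by (simp add: n_def DIM_positive Suc_leI)
  obtain C \<delta> where C: "C > 0" and d: "0 < \<delta>" "\<delta> < 1"
    and bd: "\<And>(x::'a) b. b \<in> Basis \<Longrightarrow>
      norm (fourier_integral (frac_symbol \<sigma>) x) \<le> C * max 1 \<bar>x \<bullet> b\<bar> powr (- (real n + \<delta>))"
    using fourier_frac_symbol_decay[OF \<sigma>, where 'a = 'a] unfolding n_def by metis
  define \<theta> where "\<theta> = \<delta> / real n"
  have th: "0 < \<theta>" "\<theta> < 1" using d n by (auto simp: \<theta>_def field_simps)
  show ?thesis
  proof (rule that[OF C th])
    fix x :: 'a
    have "Max ((\<lambda>b. \<bar>x \<bullet> b\<bar>) ` Basis) \<in> (\<lambda>b. \<bar>x \<bullet> b\<bar>) ` Basis" by (intro Max_in) auto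
    then obtain b0 where b0: "b0 \<in> Basis" and Mb: "Max ((\<lambda>b. \<bar>x \<bullet> b\<bar>) ` Basis) = \<bar>x \<bullet> b0\<bar>"
      by (rule imageE)
    have mx: "\<bar>x \<bullet> b\<bar> \<le> \<bar>x \<bullet> b0\<bar>" if "b \<in> Basis" for b
      unfolding Mb[symmetric] using that by (intro Max_ge) auto
    have "(2 * pi) ^ n \<ge> 1" using pi_ge_two by (intro one_le_power) auto
    have "\<bar>heat_kernel \<sigma> 1 x\<bar> = \<bar>Re (fourier_integral (frac_symbol \<sigma>) x)\<bar> / (2 * pi) ^ n"
      unfolding heat_kernel_eq_fourier_integral frac_symbol_powr_one by (simp add: n_def)
    also have "\<dots> \<le> \<bar>Re (fourier_integral (frac_symbol \<sigma>) x)\<bar> / 1"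
      using \<open>(2 * pi) ^ n \<ge> 1\<close> by (intro divide_left_mono) auto
    also have "\<dots> \<le> norm (fourier_integral (frac_symbol \<sigma>) x)"
      by (simp add: abs_Re_le_cmod)
    also have "\<dots> \<le> C * max 1 \<bar>x \<bullet> b0\<bar> powr (- (real n + \<delta>))" by (rule bd[OF b0])
    also have "max 1 \<bar>x \<bullet> b0\<bar> powr (- (real n + \<delta>)) = (\<Prod>b\<in>(Basis::'a set). max 1 \<bar>x \<bullet> b0\<bar> powr (- (1 + \<theta>)))"
    proof -
      have "(- (1 + \<theta>)) * real n = - (real n + \<delta>)" using n by (simp add: \<theta>_def field_simps)
      then show ?thesis using n by (simp add: powr_power n_def max_def mult.commute[of "real DIM('a)"])
    qed
    also have "\<dots> \<le> kernel_majorant \<theta> x"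
      unfolding kernel_majorant_def using mx th by (intro prod_mono conjI powr_mono2') (auto simp: max_def dest: mx)
    finally show "\<bar>heat_kernel \<sigma> 1 x\<bar> \<le> C * kernel_majorant \<theta> x" using C by simp
  qed
qed

section \<open>Self-similarity of the kernel and its moduli of continuity\<close>

lemma frac_symbol_simps [simp]:
  "0 \<le> frac_symbol \<sigma> \<xi>" "\<bar>frac_symbol \<sigma> \<xi>\<bar> = frac_symbol \<sigma> \<xi>" "frac_symbol \<sigma> \<xi> \<noteq> 0"
  using frac_symbol_pos[of \<sigma> \<xi>] by linarith+

lemma nn_integral_lborel_scale:
  fixes F :: "'a::euclidean_space \<Rightarrow> ennreal"
  assumes [measurable]: "F \<in> borel_measurable borel" and c: "c > 0"
  shows "(\<integral>\<^sup>+ x. F x \<partial>lborel) = ennreal (c ^ DIM('a)) * (\<integral>\<^sup>+ x. F (c *\<^sub>R x) \<partial>lborel)"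
proof -
  have "(\<integral>\<^sup>+ x. F x \<partial>lborel)
      = (\<integral>\<^sup>+ x. F x \<partial>density (distr lborel borel (\<lambda>x. 0 + c *\<^sub>R x)) (\<lambda>_. ennreal (\<bar>c\<bar> ^ DIM('a))))"
    using lborel_affine[of c "0::'a"] c by simp
  also have "\<dots> = ennreal (c ^ DIM('a)) * (\<integral>\<^sup>+ x. F (c *\<^sub>R x) \<partial>lborel)"
    using c by (simp add: nn_integral_density nn_integral_distr nn_integral_cmult)
  finally show ?thesis .
qed

lemma integral_lborel_scale:
  fixes F :: "'a::euclidean_space \<Rightarrow> 'b::{banach, second_countable_topology}"
  assumes [measurable]: "F \<in> borel_measurable borel" and c: "c > 0"
  shows "(\<integral>x. F x \<partial>lborel) = c ^ DIM('a) *\<^sub>R (\<integral>x. F (c *\<^sub>R x) \<partial>lborel)"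
proof -
  have "(\<integral>x. F x \<partial>lborel)
      = (\<integral>x. F x \<partial>density (distr lborel borel (\<lambda>x. 0 + c *\<^sub>R x)) (\<lambda>_. ennreal (\<bar>c\<bar> ^ DIM('a))))"
    using lborel_affine[of c "0::'a"] c by simp
  also have "\<dots> = c ^ DIM('a) *\<^sub>R (\<integral>x. F (c *\<^sub>R x) \<partial>lborel)"
    using c by (subst integral_density) (auto simp: integral_distr)
  finally show ?thesis .
qed

text \<open>
  Substitute \<open>\<xi> \<mapsto> c \<xi>\<close> with \<open>c\<^bsup>2\<sigma>\<^esup> t = 1\<close> in the Fourier integral.
\<close>

lemma heat_kernel_scaling:
  fixes x :: "'a::euclidean_space"
  assumes \<sigma>: "\<sigma> > 0" and t: "t > 0"
  shows "heat_kernel \<sigma> (s * t) x =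
    t powr (- (real DIM('a) / (2 * \<sigma>))) * heat_kernel \<sigma> s (t powr (- (1 / (2 * \<sigma>))) *\<^sub>R x)"
proof -
  define c where "c = t powr (- (1 / (2 * \<sigma>)))"
  have c: "c > 0" using t by (simp add: c_def)
  have cn: "c ^ DIM('a) = t powr (- (real DIM('a) / (2 * \<sigma>)))"
    using t by (simp add: c_def powr_power mult.commute)
  have "c powr (2 * \<sigma>) * t = t powr (-1) * t powr 1"
    using t \<sigma> by (simp add: c_def powr_powr)
  also have "\<dots> = 1" using t by (subst powr_add[symmetric]) simp
  finally have ct: "c powr (2 * \<sigma>) * t = 1" .
  have sym: "frac_symbol \<sigma> (c *\<^sub>R \<xi>) powr (s * t) = frac_symbol \<sigma> \<xi> powr s" for \<xi> :: 'a
  proof -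
    have "norm (c *\<^sub>R \<xi>) powr (2 * \<sigma>) * (s * t) = norm \<xi> powr (2 * \<sigma>) * s * (c powr (2 * \<sigma>) * t)"
      using c by (simp add: powr_mult)
    then show ?thesis unfolding ct by (simp add: frac_symbol_def powr_def mult.commute)
  qed
  have "fourier_integral (\<lambda>\<xi>. frac_symbol \<sigma> \<xi> powr (s * t)) x
      = c ^ DIM('a) *\<^sub>R fourier_integral (\<lambda>\<xi>. frac_symbol \<sigma> \<xi> powr s) (c *\<^sub>R x)"
    unfolding fourier_integral_def
    by (subst integral_lborel_scale[OF _ c]) (auto simp: sym)
  then show ?thesis
    unfolding heat_kernel_eq_fourier_integral cn by (simp add: c_def)
qed

lemma heat_kernel_scaling_one:
  fixes x :: "'a::euclidean_space"
  assumes "\<sigma> > 0" "t > 0"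
  shows "heat_kernel \<sigma> t x =
    t powr (- (real DIM('a) / (2 * \<sigma>))) * heat_kernel \<sigma> 1 (t powr (- (1 / (2 * \<sigma>))) *\<^sub>R x)"
  using heat_kernel_scaling[OF assms, of 1 x] by simp

text \<open>
  The \<open>L\<^sup>1\<close> distance between the symbols of \<open>G(r, \<cdot> - y)\<close> and \<open>G(1, \<cdot>)\<close>. It bounds their distance
  in \<open>L\<^sup>\<infinity>\<close>, and it tends to zero by dominated convergence on the Fourier side.
\<close>

definition sup_modulus :: "real \<Rightarrow> real \<Rightarrow> 'a::euclidean_space \<Rightarrow> real" where
  "sup_modulus \<sigma> r y =
    (\<integral>\<xi>. norm (exp (- \<i> * complex_of_real (y \<bullet> \<xi>)) * of_real (frac_symbol \<sigma> \<xi> powr r) - of_real (frac_symbol \<sigma> \<xi>)) \<partial>lborel)"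

lemma sup_modulus_nonneg: "0 \<le> sup_modulus \<sigma> r y"
  unfolding sup_modulus_def by (intro integral_nonneg_AE AE_I2) simp

lemma sup_modulus_measurable [measurable]: "sup_modulus \<sigma> r \<in> borel_measurable borel"
  unfolding sup_modulus_def[abs_def] by measurable

lemma sup_modulus_integrand_bound:
  assumes "1 / 2 \<le> r"
  shows "norm (exp (- \<i> * complex_of_real (y \<bullet> \<xi>)) * of_real (frac_symbol \<sigma> \<xi> powr r) - of_real (frac_symbol \<sigma> \<xi>))
    \<le> 2 * frac_symbol \<sigma> \<xi> powr (1 / 2)"
proof -
  have e: "norm (exp (- \<i> * complex_of_real (y \<bullet> \<xi>))) = 1"
    using norm_exp_i_times[of "- (y \<bullet> \<xi>)"] by simp
  have "frac_symbol \<sigma> \<xi> powr r \<le> frac_symbol \<sigma> \<xi> powr (1 / 2)"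
    using assms frac_symbol_le_1 frac_symbol_pos by (intro powr_mono') (auto simp: less_imp_le)
  moreover have "frac_symbol \<sigma> \<xi> powr 1 \<le> frac_symbol \<sigma> \<xi> powr (1 / 2)"
    using frac_symbol_le_1 frac_symbol_pos by (intro powr_mono') (auto simp: less_imp_le)
  ultimately have "frac_symbol \<sigma> \<xi> powr r + \<bar>frac_symbol \<sigma> \<xi>\<bar> \<le> 2 * frac_symbol \<sigma> \<xi> powr (1 / 2)"
    using frac_symbol_pos[of \<sigma> \<xi>] by simp
  then show ?thesis
    by (intro order_trans[OF norm_triangle_ineq4]) (simp add: norm_mult e)
qed

lemma sup_modulus_bounded:
  assumes "\<sigma> > 0" "1 / 2 \<le> r"
  shows "sup_modulus \<sigma> r (y::'a::euclidean_space) \<le> (\<integral>\<xi>. 2 * frac_symbol \<sigma> (\<xi>::'a) powr (1 / 2) \<partial>lborel)"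
  unfolding sup_modulus_def
proof (rule integral_mono_AE')
  show "integrable lborel (\<lambda>\<xi>::'a. 2 * frac_symbol \<sigma> \<xi> powr (1 / 2))"
    by (intro integrable_mult_right integrable_frac_symbol_powr assms) simp
qed (use sup_modulus_integrand_bound[OF assms(2)] in auto)

lemma heat_kernel_diff_le_sup_modulus:
  fixes x y :: "'a::euclidean_space"
  assumes \<sigma>: "\<sigma> > 0" and r: "r > 0"
  shows "\<bar>heat_kernel \<sigma> r (x - y) - heat_kernel \<sigma> 1 x\<bar> \<le> sup_modulus \<sigma> r y"
proof -
  let ?f = "frac_symbol \<sigma> :: 'a \<Rightarrow> real"
  let ?A = "\<lambda>\<xi>. exp (\<i> * complex_of_real ((x - y) \<bullet> \<xi>)) * of_real (?f \<xi> powr r)"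
  let ?B = "\<lambda>\<xi>. exp (\<i> * complex_of_real (x \<bullet> \<xi>)) * of_real (?f \<xi> powr 1)"
  have "(2 * pi) ^ DIM('a) \<ge> 1" using pi_ge_two by (intro one_le_power) auto
  have "\<bar>heat_kernel \<sigma> r (x - y) - heat_kernel \<sigma> 1 x\<bar>
      = \<bar>Re (fourier_integral (\<lambda>\<xi>. ?f \<xi> powr r) (x - y) - fourier_integral (\<lambda>\<xi>. ?f \<xi> powr 1) x)\<bar> / (2 * pi) ^ DIM('a)"
    unfolding heat_kernel_eq_fourier_integral by (simp add: diff_divide_distrib[symmetric])
  also have "\<dots> \<le> \<bar>Re (fourier_integral (\<lambda>\<xi>. ?f \<xi> powr r) (x - y) - fourier_integral (\<lambda>\<xi>. ?f \<xi> powr 1) x)\<bar> / 1"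
    using \<open>(2 * pi) ^ DIM('a) \<ge> 1\<close> by (intro divide_left_mono) auto
  also have "\<dots> \<le> norm (fourier_integral (\<lambda>\<xi>. ?f \<xi> powr r) (x - y) - fourier_integral (\<lambda>\<xi>. ?f \<xi> powr 1) x)"
    by (simp only: div_by_1 abs_Re_le_cmod)
  also have "fourier_integral (\<lambda>\<xi>. ?f \<xi> powr r) (x - y) - fourier_integral (\<lambda>\<xi>. ?f \<xi> powr 1) x = (\<integral>\<xi>. ?A \<xi> - ?B \<xi> \<partial>lborel)"
    unfolding fourier_integral_def
    by (rule Bochner_Integration.integral_diff[symmetric])
       (intro integrable_fourier_integrand integrable_frac_symbol_powr \<sigma> r zero_less_one)+
  also have "norm (\<integral>\<xi>. ?A \<xi> - ?B \<xi> \<partial>lborel) \<le> (\<integral>\<xi>. norm (?A \<xi> - ?B \<xi>) \<partial>lborel)"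
    by (rule integral_norm_bound)
  also have "\<dots> = sup_modulus \<sigma> r y"
    unfolding sup_modulus_def
  proof (rule Bochner_Integration.integral_cong[OF refl])
    fix \<xi> :: 'a
    have e: "norm (exp (\<i> * complex_of_real (x \<bullet> \<xi>))) = 1" by simp
    have "exp (\<i> * complex_of_real ((x - y) \<bullet> \<xi>)) = exp (\<i> * complex_of_real (x \<bullet> \<xi>)) * exp (- \<i> * complex_of_real (y \<bullet> \<xi>))"
      by (simp add: inner_diff_left right_diff_distrib flip: exp_add)
    then have "?A \<xi> - ?B \<xi> = exp (\<i> * complex_of_real (x \<bullet> \<xi>)) *
        (exp (- \<i> * complex_of_real (y \<bullet> \<xi>)) * of_real (?f \<xi> powr r) - of_real (?f \<xi>))"
      using frac_symbol_pos[of \<sigma> \<xi>] by (simp add: algebra_simps)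
    then show "norm (?A \<xi> - ?B \<xi>) =
        norm (exp (- \<i> * complex_of_real (y \<bullet> \<xi>)) * of_real (?f \<xi> powr r) - of_real (?f \<xi>))"
      by (simp only: norm_mult e mult_1)
  qed
  finally show ?thesis .
qed

text \<open>
  Dominated convergence asks for a bound on all members of a sequence; this lets the bound be proved on a
  neighbourhood of the limit point only.
\<close>

lemma isCont_by_eventual_sequences:
  fixes f :: "'a::metric_space \<Rightarrow> 'b::topological_space"
  assumes "\<And>X. X \<longlonglongrightarrow> a \<Longrightarrow> (\<And>i. P (X i)) \<Longrightarrow> (\<lambda>i. f (X i)) \<longlonglongrightarrow> f a"
    and P: "eventually P (nhds a)"
  shows "isCont f a"
  unfolding continuous_at_sequentially comp_def
proof (intro allI impI)
  fix X :: "nat \<Rightarrow> 'a" assume X: "X \<longlonglongrightarrow> a"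
  then have "eventually (\<lambda>i. P (X i)) sequentially"
    using P by (metis filterlim_iff)
  then obtain k where k: "\<And>i. i \<ge> k \<Longrightarrow> P (X i)" by (auto simp: eventually_sequentially)
  have "(\<lambda>i. f (X (i + k))) \<longlonglongrightarrow> f a"
    by (rule assms(1)) (use X k in \<open>auto intro: LIMSEQ_ignore_initial_segment\<close>)
  then show "(\<lambda>i. f (X i)) \<longlonglongrightarrow> f a" by (rule LIMSEQ_offset)
qed

lemma isCont_sup_modulus:
  assumes \<sigma>: "\<sigma> > 0"
  shows "isCont (\<lambda>p. sup_modulus \<sigma> (fst p) (snd p :: 'a::euclidean_space)) (1, 0)"
proof (rule isCont_by_eventual_sequences[where P = "\<lambda>p. 1 / 2 < fst p"])
  show "\<forall>\<^sub>F p in nhds (1, 0). 1 / 2 < fst (p :: real \<times> 'a)"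
    using order_tendstoD(1)[OF tendsto_fst[OF filterlim_ident[of "nhds (1::real, 0::'a)"]], of "1 / 2"] by simp
next
  fix X :: "nat \<Rightarrow> real \<times> 'a" assume X: "X \<longlonglongrightarrow> (1, 0)" and h: "\<And>i. 1 / 2 < fst (X i)"
  define r y where "r i = fst (X i)" and "y i = snd (X i)" for i
  have X1: "r \<longlonglongrightarrow> 1" and X2: "y \<longlonglongrightarrow> 0"
    using tendsto_fst[OF X] tendsto_snd[OF X] by (auto simp: r_def[abs_def] y_def[abs_def])
  show "(\<lambda>i. sup_modulus \<sigma> (fst (X i)) (snd (X i))) \<longlonglongrightarrow> sup_modulus \<sigma> (fst (1::real, 0::'a)) (snd (1::real, 0::'a))"
    unfolding sup_modulus_def r_def[symmetric] y_def[symmetric] fst_conv snd_conv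
  proof (rule integral_dominated_convergence[where w = "\<lambda>\<xi>. 2 * frac_symbol \<sigma> \<xi> powr (1 / 2)"])
    show "integrable lborel (\<lambda>\<xi>::'a. 2 * frac_symbol \<sigma> \<xi> powr (1 / 2))"
      by (intro integrable_mult_right integrable_frac_symbol_powr \<sigma>) simp
    fix i
    show "AE \<xi> in lborel. norm (norm (exp (- \<i> * complex_of_real (y i \<bullet> \<xi>)) * of_real (frac_symbol \<sigma> \<xi> powr r i) - of_real (frac_symbol \<sigma> \<xi>)))
        \<le> 2 * frac_symbol \<sigma> \<xi> powr (1 / 2)"
      unfolding real_norm_def abs_norm_cancel
      by (intro AE_I2 sup_modulus_integrand_bound less_imp_le[OF h[folded r_def]])
  next
    show "AE \<xi> in lborel. (\<lambda>i. norm (exp (- \<i> * complex_of_real (y i \<bullet> \<xi>)) * of_real (frac_symbol \<sigma> \<xi> powr r i) - of_real (frac_symbol \<sigma> \<xi>)))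
        \<longlonglongrightarrow> norm (exp (- \<i> * complex_of_real (0 \<bullet> \<xi>)) * of_real (frac_symbol \<sigma> \<xi> powr 1) - of_real (frac_symbol \<sigma> \<xi>))"
      by (intro AE_I2 tendsto_intros X1 X2) auto
  qed measurable
qed

lemma sup_modulus_one_zero [simp]: "sup_modulus \<sigma> 1 0 = 0"
  using frac_symbol_pos[of \<sigma>] by (simp add: sup_modulus_def less_imp_le)

lemma sup_modulus_tendsto:
  assumes "\<sigma> > 0" "(r \<longlongrightarrow> 1) F" "(y \<longlongrightarrow> (0::'a::euclidean_space)) F"
  shows "((\<lambda>i. sup_modulus \<sigma> (r i) (y i)) \<longlongrightarrow> 0) F"
  using isCont_tendsto_compose[OF isCont_sup_modulus[OF assms(1)] tendsto_Pair[OF assms(2,3)]] by simp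

lemma continuous_heat_kernel_one:
  assumes \<sigma>: "\<sigma> > 0"
  shows "continuous_on UNIV (heat_kernel \<sigma> 1 :: 'a::euclidean_space \<Rightarrow> real)"
proof -
  have "isCont (heat_kernel \<sigma> 1) a" for a :: 'a
    unfolding isCont_def
  proof (rule tendsto_dist_iff[THEN iffD2])
    show "((\<lambda>x. dist (heat_kernel \<sigma> 1 x) (heat_kernel \<sigma> 1 a)) \<longlongrightarrow> 0) (at a)"
    proof (rule tendsto_sandwich[OF _ _ tendsto_const])
      show "((\<lambda>x. sup_modulus \<sigma> 1 (a - x)) \<longlongrightarrow> 0) (at a)"
        by (rule sup_modulus_tendsto[OF \<sigma>]) (auto intro!: tendsto_eq_intros)
      show "\<forall>\<^sub>F x in at a. dist (heat_kernel \<sigma> 1 x) (heat_kernel \<sigma> 1 a) \<le> sup_modulus \<sigma> 1 (a - x)"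
        using heat_kernel_diff_le_sup_modulus[OF \<sigma> zero_less_one, of a "a - _"] by (simp add: dist_real_def)
    qed simp
  qed
  then show ?thesis by (simp add: continuous_on_eq_continuous_at)
qed

lemma continuous_on_heat_kernel:
  assumes \<sigma>: "\<sigma> > 0"
  shows "continuous_on ({0<..} \<times> UNIV) (\<lambda>p. heat_kernel \<sigma> (fst p) (snd p :: 'a::euclidean_space))"
proof -
  have "continuous_on ({0<..} \<times> UNIV) (\<lambda>p. fst p powr (- (real DIM('a) / (2 * \<sigma>))) *
      heat_kernel \<sigma> 1 (fst p powr (- (1 / (2 * \<sigma>))) *\<^sub>R (snd p :: 'a)))"
    by (intro continuous_intros continuous_on_compose2[OF continuous_heat_kernel_one[OF \<sigma>]]) auto
  then show ?thesis
    by (rule continuous_on_cong[THEN iffD1, rotated -1]) (auto simp: heat_kernel_scaling_one[OF \<sigma>, symmetric])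
qed

lemma continuous_heat_kernel:
  assumes \<sigma>: "\<sigma> > 0" and t: "t > 0"
  shows "continuous_on UNIV (heat_kernel \<sigma> t :: 'a::euclidean_space \<Rightarrow> real)"
proof -
  have "continuous_on UNIV (\<lambda>x::'a. heat_kernel \<sigma> (fst (t, x)) (snd (t, x)))"
    using t by (intro continuous_on_compose2[OF continuous_on_heat_kernel[OF \<sigma>]] continuous_intros) auto
  then show ?thesis by simp
qed

lemma heat_kernel_measurable:
  assumes "\<sigma> > 0" "t > 0"
  shows "heat_kernel \<sigma> t \<in> borel_measurable borel"
  by (rule borel_measurable_continuous_onI[OF continuous_heat_kernel[OF assms]])

text \<open>
  At \<open>x = 0\<close> the Fourier integral is the integral of a positive function.
\<close>

lemma heat_kernel_zero_pos:
  assumes \<sigma>: "\<sigma> > 0" shows "heat_kernel \<sigma> 1 (0::'a::euclidean_space) > 0"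
proof -
  let ?f = "frac_symbol \<sigma> :: 'a \<Rightarrow> real"
  have "fourier_integral (\<lambda>\<xi>. ?f \<xi> powr 1) 0 = of_real (\<integral>\<xi>. ?f \<xi> \<partial>lborel)"
    unfolding frac_symbol_powr_one fourier_integral_def by (simp flip: integral_of_real)
  moreover have "(\<integral>\<xi>. ?f \<xi> \<partial>lborel) > 0"
  proof -
    have "(\<integral>\<xi>. ?f \<xi> \<partial>lborel) \<noteq> 0"
    proof
      assume "(\<integral>\<xi>. ?f \<xi> \<partial>lborel) = 0"
      then have "AE \<xi> in lborel. ?f \<xi> = 0"
        using integral_nonneg_eq_0_iff_AE[OF integrable_frac_symbol[OF \<sigma>]] frac_symbol_pos[of \<sigma>]
        by (auto simp: less_imp_le)
      then have "AE \<xi>::'a in lborel. False"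
        by eventually_elim (metis frac_symbol_pos less_irrefl)
      then show False by (simp add: eventually_False ae_filter_eq_bot_iff emeasure_lborel_UNIV)
    qed
    moreover have "(\<integral>\<xi>. ?f \<xi> \<partial>lborel) \<ge> 0"
      by (intro integral_nonneg_AE AE_I2) simp
    ultimately show ?thesis by linarith
  qed
  ultimately show ?thesis by (simp add: heat_kernel_eq_fourier_integral)
qed

abbreviation l1norm :: "('a::euclidean_space \<Rightarrow> real) \<Rightarrow> ennreal" where
  "l1norm f \<equiv> \<integral>\<^sup>+ x. ennreal \<bar>f x\<bar> \<partial>lborel"

lemma powr_neg_power_dim:
  fixes t \<sigma> :: real
  assumes "t > 0"
  shows "(t powr (- (1 / (2 * \<sigma>)))) ^ n = t powr (- (real n / (2 * \<sigma>)))"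
  using assms by (simp add: powr_power mult.commute)

lemma integrable_heat_kernel_one:
  assumes \<sigma>: "\<sigma> > 0"
  shows "integrable lborel (heat_kernel \<sigma> 1 :: 'a::euclidean_space \<Rightarrow> real)"
proof -
  obtain C \<theta> where C: "C > 0" and th: "0 < \<theta>" "\<theta> < 1"
    and bd: "\<And>x::'a. \<bar>heat_kernel \<sigma> 1 x\<bar> \<le> C * kernel_majorant \<theta> x"
    using heat_kernel_one_decay[OF \<sigma>, where 'a = 'a] by metis
  show ?thesis
  proof (rule Bochner_Integration.integrable_bound)
    show "integrable lborel (\<lambda>x::'a. C * kernel_majorant \<theta> x)"
      by (intro integrable_mult_right integrable_kernel_majorant th)
    show "AE x::'a in lborel. norm (heat_kernel \<sigma> 1 x) \<le> norm (C * kernel_majorant \<theta> x)"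
      using bd by (intro AE_I2) (simp add: abs_le_iff order_trans[OF _ abs_ge_self])
  qed (use heat_kernel_measurable[OF \<sigma> zero_less_one] in simp)
qed

lemma nn_integral_abs_heat_kernel:
  assumes \<sigma>: "\<sigma> > 0" and t: "t > 0"
  shows "l1norm (\<lambda>x. heat_kernel \<sigma> t (x::'a::euclidean_space))
    = l1norm (\<lambda>x. heat_kernel \<sigma> 1 (x::'a))"
proof -
  note [measurable] = heat_kernel_measurable[OF \<sigma> zero_less_one, where 'a = 'a]
  define c where "c = t powr (- (1 / (2 * \<sigma>)))"
  have c: "c > 0" using t by (simp add: c_def)
  have "l1norm (\<lambda>x. heat_kernel \<sigma> 1 (x::'a))
      = ennreal (c ^ DIM('a)) * l1norm (\<lambda>x. heat_kernel \<sigma> 1 (c *\<^sub>R (x::'a)))"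
    by (rule nn_integral_lborel_scale[OF _ c]) measurable
  also have "\<dots> = (\<integral>\<^sup>+ x. ennreal (c ^ DIM('a)) * ennreal \<bar>heat_kernel \<sigma> 1 (c *\<^sub>R (x::'a))\<bar> \<partial>lborel)"
    by (rule nn_integral_cmult[symmetric]) measurable
  also have "\<dots> = l1norm (\<lambda>x. heat_kernel \<sigma> t (x::'a))"
    using t c by (intro nn_integral_cong)
      (simp add: heat_kernel_scaling_one[OF \<sigma> t] powr_neg_power_dim[OF t, symmetric] c_def abs_mult ennreal_mult)
  finally show ?thesis ..
qed

text \<open>
  The type argument carries the dimension, on which the constant depends.
\<close>

definition kernel_L1 :: "real \<Rightarrow> 'a::euclidean_space itself \<Rightarrow> real" where
  "kernel_L1 \<sigma> _ = (\<integral>x. \<bar>heat_kernel \<sigma> 1 (x::'a)\<bar> \<partial>lborel)"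

lemma kernel_L1_nonneg: "0 \<le> kernel_L1 \<sigma> TYPE('a::euclidean_space)"
  by (simp add: kernel_L1_def)

lemma heat_kernel_L1_norm:
  assumes \<sigma>: "\<sigma> > 0" and t: "t > 0"
  shows "l1norm (\<lambda>x. heat_kernel \<sigma> t (x::'a::euclidean_space)) = ennreal (kernel_L1 \<sigma> TYPE('a))"
  unfolding nn_integral_abs_heat_kernel[OF assms] kernel_L1_def
  using integrable_heat_kernel_one[OF \<sigma>, where 'a = 'a] by (intro nn_integral_eq_integral) auto

lemma integrable_heat_kernel:
  assumes \<sigma>: "\<sigma> > 0" and t: "t > 0"
  shows "integrable lborel (heat_kernel \<sigma> t :: 'a::euclidean_space \<Rightarrow> real)"
  unfolding integrable_iff_bounded real_norm_def heat_kernel_L1_norm[OF assms]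
  using heat_kernel_measurable[OF assms] by simp

text \<open>
  A bound for \<open>G(1, \<cdot>)\<close>: the inversion formula without its constant factor, which is at most \<open>1\<close>.
\<close>

definition kernel_sup :: "real \<Rightarrow> 'a::euclidean_space itself \<Rightarrow> real" where
  "kernel_sup \<sigma> _ = (\<integral>\<xi>. frac_symbol \<sigma> (\<xi>::'a) \<partial>lborel)"

lemma kernel_sup_nonneg: "0 \<le> kernel_sup \<sigma> TYPE('a::euclidean_space)"
  by (simp add: kernel_sup_def)

lemma heat_kernel_bounded:
  fixes x :: "'a::euclidean_space"
  assumes \<sigma>: "\<sigma> > 0" and t: "t > 0"
  shows "\<bar>heat_kernel \<sigma> t x\<bar> \<le> kernel_sup \<sigma> TYPE('a) * t powr (- (real DIM('a) / (2 * \<sigma>)))"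
proof -
  have one: "\<bar>heat_kernel \<sigma> 1 z\<bar> \<le> kernel_sup \<sigma> TYPE('a)" for z :: 'a
  proof -
    have "(2 * pi) ^ DIM('a) \<ge> 1" using pi_ge_two by (intro one_le_power) auto
    have "\<bar>heat_kernel \<sigma> 1 z\<bar> = \<bar>Re (fourier_integral (frac_symbol \<sigma>) z)\<bar> / (2 * pi) ^ DIM('a)"
      unfolding heat_kernel_eq_fourier_integral frac_symbol_powr_one by simp
    also have "\<dots> \<le> \<bar>Re (fourier_integral (frac_symbol \<sigma>) z)\<bar> / 1"
      using \<open>(2 * pi) ^ DIM('a) \<ge> 1\<close> by (intro divide_left_mono) auto
    also have "\<dots> \<le> norm (fourier_integral (frac_symbol \<sigma>) z)" by (simp add: abs_Re_le_cmod)
    also have "\<dots> \<le> kernel_sup \<sigma> TYPE('a)"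
      using norm_fourier_integral_le[OF integrable_frac_symbol[OF \<sigma>, where 'a = 'a]] by (simp add: kernel_sup_def)
    finally show ?thesis .
  qed
  show ?thesis
    unfolding heat_kernel_scaling_one[OF \<sigma> t, of x] abs_mult
    using one by (subst mult.commute) (intro mult_mono, auto)
qed

definition l1_modulus :: "real \<Rightarrow> real \<Rightarrow> 'a::euclidean_space \<Rightarrow> real" where
  "l1_modulus \<sigma> r y = (\<integral>x. \<bar>heat_kernel \<sigma> r (x - y) - heat_kernel \<sigma> 1 x\<bar> \<partial>lborel)"

lemma l1_modulus_nonneg: "0 \<le> l1_modulus \<sigma> r y"
  by (simp add: l1_modulus_def)

lemma l1_modulus_measurable:
  assumes "\<sigma> > 0" "r > 0"
  shows "l1_modulus \<sigma> r \<in> borel_measurable (borel :: 'a::euclidean_space measure)"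
proof -
  note [measurable] = heat_kernel_measurable[OF assms, where 'a = 'a] heat_kernel_measurable[OF assms(1) zero_less_one, where 'a = 'a]
  show ?thesis unfolding l1_modulus_def[abs_def] by measurable
qed

lemma l1_modulus_integrable:
  assumes "\<sigma> > 0" "r > 0"
  shows "integrable lborel (\<lambda>x. heat_kernel \<sigma> r (x - y) - heat_kernel \<sigma> 1 (x::'a::euclidean_space))"
  using integrable_lborel_translation[OF integrable_heat_kernel[OF assms], of "- y"]
  by (intro Bochner_Integration.integrable_diff integrable_heat_kernel_one[OF assms(1)]) simp

lemma l1_modulus_bounded:
  fixes y :: "'a::euclidean_space"
  assumes \<sigma>: "\<sigma> > 0" and r: "r > 0"
  shows "l1_modulus \<sigma> r y \<le> 2 * kernel_L1 \<sigma> TYPE('a)"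
proof -
  note [measurable] = heat_kernel_measurable[OF assms, where 'a = 'a]
  have ir: "integrable lborel (\<lambda>x::'a. heat_kernel \<sigma> r (x - y))"
    using integrable_lborel_translation[OF integrable_heat_kernel[OF assms], of "- y"] by simp
  have "l1_modulus \<sigma> r y \<le> (\<integral>x. \<bar>heat_kernel \<sigma> r (x - y)\<bar> + \<bar>heat_kernel \<sigma> 1 x\<bar> \<partial>lborel)"
    unfolding l1_modulus_def
    by (intro integral_mono Bochner_Integration.integrable_add integrable_abs l1_modulus_integrable[OF assms]
        ir integrable_heat_kernel_one[OF \<sigma>] abs_triangle_ineq4)
  also have "\<dots> = (\<integral>x. \<bar>heat_kernel \<sigma> r (x - y)\<bar> \<partial>lborel) + kernel_L1 \<sigma> TYPE('a)"
    unfolding kernel_L1_def using ir integrable_heat_kernel_one[OF \<sigma>, where 'a = 'a]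
    by (intro Bochner_Integration.integral_add integrable_abs)
  also have "(\<integral>x. \<bar>heat_kernel \<sigma> r (x - y)\<bar> \<partial>lborel) = (\<integral>x. \<bar>heat_kernel \<sigma> r (x::'a)\<bar> \<partial>lborel)"
    using integral_lborel_translation[of "\<lambda>x. \<bar>heat_kernel \<sigma> r x\<bar>" "- y"] by simp
  also have "\<dots> = kernel_L1 \<sigma> TYPE('a)"
    using heat_kernel_L1_norm[OF assms, where 'a = 'a] kernel_L1_nonneg[of \<sigma>, where 'a = 'a]
    by (subst integral_eq_nn_integral) auto
  finally show ?thesis by simp
qed

text \<open>
  Pointwise convergence is continuity of the kernel; the domination is the shift-and-scale invariance of
  the majorant.
\<close>

lemma isCont_l1_modulus:
  assumes \<sigma>: "\<sigma> > 0"
  shows "isCont (\<lambda>p. l1_modulus \<sigma> (fst p) (snd p :: 'a::euclidean_space)) (1, 0)"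
proof (rule isCont_by_eventual_sequences[where
      P = "\<lambda>p. 0 < fst p \<and> 1 / 2 < fst p powr (- (1 / (2 * \<sigma>))) \<and> fst p powr (- (real DIM('a) / (2 * \<sigma>))) < 2 \<and> norm (snd p) < 1"])
  have id: "((\<lambda>p. p) \<longlongrightarrow> (1::real, 0::'a)) (nhds (1, 0))" by (rule filterlim_ident)
  have f: "((\<lambda>p::real \<times> 'a. fst p powr e) \<longlongrightarrow> 1) (nhds (1, 0))" for e
    using tendsto_powr[OF tendsto_fst[OF id] tendsto_const, of e] by simp
  have n: "((\<lambda>p::real \<times> 'a. norm (snd p)) \<longlongrightarrow> 0) (nhds (1, 0))"
    using tendsto_norm[OF tendsto_snd[OF id]] by simp
  have "((\<lambda>p::real \<times> 'a. fst p) \<longlongrightarrow> 1) (nhds (1, 0))" using tendsto_fst[OF id] by simp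
  then show "\<forall>\<^sub>F p::real \<times> 'a in nhds (1, 0). 0 < fst p \<and> 1 / 2 < fst p powr (- (1 / (2 * \<sigma>)))
      \<and> fst p powr (- (real DIM('a) / (2 * \<sigma>))) < 2 \<and> norm (snd p) < 1"
    by (intro eventually_conj order_tendstoD(1)[OF f] order_tendstoD(2)[OF f] order_tendstoD(2)[OF n]
        order_tendstoD(1)[where y = 1]) auto
next
  fix X :: "nat \<Rightarrow> real \<times> 'a" assume X: "X \<longlonglongrightarrow> (1, 0)"
    and h: "\<And>i. 0 < fst (X i) \<and> 1 / 2 < fst (X i) powr (- (1 / (2 * \<sigma>))) \<and>
      fst (X i) powr (- (real DIM('a) / (2 * \<sigma>))) < 2 \<and> norm (snd (X i)) < 1"
  define r y where "r i = fst (X i)" and "y i = snd (X i)" for i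
  have X1: "r \<longlonglongrightarrow> 1" and X2: "y \<longlonglongrightarrow> 0"
    using tendsto_fst[OF X] tendsto_snd[OF X] by (auto simp: r_def[abs_def] y_def[abs_def])
  have r: "r i > 0" "1 / 2 \<le> r i powr (- (1 / (2 * \<sigma>)))" "r i powr (- (real DIM('a) / (2 * \<sigma>))) \<le> 2" "norm (y i) \<le> 1" for i
    using h[of i] by (auto simp: r_def y_def)
  obtain C \<theta> where C: "C > 0" and th: "0 < \<theta>" "\<theta> < 1"
    and bd: "\<And>x::'a. \<bar>heat_kernel \<sigma> 1 x\<bar> \<le> C * kernel_majorant \<theta> x"
    using heat_kernel_one_decay[OF \<sigma>, where 'a = 'a] by metis
  define B where "B = 2 * C * (4 powr (1 + \<theta>)) ^ DIM('a) + C"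
  show "(\<lambda>i. l1_modulus \<sigma> (fst (X i)) (snd (X i))) \<longlonglongrightarrow> l1_modulus \<sigma> (fst (1::real, 0::'a)) (snd (1::real, 0::'a))"
    unfolding l1_modulus_def r_def[symmetric] y_def[symmetric] fst_conv snd_conv
  proof (rule integral_dominated_convergence[where w = "\<lambda>x. B * kernel_majorant \<theta> x"])
    show "integrable lborel (\<lambda>x::'a. B * kernel_majorant \<theta> x)"
      by (intro integrable_mult_right integrable_kernel_majorant th)
    fix i
    show "AE x in lborel. norm \<bar>heat_kernel \<sigma> (r i) (x - y i) - heat_kernel \<sigma> 1 x\<bar> \<le> B * kernel_majorant \<theta> x"
    proof (rule AE_I2)
      fix x :: 'a
      let ?c = "r i powr (- (1 / (2 * \<sigma>)))"
      have "\<bar>heat_kernel \<sigma> (r i) (x - y i)\<bar>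
          \<le> r i powr (- (real DIM('a) / (2 * \<sigma>))) * \<bar>heat_kernel \<sigma> 1 (?c *\<^sub>R (x - y i))\<bar>"
        by (simp add: heat_kernel_scaling_one[OF \<sigma> r(1)] abs_mult)
      also have "\<dots> \<le> 2 * (C * kernel_majorant \<theta> (?c *\<^sub>R (x - y i)))"
        using r(3) bd by (intro mult_mono) auto
      also have "\<dots> \<le> 2 * (C * ((4 powr (1 + \<theta>)) ^ DIM('a) * kernel_majorant \<theta> x))"
        using C by (intro mult_left_mono kernel_majorant_shift_scale r th) auto
      finally show "norm \<bar>heat_kernel \<sigma> (r i) (x - y i) - heat_kernel \<sigma> 1 x\<bar> \<le> B * kernel_majorant \<theta> x"
        using bd[of x] abs_triangle_ineq4[of "heat_kernel \<sigma> (r i) (x - y i)" "heat_kernel \<sigma> 1 x"]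
        by (simp add: B_def algebra_simps)
    qed
    show "(\<lambda>x. \<bar>heat_kernel \<sigma> (r i) (x - y i) - heat_kernel \<sigma> 1 x\<bar>) \<in> borel_measurable lborel"
      using borel_measurable_integrable[OF l1_modulus_integrable[OF \<sigma> r(1)[of i], of "y i"]] by simp
  next
    show "(\<lambda>x::'a. \<bar>heat_kernel \<sigma> 1 (x - 0) - heat_kernel \<sigma> 1 x\<bar>) \<in> borel_measurable lborel"
      by simp
    show "AE x in lborel. (\<lambda>i. \<bar>heat_kernel \<sigma> (r i) (x - y i) - heat_kernel \<sigma> 1 x\<bar>)
        \<longlonglongrightarrow> \<bar>heat_kernel \<sigma> 1 (x - 0) - heat_kernel \<sigma> 1 x\<bar>"
    proof (rule AE_I2)
      fix x :: 'a
      have "(\<lambda>i. heat_kernel \<sigma> (fst (r i, x - y i)) (snd (r i, x - y i)))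
          \<longlonglongrightarrow> heat_kernel \<sigma> (fst (1::real, x - 0)) (snd (1::real, x - 0))"
      proof (rule continuous_on_tendsto_compose[OF continuous_on_heat_kernel[OF \<sigma>]])
        show "(\<lambda>i. (r i, x - y i)) \<longlonglongrightarrow> (1, x - 0)" by (intro tendsto_intros X1 X2)
      qed (use r in auto)
      then show "(\<lambda>i. \<bar>heat_kernel \<sigma> (r i) (x - y i) - heat_kernel \<sigma> 1 x\<bar>)
          \<longlonglongrightarrow> \<bar>heat_kernel \<sigma> 1 (x - 0) - heat_kernel \<sigma> 1 x\<bar>"
        by (intro tendsto_intros) simp
    qed
  qed
qed

lemma l1_modulus_tendsto:
  assumes "\<sigma> > 0" "(r \<longlongrightarrow> 1) F" "(y \<longlongrightarrow> (0::'a::euclidean_space)) F"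
  shows "((\<lambda>i. l1_modulus \<sigma> (r i) (y i)) \<longlongrightarrow> 0) F"
  using isCont_tendsto_compose[OF isCont_l1_modulus[OF assms(1)] tendsto_Pair[OF assms(2,3)]]
  by (simp add: l1_modulus_def)

text \<open>
  Rescaling by \<open>t\<close> turns a comparison of \<open>G(s)\<close> with \<open>G(t)\<close> into one of \<open>G(s/t)\<close> with \<open>G(1)\<close>.
\<close>

lemma heat_kernel_difference_scaled:
  fixes x y :: "'a::euclidean_space"
  assumes \<sigma>: "\<sigma> > 0" and t: "t > 0"
  defines "c \<equiv> t powr (- (1 / (2 * \<sigma>)))"
  shows "heat_kernel \<sigma> s (x - y) - heat_kernel \<sigma> t x
    = t powr (- (real DIM('a) / (2 * \<sigma>))) * (heat_kernel \<sigma> (s / t) (c *\<^sub>R x - c *\<^sub>R y) - heat_kernel \<sigma> 1 (c *\<^sub>R x))"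
  using heat_kernel_scaling[OF \<sigma> t, of "s / t" "x - y"] heat_kernel_scaling_one[OF \<sigma> t, of x] t
  by (simp add: c_def right_diff_distrib scaleR_diff_right)

lemma heat_kernel_difference_sup:
  fixes x y :: "'a::euclidean_space"
  assumes \<sigma>: "\<sigma> > 0" and t: "t > 0" and s: "s > 0"
  shows "\<bar>heat_kernel \<sigma> s (x - y) - heat_kernel \<sigma> t x\<bar>
    \<le> t powr (- (real DIM('a) / (2 * \<sigma>))) * sup_modulus \<sigma> (s / t) (t powr (- (1 / (2 * \<sigma>))) *\<^sub>R y)"
  unfolding heat_kernel_difference_scaled[OF \<sigma> t] abs_mult
  using heat_kernel_diff_le_sup_modulus[OF \<sigma>, of "s / t"] s t by (simp add: mult_left_mono)

lemma heat_kernel_difference_l1: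
  fixes y :: "'a::euclidean_space"
  assumes \<sigma>: "\<sigma> > 0" and t: "t > 0" and s: "s > 0"
  shows "l1norm (\<lambda>x. heat_kernel \<sigma> s (x - y) - heat_kernel \<sigma> t x)
    = ennreal (l1_modulus \<sigma> (s / t) (t powr (- (1 / (2 * \<sigma>))) *\<^sub>R y))"
proof -
  define c where "c = t powr (- (1 / (2 * \<sigma>)))"
  have c: "c > 0" using t by (simp add: c_def)
  have st: "s / t > 0" using s t by simp
  note [measurable] = heat_kernel_measurable[OF \<sigma> zero_less_one, where 'a = 'a] heat_kernel_measurable[OF \<sigma> st, where 'a = 'a]
  let ?F = "\<lambda>z. heat_kernel \<sigma> (s / t) (z - c *\<^sub>R y) - heat_kernel \<sigma> 1 z"
  have "ennreal (l1_modulus \<sigma> (s / t) (c *\<^sub>R y)) = l1norm ?F"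
    unfolding l1_modulus_def
    by (rule nn_integral_eq_integral[symmetric]) (use l1_modulus_integrable[OF \<sigma> st, of "c *\<^sub>R y"] in auto)
  also have "\<dots> = ennreal (c ^ DIM('a)) * l1norm (\<lambda>x. ?F (c *\<^sub>R x))"
    by (rule nn_integral_lborel_scale[OF _ c]) measurable
  also have "\<dots> = (\<integral>\<^sup>+ x. ennreal (c ^ DIM('a)) * ennreal \<bar>?F (c *\<^sub>R x)\<bar> \<partial>lborel)"
    by (rule nn_integral_cmult[symmetric]) measurable
  also have "\<dots> = l1norm (\<lambda>x. heat_kernel \<sigma> s (x - y) - heat_kernel \<sigma> t x)"
    using c by (intro nn_integral_cong)
      (simp add: heat_kernel_difference_scaled[OF \<sigma> t] powr_neg_power_dim[OF t, symmetric] c_def[symmetric] abs_mult ennreal_mult)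
  finally show ?thesis by (simp add: c_def)
qed

section \<open>Convolution with the kernel\<close>

text \<open>
  Minkowski's integral inequality in \<open>L\<^sup>1\<close>, where it is Tonelli's theorem. It yields Young's inequality
  for convolutions and the passage of norms under the Duhamel integral.
\<close>

lemma nn_integral_abs_integral_le:
  fixes k :: "'a::euclidean_space \<Rightarrow> 'b::euclidean_space \<Rightarrow> real"
  assumes [measurable]: "(\<lambda>(x, y). k x y) \<in> borel_measurable (borel \<Otimes>\<^sub>M borel)"
  shows "(\<integral>\<^sup>+ x. ennreal \<bar>\<integral>y. k x y \<partial>lborel\<bar> \<partial>lborel) \<le> (\<integral>\<^sup>+ y. l1norm (\<lambda>x. k x y) \<partial>lborel)"
proof -
  have "(\<integral>\<^sup>+ x. ennreal \<bar>\<integral>y. k x y \<partial>lborel\<bar> \<partial>lborel) \<le> (\<integral>\<^sup>+ x. l1norm (k x) \<partial>lborel)"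
  proof (rule nn_integral_mono)
    fix x
    show "ennreal \<bar>\<integral>y. k x y \<partial>lborel\<bar> \<le> l1norm (k x)"
    proof (cases "integrable lborel (k x)")
      case True
      then show ?thesis using integral_norm_bound_ennreal[OF True] by simp
    qed (simp add: not_integrable_integral_eq)
  qed
  also have "\<dots> = (\<integral>\<^sup>+ y. l1norm (\<lambda>x. k x y) \<partial>lborel)"
  proof -
    have "pair_sigma_finite (lborel :: 'a measure) (lborel :: 'b measure)"
      by (intro pair_sigma_finite.intro lborel.sigma_finite_measure_axioms)
    then show ?thesis by (rule pair_sigma_finite.Fubini'[symmetric]) measurable
  qed
  finally show ?thesis .
qed

lemma nn_integral_lborel_reflect:
  fixes F :: "'a::euclidean_space \<Rightarrow> ennreal"
  assumes [measurable]: "F \<in> borel_measurable borel"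
  shows "(\<integral>\<^sup>+ y. F (x - y) \<partial>lborel) = (\<integral>\<^sup>+ y. F y \<partial>lborel)"
proof -
  have "(\<integral>\<^sup>+ y. F y \<partial>lborel)
      = (\<integral>\<^sup>+ y. F y \<partial>density (distr lborel borel (\<lambda>y. x + (-1) *\<^sub>R y)) (\<lambda>_. ennreal (\<bar>-1\<bar> ^ DIM('a))))"
    using lborel_affine[of "-1" x] by simp
  also have "\<dots> = (\<integral>\<^sup>+ y. F (x - y) \<partial>lborel)"
    by (simp add: nn_integral_density nn_integral_distr)
  finally show ?thesis ..
qed

lemma heat_op_eq_convolution:
  fixes f :: "'a::euclidean_space \<Rightarrow> real"
  assumes "\<sigma> > 0" "t > 0" "f \<in> borel_measurable borel"
  shows "heat_op \<sigma> t f x = (\<integral>y. heat_kernel \<sigma> t (x - y) * f y \<partial>lborel)"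
proof -
  note [measurable] = heat_kernel_measurable[OF assms(1,2), where 'a = 'a] assms(3)
  show ?thesis
    unfolding heat_op_def using assms by (subst integral_completion) auto
qed

lemma integrable_heat_convolution:
  fixes f :: "'a::euclidean_space \<Rightarrow> real"
  assumes \<sigma>: "\<sigma> > 0" and t: "t > 0" and f: "integrable lborel f"
  shows "integrable lborel (\<lambda>y. heat_kernel \<sigma> t (x - y) * f y)"
proof (rule Bochner_Integration.integrable_bound)
  note [measurable] = heat_kernel_measurable[OF \<sigma> t, where 'a = 'a] borel_measurable_integrable[OF f]
  show "(\<lambda>y. heat_kernel \<sigma> t (x - y) * f y) \<in> borel_measurable lborel" by measurable
  let ?K = "kernel_sup \<sigma> TYPE('a) * t powr (- (real DIM('a) / (2 * \<sigma>)))"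
  show "integrable lborel (\<lambda>y. ?K * \<bar>f y\<bar>)" by (intro integrable_mult_right integrable_abs f)
  show "AE y in lborel. norm (heat_kernel \<sigma> t (x - y) * f y) \<le> norm (?K * \<bar>f y\<bar>)"
    using heat_kernel_bounded[OF \<sigma> t, where 'a = 'a] kernel_sup_nonneg[of \<sigma>, where 'a = 'a]
    by (intro AE_I2) (auto simp: abs_mult intro!: mult_right_mono)
qed

lemma heat_op_sup_bound_L1:
  fixes f :: "'a::euclidean_space \<Rightarrow> real"
  assumes \<sigma>: "\<sigma> > 0" and t: "t > 0" and f: "integrable lborel f"
  shows "\<bar>heat_op \<sigma> t f x\<bar>
    \<le> kernel_sup \<sigma> TYPE('a) * t powr (- (real DIM('a) / (2 * \<sigma>))) * (\<integral>y. \<bar>f y\<bar> \<partial>lborel)"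
proof -
  note [measurable] = borel_measurable_integrable[OF f]
  let ?K = "kernel_sup \<sigma> TYPE('a) * t powr (- (real DIM('a) / (2 * \<sigma>)))"
  have "\<bar>heat_op \<sigma> t f x\<bar> = norm (\<integral>y. heat_kernel \<sigma> t (x - y) * f y \<partial>lborel)"
    by (subst heat_op_eq_convolution[OF \<sigma> t]) auto
  also have "\<dots> \<le> (\<integral>y. norm (heat_kernel \<sigma> t (x - y) * f y) \<partial>lborel)" by (rule integral_norm_bound)
  also have "\<dots> \<le> (\<integral>y. ?K * \<bar>f y\<bar> \<partial>lborel)"
  proof (rule integral_mono)
    show "norm (heat_kernel \<sigma> t (x - y) * f y) \<le> ?K * \<bar>f y\<bar>" for y
      unfolding real_norm_def abs_mult by (intro mult_right_mono heat_kernel_bounded[OF \<sigma> t]) simp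
  qed (intro integrable_norm integrable_heat_convolution integrable_mult_right integrable_abs \<sigma> t f)+
  finally show ?thesis by simp
qed

lemma heat_op_sup_bound_sup:
  fixes f :: "'a::euclidean_space \<Rightarrow> real"
  assumes \<sigma>: "\<sigma> > 0" and t: "t > 0" and [measurable]: "f \<in> borel_measurable borel"
    and B: "AE y in lborel. \<bar>f y\<bar> \<le> B" "B \<ge> 0"
  shows "\<bar>heat_op \<sigma> t f x\<bar> \<le> kernel_L1 \<sigma> TYPE('a) * B"
proof -
  note [measurable] = heat_kernel_measurable[OF \<sigma> t, where 'a = 'a]
  have "ennreal \<bar>heat_op \<sigma> t f x\<bar> = ennreal (norm (\<integral>y. heat_kernel \<sigma> t (x - y) * f y \<partial>lborel))"
    by (subst heat_op_eq_convolution[OF \<sigma> t]) auto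
  also have "\<dots> \<le> (\<integral>\<^sup>+ y. ennreal (norm (heat_kernel \<sigma> t (x - y) * f y)) \<partial>lborel)"
  proof (cases "integrable lborel (\<lambda>y. heat_kernel \<sigma> t (x - y) * f y)")
    case True then show ?thesis by (rule integral_norm_bound_ennreal)
  qed (simp add: not_integrable_integral_eq)
  also have "\<dots> \<le> (\<integral>\<^sup>+ y. ennreal \<bar>heat_kernel \<sigma> t (x - y)\<bar> * ennreal B \<partial>lborel)"
    by (rule nn_integral_mono_AE) (use B in \<open>auto simp: abs_mult ennreal_mult[symmetric] intro!: ennreal_leI mult_left_mono\<close>)
  also have "\<dots> = l1norm (\<lambda>y. heat_kernel \<sigma> t (x - y)) * ennreal B"
    by (rule nn_integral_multc) measurable
  also have "l1norm (\<lambda>y. heat_kernel \<sigma> t (x - y)) = ennreal (kernel_L1 \<sigma> TYPE('a))"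
    using nn_integral_lborel_reflect[of "\<lambda>z. ennreal \<bar>heat_kernel \<sigma> t z\<bar>" x] heat_kernel_L1_norm[OF \<sigma> t, where 'a = 'a] by simp
  finally show ?thesis using B kernel_L1_nonneg[of \<sigma>, where 'a = 'a]
    by (simp add: ennreal_mult[symmetric] ennreal_le_iff)
qed

lemma heat_op_L1_bound:
  fixes f :: "'a::euclidean_space \<Rightarrow> real"
  assumes \<sigma>: "\<sigma> > 0" and t: "t > 0" and [measurable]: "f \<in> borel_measurable borel"
  shows "l1norm (heat_op \<sigma> t f)
    \<le> ennreal (kernel_L1 \<sigma> TYPE('a)) * l1norm f"
proof -
  note [measurable] = heat_kernel_measurable[OF \<sigma> t, where 'a = 'a]
  have "l1norm (heat_op \<sigma> t f)
      \<le> (\<integral>\<^sup>+ y. l1norm (\<lambda>x. heat_kernel \<sigma> t (x - y) * f y) \<partial>lborel)"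
    unfolding heat_op_eq_convolution[OF \<sigma> t assms(3)] by (rule nn_integral_abs_integral_le) measurable
  also have "\<dots> = (\<integral>\<^sup>+ y. ennreal (kernel_L1 \<sigma> TYPE('a)) * ennreal \<bar>f y\<bar> \<partial>lborel)"
  proof (rule nn_integral_cong)
    fix y
    have "l1norm (\<lambda>x. heat_kernel \<sigma> t (x - y) * f y)
        = l1norm (\<lambda>x. heat_kernel \<sigma> t (x - y)) * ennreal \<bar>f y\<bar>"
      by (simp add: abs_mult ennreal_mult nn_integral_multc)
    also have "l1norm (\<lambda>x. heat_kernel \<sigma> t (x - y)) = ennreal (kernel_L1 \<sigma> TYPE('a))"
      using nn_integral_distr[of "(+) (- y)" lborel borel "\<lambda>x. ennreal \<bar>heat_kernel \<sigma> t x\<bar>"]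
        heat_kernel_L1_norm[OF \<sigma> t, where 'a = 'a]
      unfolding lborel_distr_plus by simp
    finally show "l1norm (\<lambda>x. heat_kernel \<sigma> t (x - y) * f y)
        = ennreal (kernel_L1 \<sigma> TYPE('a)) * ennreal \<bar>f y\<bar>" .
  qed
  also have "\<dots> = ennreal (kernel_L1 \<sigma> TYPE('a)) * l1norm f"
    by (rule nn_integral_cmult) measurable
  finally show ?thesis .
qed

lemma heat_op_measurable:
  fixes f :: "'a::euclidean_space \<Rightarrow> real"
  assumes \<sigma>: "\<sigma> > 0" and t: "t > 0" and [measurable]: "f \<in> borel_measurable borel"
  shows "heat_op \<sigma> t f \<in> borel_measurable borel"
proof -
  note [measurable] = heat_kernel_measurable[OF \<sigma> t, where 'a = 'a]
  have "heat_op \<sigma> t f = (\<lambda>x. \<integral>y. heat_kernel \<sigma> t (x - y) * f y \<partial>lborel)"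
    by (rule ext) (rule heat_op_eq_convolution[OF \<sigma> t assms(3)])
  then show ?thesis by simp
qed

lemma heat_op_minus_kernel:
  fixes f :: "'a::euclidean_space \<Rightarrow> real"
  assumes \<sigma>: "\<sigma> > 0" and t: "t > 0" and s: "s > 0" and f: "integrable lborel f"
  shows "heat_op \<sigma> s f x - heat_kernel \<sigma> t x * (\<integral>y. f y \<partial>lborel)
    = (\<integral>y. (heat_kernel \<sigma> s (x - y) - heat_kernel \<sigma> t x) * f y \<partial>lborel)"
proof -
  have "heat_op \<sigma> s f x - heat_kernel \<sigma> t x * (\<integral>y. f y \<partial>lborel)
      = (\<integral>y. heat_kernel \<sigma> s (x - y) * f y \<partial>lborel) - (\<integral>y. heat_kernel \<sigma> t x * f y \<partial>lborel)"
    using f by (subst heat_op_eq_convolution[OF \<sigma> s]) auto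
  also have "\<dots> = (\<integral>y. heat_kernel \<sigma> s (x - y) * f y - heat_kernel \<sigma> t x * f y \<partial>lborel)"
    by (intro Bochner_Integration.integral_diff[symmetric] integrable_heat_convolution integrable_mult_right \<sigma> s f)
  finally show ?thesis by (simp add: left_diff_distrib)
qed

section \<open>Asymptotics of a single heat flow\<close>

text \<open>
  The error is of lower order than the profile \<open>G(t, \<cdot>)\<close> at both endpoints \<open>L\<^sup>1\<close> and \<open>L\<^sup>\<infinity>\<close>, hence by
  interpolation in every \<open>L\<^sup>m\<close>.
\<close>

definition vanishing_profile :: "real \<Rightarrow> (real \<Rightarrow> 'a::euclidean_space \<Rightarrow> real) \<Rightarrow> bool" where
  "vanishing_profile \<sigma> E \<longleftrightarrow> (\<forall>e>0. \<forall>\<^sub>F t in at_top.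
     E t \<in> borel_measurable borel \<and>
     (\<forall>x. \<bar>E t x\<bar> \<le> e * t powr (- (real DIM('a) / (2 * \<sigma>)))) \<and>
     l1norm (E t) \<le> ennreal e)"

lemma vanishing_profileI:
  fixes E :: "real \<Rightarrow> 'a::euclidean_space \<Rightarrow> real"
  assumes "\<forall>\<^sub>F t in at_top. E t \<in> borel_measurable borel"
    and "(A \<longlongrightarrow> 0) at_top" "\<forall>\<^sub>F t in at_top. \<forall>x. \<bar>E t x\<bar> \<le> A t * t powr (- (real DIM('a) / (2 * \<sigma>)))"
    and "(B \<longlongrightarrow> 0) at_top" "\<forall>\<^sub>F t in at_top. (l1norm (E t)) \<le> ennreal (B t)"
  shows "vanishing_profile \<sigma> E"
  unfolding vanishing_profile_def
proof (intro allI impI)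
  fix e :: real assume e: "e > 0"
  show "\<forall>\<^sub>F t in at_top. E t \<in> borel_measurable borel \<and>
     (\<forall>x. \<bar>E t x\<bar> \<le> e * t powr (- (real DIM('a) / (2 * \<sigma>)))) \<and> l1norm (E t) \<le> ennreal e"
    using assms(1,3,5) order_tendstoD(2)[OF assms(2) e] order_tendstoD(2)[OF assms(4) e]
  proof eventually_elim
    case (elim t)
    have "\<bar>E t x\<bar> \<le> e * t powr (- (real DIM('a) / (2 * \<sigma>)))" for x
      using elim(2) elim(4) by (meson less_imp_le mult_right_mono order_trans powr_ge_zero)
    moreover have "l1norm (E t) \<le> ennreal e"
      using elim(3) elim(5) by (meson ennreal_leI less_imp_le order_trans)
    ultimately show ?case using elim(1) by blast
  qed
qed

lemma vanishing_profile_add: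
  assumes "vanishing_profile \<sigma> E" "vanishing_profile \<sigma> F"
  shows "vanishing_profile \<sigma> (\<lambda>t x. E t x + F t x)"
  unfolding vanishing_profile_def
proof (intro allI impI)
  fix e :: real assume e: "e > 0"
  show "\<forall>\<^sub>F t in at_top. (\<lambda>x. E t x + F t x) \<in> borel_measurable borel \<and>
     (\<forall>x. \<bar>E t x + F t x\<bar> \<le> e * t powr (- (real DIM('a) / (2 * \<sigma>)))) \<and> l1norm (\<lambda>x. E t x + F t x) \<le> ennreal e"
    using assms(1)[unfolded vanishing_profile_def, rule_format, OF half_gt_zero[OF e]]
      assms(2)[unfolded vanishing_profile_def, rule_format, OF half_gt_zero[OF e]]
  proof eventually_elim
    case (elim t)
    then have [measurable]: "E t \<in> borel_measurable borel" "F t \<in> borel_measurable borel" by auto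
    have "l1norm (\<lambda>x. E t x + F t x) \<le> (\<integral>\<^sup>+ x. ennreal \<bar>E t x\<bar> + ennreal \<bar>F t x\<bar> \<partial>lborel)"
      by (intro nn_integral_mono) (simp flip: ennreal_plus)
    also have "\<dots> = l1norm (E t) + l1norm (F t)"
      by (rule nn_integral_add) auto
    also have "\<dots> \<le> ennreal (e / 2) + ennreal (e / 2)" using elim by (intro add_mono) auto
    also have "\<dots> = ennreal e" using e by (simp flip: ennreal_plus)
    finally have "l1norm (\<lambda>x. E t x + F t x) \<le> ennreal e" .
    moreover have "\<bar>E t x + F t x\<bar> \<le> e * t powr (- (real DIM('a) / (2 * \<sigma>)))" for x
    proof -
      have "\<bar>E t x\<bar> \<le> e / 2 * t powr (- (real DIM('a) / (2 * \<sigma>)))" "\<bar>F t x\<bar> \<le> e / 2 * t powr (- (real DIM('a) / (2 * \<sigma>)))"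
        using elim by auto
      then show ?thesis using abs_triangle_ineq[of "E t x" "F t x"] by linarith
    qed
    moreover have "(\<lambda>x. E t x + F t x) \<in> borel_measurable borel" by measurable
    ultimately show ?case by blast
  qed
qed

lemma vanishing_profile_cmult:
  assumes "vanishing_profile \<sigma> E"
  shows "vanishing_profile \<sigma> (\<lambda>t x. c * E t x)"
  unfolding vanishing_profile_def
proof (intro allI impI)
  fix e :: real assume e: "e > 0"
  define d where "d = e / (\<bar>c\<bar> + 1)"
  have d: "d > 0" "\<bar>c\<bar> * d \<le> e" using e by (auto simp: d_def field_simps add_pos_nonneg)
  show "\<forall>\<^sub>F t in at_top. (\<lambda>x. c * E t x) \<in> borel_measurable borel \<and>
     (\<forall>x. \<bar>c * E t x\<bar> \<le> e * t powr (- (real DIM('a) / (2 * \<sigma>)))) \<and> l1norm (\<lambda>x. c * E t x) \<le> ennreal e"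
    using assms(1)[unfolded vanishing_profile_def, rule_format, OF d(1)]
  proof eventually_elim
    case (elim t)
    then have [measurable]: "E t \<in> borel_measurable borel" by auto
    have "l1norm (\<lambda>x. c * E t x) = ennreal \<bar>c\<bar> * l1norm (E t)"
      by (simp add: abs_mult ennreal_mult nn_integral_cmult)
    also have "\<dots> \<le> ennreal \<bar>c\<bar> * ennreal d" using elim by (intro mult_left_mono) auto
    also have "\<dots> = ennreal (\<bar>c\<bar> * d)" using d by (simp add: ennreal_mult)
    also have "\<dots> \<le> ennreal e" using d by (intro ennreal_leI)
    finally have "l1norm (\<lambda>x. c * E t x) \<le> ennreal e" .
    moreover have "\<bar>c * E t x\<bar> \<le> e * t powr (- (real DIM('a) / (2 * \<sigma>)))" for x
    proof -
      have "\<bar>c * E t x\<bar> \<le> \<bar>c\<bar> * (d * t powr (- (real DIM('a) / (2 * \<sigma>))))"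
        unfolding abs_mult using elim by (intro mult_left_mono) auto
      also have "\<dots> \<le> e * t powr (- (real DIM('a) / (2 * \<sigma>)))"
        unfolding mult.assoc[symmetric] using d by (intro mult_right_mono) auto
      finally show ?thesis .
    qed
    moreover have "(\<lambda>x. c * E t x) \<in> borel_measurable borel" by measurable
    ultimately show ?case by blast
  qed
qed

lemma vanishing_profile_sup_tendsto:
  fixes E :: "real \<Rightarrow> 'a::euclidean_space \<Rightarrow> real"
  assumes "vanishing_profile \<sigma> E"
  shows "((\<lambda>t. t powr (real DIM('a) / (2 * \<sigma>)) * E t (X t)) \<longlongrightarrow> 0) at_top"
proof (rule tendstoI)
  fix e :: real assume e: "e > 0"
  show "\<forall>\<^sub>F t in at_top. dist (t powr (real DIM('a) / (2 * \<sigma>)) * E t (X t)) 0 < e"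
    using assms[unfolded vanishing_profile_def, rule_format, OF half_gt_zero[OF e]] eventually_gt_at_top[of 0]
  proof eventually_elim
    case (elim t)
    then have "\<bar>E t (X t)\<bar> \<le> e / 2 * t powr (- (real DIM('a) / (2 * \<sigma>)))" by auto
    then have "t powr (real DIM('a) / (2 * \<sigma>)) * \<bar>E t (X t)\<bar> \<le> t powr (real DIM('a) / (2 * \<sigma>)) * (e / 2 * t powr (- (real DIM('a) / (2 * \<sigma>))))"
      by (rule mult_left_mono) simp
    also have "\<dots> = e / 2" using elim by (simp add: powr_minus)
    finally show ?case using e by (simp add: abs_mult)
  qed
qed

lemma vanishing_profile_L1_tendsto:
  fixes E :: "real \<Rightarrow> 'a::euclidean_space \<Rightarrow> real"
  assumes "vanishing_profile \<sigma> E"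
  shows "((\<lambda>t. enn2real (l1norm (E t))) \<longlongrightarrow> 0) at_top"
proof (rule tendstoI)
  fix e :: real assume e: "e > 0"
  show "\<forall>\<^sub>F t in at_top. dist (enn2real (l1norm (E t))) 0 < e"
    using assms[unfolded vanishing_profile_def, rule_format, OF half_gt_zero[OF e]]
  proof eventually_elim
    case (elim t)
    then have "enn2real (l1norm (E t)) \<le> e / 2"
      using e by (intro enn2real_leI) auto
    then show ?case using e by simp
  qed
qed

text \<open>
  For fixed \<open>y\<close> the modulus tends to zero, and it is bounded, so its average against the integrable
  \<open>|f|\<close> tends to zero. The maximum with \<open>1/2\<close> is inactive for \<open>t \<ge> 2\<tau>\<close> and keeps the integrand
  bounded for all other \<open>t\<close>.
\<close>

lemma modulus_average_tendsto:
  fixes f :: "'a::euclidean_space \<Rightarrow> real" and W :: "real \<Rightarrow> 'a \<Rightarrow> real"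
  assumes f: "integrable lborel f"
    and meas: "\<And>r. r > 0 \<Longrightarrow> W r \<in> borel_measurable borel"
    and W: "\<And>r y. 1 / 2 \<le> r \<Longrightarrow> 0 \<le> W r y \<and> W r y \<le> B"
    and lim: "\<And>(r :: real \<Rightarrow> real) y. (r \<longlongrightarrow> 1) at_top \<Longrightarrow> (y \<longlongrightarrow> 0) at_top \<Longrightarrow> ((\<lambda>i. W (r i) (y i)) \<longlongrightarrow> 0) at_top"
    and k: "k > 0"
  shows "((\<lambda>t. \<integral>y. \<bar>f y\<bar> * W (max (1 / 2) ((t - \<tau>) / t)) (t powr (- k) *\<^sub>R y) \<partial>lborel) \<longlongrightarrow> 0) at_top"
proof -
  have r: "((\<lambda>t. max (1 / 2) ((t - \<tau>) / t)) \<longlongrightarrow> 1) at_top" for \<tau> :: real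
  proof -
    have "((\<lambda>t::real. (t - \<tau>) / t) \<longlongrightarrow> 1) at_top" by real_asymp
    from tendsto_max[OF tendsto_const this, of "1 / 2"] show ?thesis by simp
  qed
  have c: "((\<lambda>t::real. t powr (- k)) \<longlongrightarrow> 0) at_top" using k by real_asymp
  note [measurable] = borel_measurable_integrable[OF f]
  have "((\<lambda>t. \<integral>y. \<bar>f y\<bar> * W (max (1 / 2) ((t - \<tau>) / t)) (t powr (- k) *\<^sub>R y) \<partial>lborel) \<longlongrightarrow> integral\<^sup>L (lborel :: 'a measure) (\<lambda>_. 0)) at_top"
  proof (rule integral_dominated_convergence_at_top[where w = "\<lambda>y. B * \<bar>f y\<bar>"])
    show "(\<lambda>y. \<bar>f y\<bar> * W (max (1 / 2) ((t - \<tau>) / t)) (t powr (- k) *\<^sub>R y)) \<in> borel_measurable lborel" for t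
    proof -
      have [measurable]: "W (max (1 / 2) ((t - \<tau>) / t)) \<in> borel_measurable borel" by (rule meas) simp
      show ?thesis by measurable
    qed
    show "integrable lborel (\<lambda>y. B * \<bar>f y\<bar>)" by (intro integrable_mult_right integrable_abs f)
    show "AE y in lborel. ((\<lambda>t. \<bar>f y\<bar> * W (max (1 / 2) ((t - \<tau>) / t)) (t powr (- k) *\<^sub>R y)) \<longlongrightarrow> 0) at_top"
    proof (rule AE_I2)
      fix y :: 'a
      have "((\<lambda>t. t powr (- k) *\<^sub>R y) \<longlongrightarrow> 0) at_top" using tendsto_scaleR[OF c tendsto_const, of y] by simp
      from tendsto_mult[OF tendsto_const lim[OF r this], of "\<bar>f y\<bar>"]
      show "((\<lambda>t. \<bar>f y\<bar> * W (max (1 / 2) ((t - \<tau>) / t)) (t powr (- k) *\<^sub>R y)) \<longlongrightarrow> 0) at_top" by simp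
    qed
    show "\<forall>\<^sub>F t in at_top. AE y in lborel. norm (\<bar>f y\<bar> * W (max (1 / 2) ((t - \<tau>) / t)) (t powr (- k) *\<^sub>R y)) \<le> B * \<bar>f y\<bar>"
    proof (intro always_eventually allI AE_I2)
      fix t y
      have "1 / 2 \<le> max (1 / 2) ((t - \<tau>) / t)" by simp
      from W[OF this, of "t powr (- k) *\<^sub>R y"]
      have "\<bar>W (max (1 / 2) ((t - \<tau>) / t)) (t powr (- k) *\<^sub>R y)\<bar> \<le> B" by linarith
      from mult_left_mono[OF this abs_ge_zero[of "f y"]]
      show "norm (\<bar>f y\<bar> * W (max (1 / 2) ((t - \<tau>) / t)) (t powr (- k) *\<^sub>R y)) \<le> B * \<bar>f y\<bar>"
        by (simp only: real_norm_def abs_mult abs_abs mult.commute[of B])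
    qed
  qed simp
  then show ?thesis by simp
qed

text \<open>
  The error splits into \<open>(a(t - \<tau>) - \<alpha>) G(t - \<tau>) * f\<close>, small because of the coefficient, and \<open>\<alpha>\<close> times
  \<open>\<integral> (G(t - \<tau>, x - y) - G(t, x)) f(y) dy\<close>, small because of the moduli of continuity.
\<close>

lemma heat_op_asymptotics:
  fixes f :: "'a::euclidean_space \<Rightarrow> real"
  assumes \<sigma>: "\<sigma> > 0" and f: "integrable lborel f" and a: "(a \<longlongrightarrow> \<alpha>) at_top" and \<tau>: "\<tau> \<ge> 0"
  shows "vanishing_profile \<sigma> (\<lambda>t x. a (t - \<tau>) * heat_op \<sigma> (t - \<tau>) f x - \<alpha> * heat_kernel \<sigma> t x * (\<integral>y. f y \<partial>lborel))"
proof -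
  let ?D = "real DIM('a) / (2 * \<sigma>)" and ?k = "1 / (2 * \<sigma>)"
  let ?L = "kernel_L1 \<sigma> TYPE('a)" and ?S = "kernel_sup \<sigma> TYPE('a)"
  note [measurable] = borel_measurable_integrable[OF f]
  have fm: "f \<in> borel_measurable borel" by measurable
  define I where "I = (\<integral>y. \<bar>f y\<bar> \<partial>lborel)"
  have I: "I \<ge> 0" by (simp add: I_def)
  have nI: "l1norm f = ennreal I"
    unfolding I_def using f by (intro nn_integral_eq_integral) auto
  define B0 where "B0 = (\<integral>\<xi>. 2 * frac_symbol \<sigma> (\<xi>::'a) powr (1 / 2) \<partial>lborel)"
  define W1 where "W1 t = (\<integral>y. \<bar>f y\<bar> * sup_modulus \<sigma> (max (1 / 2) ((t - \<tau>) / t)) (t powr (- ?k) *\<^sub>R y) \<partial>lborel)" for t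
  define W2 where "W2 t = (\<integral>y. \<bar>f y\<bar> * l1_modulus \<sigma> (max (1 / 2) ((t - \<tau>) / t)) (t powr (- ?k) *\<^sub>R y) \<partial>lborel)" for t
  have W1: "(W1 \<longlongrightarrow> 0) at_top"
    unfolding W1_def
    by (rule modulus_average_tendsto[OF f])
       (use \<sigma> sup_modulus_nonneg sup_modulus_bounded[OF \<sigma>] in \<open>auto intro: sup_modulus_tendsto\<close>)
  have W2: "(W2 \<longlongrightarrow> 0) at_top"
    unfolding W2_def
    by (rule modulus_average_tendsto[OF f, where W = "l1_modulus \<sigma>" and B = "2 * ?L"])
       (use \<sigma> l1_modulus_nonneg l1_modulus_bounded[OF \<sigma>, where 'a = 'a] l1_modulus_measurable[OF \<sigma>] in \<open>auto intro: l1_modulus_tendsto\<close>)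
  have aa: "((\<lambda>t. a (t - \<tau>)) \<longlongrightarrow> \<alpha>) at_top"
    by (rule filterlim_compose[OF a]) real_asymp
  have ad: "((\<lambda>t. \<bar>a (t - \<tau>) - \<alpha>\<bar>) \<longlongrightarrow> 0) at_top"
    using tendsto_rabs[OF tendsto_diff[OF aa tendsto_const[of \<alpha>]]] by simp
  have large: "\<forall>\<^sub>F t in at_top. t > 2 * \<tau> \<and> t > 0"
    by (intro eventually_conj eventually_gt_at_top)
  define E where "E t x = a (t - \<tau>) * heat_op \<sigma> (t - \<tau>) f x - \<alpha> * heat_kernel \<sigma> t x * (\<integral>y. f y \<partial>lborel)" for t x
  have split: "\<bar>E t x\<bar> \<le> \<bar>a (t - \<tau>) - \<alpha>\<bar> * \<bar>heat_op \<sigma> (t - \<tau>) f x\<bar>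
      + \<bar>\<alpha>\<bar> * \<bar>\<integral>y. (heat_kernel \<sigma> (t - \<tau>) (x - y) - heat_kernel \<sigma> t x) * f y \<partial>lborel\<bar>"
    if t: "t > 2 * \<tau> \<and> t > 0" for t x
  proof -
    have "E t x = (a (t - \<tau>) - \<alpha>) * heat_op \<sigma> (t - \<tau>) f x
        + \<alpha> * (heat_op \<sigma> (t - \<tau>) f x - heat_kernel \<sigma> t x * (\<integral>y. f y \<partial>lborel))"
      by (simp add: E_def algebra_simps)
    also have "heat_op \<sigma> (t - \<tau>) f x - heat_kernel \<sigma> t x * (\<integral>y. f y \<partial>lborel)
        = (\<integral>y. (heat_kernel \<sigma> (t - \<tau>) (x - y) - heat_kernel \<sigma> t x) * f y \<partial>lborel)"
      using t \<tau> by (intro heat_op_minus_kernel[OF \<sigma> _ _ f]) auto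
    finally show ?thesis
      by (simp add: abs_mult[symmetric])
  qed
  have "vanishing_profile \<sigma> E"
  proof (rule vanishing_profileI)
    show "\<forall>\<^sub>F t in at_top. E t \<in> borel_measurable borel"
      using large
    proof eventually_elim
      case (elim t)
      then have "t - \<tau> > 0" "t > 0" using \<tau> by auto
      note [measurable] = heat_op_measurable[OF \<sigma> this(1) fm] heat_kernel_measurable[OF \<sigma> this(2), where 'a = 'a]
      show ?case unfolding E_def by measurable
    qed
    show "((\<lambda>t. \<bar>a (t - \<tau>) - \<alpha>\<bar> * (?S * 2 powr ?D * I) + \<bar>\<alpha>\<bar> * W1 t) \<longlongrightarrow> 0) at_top"
      by (intro tendsto_add_zero tendsto_mult_left_zero[OF ad] tendsto_mult_right_zero[OF W1])
    show "\<forall>\<^sub>F t in at_top. \<forall>x. \<bar>E t x\<bar> \<le> (\<bar>a (t - \<tau>) - \<alpha>\<bar> * (?S * 2 powr ?D * I) + \<bar>\<alpha>\<bar> * W1 t) * t powr (- ?D)"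
      using large
    proof eventually_elim
      case (elim t)
      have st: "t - \<tau> > 0" "t > 0" using elim \<tau> by auto
      have rr: "max (1 / 2) ((t - \<tau>) / t) = (t - \<tau>) / t" using elim by (simp add: max_def field_simps)
      show ?case
      proof
        fix x
        have "(t - \<tau>) powr (- ?D) \<le> (t / 2) powr (- ?D)"
          using elim \<sigma> \<tau> by (intro powr_mono2') auto
        also have "\<dots> = 2 powr ?D * t powr (- ?D)"
          using powr_minus_divide[of 2 ?D] st by (simp add: powr_divide)
        finally have p: "(t - \<tau>) powr (- ?D) \<le> 2 powr ?D * t powr (- ?D)" .
        have 1: "\<bar>heat_op \<sigma> (t - \<tau>) f x\<bar> \<le> ?S * (2 powr ?D * t powr (- ?D)) * I"
          by (rule order_trans[OF heat_op_sup_bound_L1[OF \<sigma> st(1) f]], unfold I_def[symmetric])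
             (intro mult_right_mono mult_left_mono p kernel_sup_nonneg I)
        have "norm (\<integral>y. (heat_kernel \<sigma> (t - \<tau>) (x - y) - heat_kernel \<sigma> t x) * f y \<partial>lborel)
            \<le> (\<integral>y. t powr (- ?D) * (\<bar>f y\<bar> * sup_modulus \<sigma> ((t - \<tau>) / t) (t powr (- ?k) *\<^sub>R y)) \<partial>lborel)"
        proof (rule order_trans[OF integral_norm_bound integral_mono])
          show "integrable lborel (\<lambda>y. norm ((heat_kernel \<sigma> (t - \<tau>) (x - y) - heat_kernel \<sigma> t x) * f y))"
            unfolding left_diff_distrib
            by (rule integrable_norm, rule Bochner_Integration.integrable_diff,
                rule integrable_heat_convolution[OF \<sigma> st(1) f], rule integrable_mult_right, rule f)
          show "integrable lborel (\<lambda>y. t powr (- ?D) * (\<bar>f y\<bar> * sup_modulus \<sigma> ((t - \<tau>) / t) (t powr (- ?k) *\<^sub>R y)))"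
          proof (rule integrable_mult_right, rule Bochner_Integration.integrable_bound)
            show "integrable lborel (\<lambda>y. B0 * \<bar>f y\<bar>)"
              by (intro integrable_mult_right integrable_abs f)
            have "1 / 2 \<le> (t - \<tau>) / t" using rr by (metis max.cobounded1)
            then have "sup_modulus \<sigma> ((t - \<tau>) / t) y \<le> B0" for y :: 'a
              unfolding B0_def by (rule sup_modulus_bounded[OF \<sigma>])
            then have le: "\<bar>f y\<bar> * sup_modulus \<sigma> ((t - \<tau>) / t) (t powr (- ?k) *\<^sub>R y) \<le> \<bar>f y\<bar> * B0" for y
              by (rule mult_left_mono) simp
            have "norm (\<bar>f y\<bar> * sup_modulus \<sigma> ((t - \<tau>) / t) (t powr (- ?k) *\<^sub>R y)) \<le> norm (B0 * \<bar>f y\<bar>)" for y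
              using le[of y] mult_nonneg_nonneg[OF abs_ge_zero sup_modulus_nonneg, of "f y" \<sigma> "(t - \<tau>) / t" "t powr (- ?k) *\<^sub>R y"]
              unfolding real_norm_def mult.commute[of B0] by linarith
            then show "AE y in lborel. norm (\<bar>f y\<bar> * sup_modulus \<sigma> ((t - \<tau>) / t) (t powr (- ?k) *\<^sub>R y)) \<le> norm (B0 * \<bar>f y\<bar>)"
              by (intro AE_I2)
          qed measurable
          show "norm ((heat_kernel \<sigma> (t - \<tau>) (x - y) - heat_kernel \<sigma> t x) * f y)
              \<le> t powr (- ?D) * (\<bar>f y\<bar> * sup_modulus \<sigma> ((t - \<tau>) / t) (t powr (- ?k) *\<^sub>R y))" for y
            using mult_right_mono[OF heat_kernel_difference_sup[OF \<sigma> st(2) st(1), of x y] abs_ge_zero[of "f y"]]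
            unfolding real_norm_def abs_mult by (simp only: mult_ac)
        qed
        also have "\<dots> = t powr (- ?D) * W1 t"
          unfolding W1_def rr by (rule integral_mult_right_zero)
        finally have 2: "\<bar>\<integral>y. (heat_kernel \<sigma> (t - \<tau>) (x - y) - heat_kernel \<sigma> t x) * f y \<partial>lborel\<bar> \<le> t powr (- ?D) * W1 t"
          unfolding real_norm_def .
        have "\<bar>E t x\<bar> \<le> \<bar>a (t - \<tau>) - \<alpha>\<bar> * (?S * (2 powr ?D * t powr (- ?D)) * I) + \<bar>\<alpha>\<bar> * (t powr (- ?D) * W1 t)"
          by (rule order_trans[OF split[OF elim]]) (intro add_mono mult_left_mono 1 2 abs_ge_zero)
        then show "\<bar>E t x\<bar> \<le> (\<bar>a (t - \<tau>) - \<alpha>\<bar> * (?S * 2 powr ?D * I) + \<bar>\<alpha>\<bar> * W1 t) * t powr (- ?D)"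
          by (simp add: algebra_simps)
      qed
    qed
    show "((\<lambda>t. \<bar>a (t - \<tau>) - \<alpha>\<bar> * (?L * I) + \<bar>\<alpha>\<bar> * W2 t) \<longlongrightarrow> 0) at_top"
      by (intro tendsto_add_zero tendsto_mult_left_zero[OF ad] tendsto_mult_right_zero[OF W2])
    show "\<forall>\<^sub>F t in at_top. (l1norm (E t)) \<le> ennreal (\<bar>a (t - \<tau>) - \<alpha>\<bar> * (?L * I) + \<bar>\<alpha>\<bar> * W2 t)"
      using large
    proof eventually_elim
      case (elim t)
      have st: "t - \<tau> > 0" "t > 0" using elim \<tau> by auto
      have rr: "max (1 / 2) ((t - \<tau>) / t) = (t - \<tau>) / t" using elim by (simp add: max_def field_simps)
      have stt: "(t - \<tau>) / t > 0" using st by simp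
      note [measurable] = heat_op_measurable[OF \<sigma> st(1) fm] heat_kernel_measurable[OF \<sigma> st(1), where 'a = 'a]
        heat_kernel_measurable[OF \<sigma> st(2), where 'a = 'a] l1_modulus_measurable[OF \<sigma> stt, where 'a = 'a]
      let ?R = "\<lambda>x. \<integral>y. (heat_kernel \<sigma> (t - \<tau>) (x - y) - heat_kernel \<sigma> t x) * f y \<partial>lborel"
      have "l1norm ?R
          \<le> (\<integral>\<^sup>+ y. l1norm (\<lambda>x. (heat_kernel \<sigma> (t - \<tau>) (x - y) - heat_kernel \<sigma> t x) * f y) \<partial>lborel)"
        by (rule nn_integral_abs_integral_le) measurable
      also have "\<dots> = (\<integral>\<^sup>+ y. ennreal (\<bar>f y\<bar> * l1_modulus \<sigma> ((t - \<tau>) / t) (t powr (- ?k) *\<^sub>R y)) \<partial>lborel)"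
        by (intro nn_integral_cong)
           (simp add: abs_mult ennreal_mult nn_integral_cmult heat_kernel_difference_l1[OF \<sigma> st(2) st(1)] l1_modulus_nonneg mult.commute[of _ "\<bar>f _\<bar>"])
      also have "\<dots> = ennreal (W2 t)"
        unfolding W2_def rr
      proof (rule nn_integral_eq_integral)
        show "integrable lborel (\<lambda>y. \<bar>f y\<bar> * l1_modulus \<sigma> ((t - \<tau>) / t) (t powr (- ?k) *\<^sub>R y))"
        proof (rule Bochner_Integration.integrable_bound)
          show "integrable lborel (\<lambda>y. \<bar>f y\<bar> * (2 * ?L))"
            by (intro integrable_mult_left integrable_abs f)
          show "AE y in lborel. norm (\<bar>f y\<bar> * l1_modulus \<sigma> ((t - \<tau>) / t) (t powr (- ?k) *\<^sub>R y)) \<le> norm (\<bar>f y\<bar> * (2 * ?L))"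
            using l1_modulus_bounded[OF \<sigma> stt, where 'a = 'a]
            by (intro AE_I2) (simp add: abs_mult l1_modulus_nonneg kernel_L1_nonneg mult_left_mono)
        qed measurable
      qed (simp add: l1_modulus_nonneg)
      finally have 2: "l1norm ?R \<le> ennreal (W2 t)" .
      have 1: "l1norm (heat_op \<sigma> (t - \<tau>) f) \<le> ennreal (?L * I)"
        using heat_op_L1_bound[OF \<sigma> st(1) fm] I kernel_L1_nonneg[of \<sigma>, where 'a = 'a] by (simp add: nI ennreal_mult)
      have W2p: "W2 t \<ge> 0" unfolding W2_def by (intro integral_nonneg_AE AE_I2) (simp add: l1_modulus_nonneg)
      have "l1norm (E t) \<le> (\<integral>\<^sup>+ x. ennreal \<bar>a (t - \<tau>) - \<alpha>\<bar> * ennreal \<bar>heat_op \<sigma> (t - \<tau>) f x\<bar>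
          + ennreal \<bar>\<alpha>\<bar> * ennreal \<bar>?R x\<bar> \<partial>lborel)"
        using split[OF elim] by (intro nn_integral_mono) (simp flip: ennreal_mult ennreal_plus)
      also have "\<dots> = ennreal \<bar>a (t - \<tau>) - \<alpha>\<bar> * l1norm (heat_op \<sigma> (t - \<tau>) f)
          + ennreal \<bar>\<alpha>\<bar> * l1norm ?R"
        by (subst nn_integral_add) (auto simp: nn_integral_cmult)
      also have "\<dots> \<le> ennreal \<bar>a (t - \<tau>) - \<alpha>\<bar> * ennreal (?L * I) + ennreal \<bar>\<alpha>\<bar> * ennreal (W2 t)"
        by (intro add_mono mult_left_mono 1 2) auto
      also have "\<dots> = ennreal (\<bar>a (t - \<tau>) - \<alpha>\<bar> * (?L * I) + \<bar>\<alpha>\<bar> * W2 t)"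
        using I W2p kernel_L1_nonneg[of \<sigma>, where 'a = 'a] by (simp add: ennreal_mult ennreal_plus)
      finally show ?case .
    qed
  qed
  then show ?thesis unfolding E_def .
qed

section \<open>Duhamel integrals\<close>

text \<open>
  The properties of \<open>N(\<tau>) = u(\<tau>)\<^sup>p\<close> that the Duhamel integral needs. Continuity in time
  with values in \<open>L\<^sup>1\<close> takes the place of joint measurability in \<open>(\<tau>, x)\<close>.
\<close>

locale decaying_source =
  fixes \<sigma> \<kappa> B :: real and N :: "real \<Rightarrow> 'a::euclidean_space \<Rightarrow> real"
  assumes \<sigma>: "\<sigma> > 0" and \<kappa>: "\<kappa> > 1" and B: "B \<ge> 0"
    and meas: "\<And>\<tau>. \<tau> \<ge> 0 \<Longrightarrow> N \<tau> \<in> borel_measurable borel"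
    and L1: "\<And>\<tau>. \<tau> \<ge> 0 \<Longrightarrow> (l1norm (N \<tau>)) \<le> ennreal (B * (1 + \<tau>) powr (- \<kappa>))"
    and Linf: "\<And>\<tau>. \<tau> \<ge> 0 \<Longrightarrow>
      AE x in lborel. \<bar>N \<tau> x\<bar> \<le> B * ((1 + \<tau>) powr (- \<kappa>) * (1 + \<tau>) powr (- (real DIM('a) / (2 * \<sigma>))))"
    and cont: "\<And>\<tau>. \<tau> \<ge> 0 \<Longrightarrow> ((\<lambda>s. \<integral>x. \<bar>N s x - N \<tau> x\<bar> \<partial>lborel) \<longlongrightarrow> 0) (at \<tau> within {0..})"
begin


lemma source_integrable: "\<tau> \<ge> 0 \<Longrightarrow> integrable lborel (N \<tau>)"
  using meas[of \<tau>] le_less_trans[OF L1[of \<tau>] ennreal_less_top] by (simp add: integrable_iff_bounded)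

lemma source_L1: "\<tau> \<ge> 0 \<Longrightarrow> (\<integral>x. \<bar>N \<tau> x\<bar> \<partial>lborel) \<le> B * (1 + \<tau>) powr (- \<kappa>)"
  using L1[of \<tau>] nn_integral_eq_integral[OF integrable_abs[OF source_integrable[of \<tau>]]] B
  by (simp add: ennreal_le_iff)

lemma source_mass_bound: "\<tau> \<ge> 0 \<Longrightarrow> \<bar>\<integral>x. N \<tau> x \<partial>lborel\<bar> \<le> B * (1 + \<tau>) powr (- \<kappa>)"
  using integral_abs_bound[of lborel "N \<tau>"] source_L1[of \<tau>] by linarith

lemma continuous_source_mass: "continuous_on {0..} (\<lambda>\<tau>. \<integral>x. N \<tau> x \<partial>lborel)"
  unfolding continuous_on_def
proof
  fix \<tau> :: real assume t: "\<tau> \<in> {0..}"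
  show "((\<lambda>s. \<integral>x. N s x \<partial>lborel) \<longlongrightarrow> (\<integral>x. N \<tau> x \<partial>lborel)) (at \<tau> within {0..})"
  proof (rule tendsto_dist_iff[THEN iffD2], rule tendsto_sandwich[OF _ _ tendsto_const])
    show "((\<lambda>s. \<integral>x. \<bar>N s x - N \<tau> x\<bar> \<partial>lborel) \<longlongrightarrow> 0) (at \<tau> within {0..})" using t cont by simp
    have "dist (\<integral>x. N s x \<partial>lborel) (\<integral>x. N \<tau> x \<partial>lborel) \<le> (\<integral>x. \<bar>N s x - N \<tau> x\<bar> \<partial>lborel)"
      if s: "s \<in> {0..}" for s
    proof -
      have "(\<integral>x. N s x \<partial>lborel) - (\<integral>x. N \<tau> x \<partial>lborel) = (\<integral>x. N s x - N \<tau> x \<partial>lborel)"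
        by (rule Bochner_Integration.integral_diff[symmetric]) (use s t source_integrable in auto)
      then show ?thesis using integral_abs_bound[of lborel "\<lambda>x. N s x - N \<tau> x"] by (simp add: dist_real_def)
    qed
    then show "\<forall>\<^sub>F s in at \<tau> within {0..}. dist (\<integral>x. N s x \<partial>lborel) (\<integral>x. N \<tau> x \<partial>lborel) \<le> (\<integral>x. \<bar>N s x - N \<tau> x\<bar> \<partial>lborel)"
      by (simp add: eventually_at_filter)
  qed simp
qed

text \<open>
  Convolution with the continuous and bounded kernel turns continuity of the source in \<open>L\<^sup>1\<close> into
  pointwise joint continuity in time and space. This makes the integrand of the Duhamel integral jointly
  measurable, so that Tonelli's theorem applies to it.
\<close>

lemma continuous_heat_op_source:
  "continuous_on ({0..<t} \<times> UNIV) (\<lambda>p. heat_op \<sigma> (t - fst p) (N (fst p)) (snd p))"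
  unfolding continuous_on_sequentially
proof (intro allI ballI impI, elim conjE)
  fix X :: "nat \<Rightarrow> real \<times> 'a" and p
  assume p: "p \<in> {0..<t} \<times> UNIV" and Xin: "\<forall>n. X n \<in> {0..<t} \<times> UNIV" and X: "X \<longlonglongrightarrow> p"
  define \<tau> x where "\<tau> = fst p" and "x = snd p"
  define \<tau>n xn where "\<tau>n n = fst (X n)" and "xn n = snd (X n)" for n
  have tn: "\<tau>n \<longlonglongrightarrow> \<tau>" and xn: "xn \<longlonglongrightarrow> x"
    using tendsto_fst[OF X] tendsto_snd[OF X] by (auto simp: \<tau>_def x_def \<tau>n_def[abs_def] xn_def[abs_def])
  have pos: "0 \<le> \<tau>" "0 < t - \<tau>" "0 \<le> \<tau>n n" "0 < t - \<tau>n n" for n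
    using p Xin[rule_format, of n] by (auto simp: \<tau>_def \<tau>n_def mem_Times_iff)
  note [measurable] = meas[OF pos(1)] meas[OF pos(3)]
  have s: "(\<lambda>n. t - \<tau>n n) \<longlonglongrightarrow> t - \<tau>" by (intro tendsto_intros tn)
  have sD: "(\<lambda>n. (t - \<tau>n n) powr (- (real DIM('a) / (2 * \<sigma>)))) \<longlonglongrightarrow> (t - \<tau>) powr (- (real DIM('a) / (2 * \<sigma>)))"
    using pos(2) by (intro tendsto_intros s) auto
  obtain M where M: "\<And>n. (t - \<tau>n n) powr (- (real DIM('a) / (2 * \<sigma>))) \<le> M"
    using convergent_imp_Bseq[OF convergentI[OF sD]] by (auto simp: Bseq_def)
  have dist0: "(\<lambda>n. \<integral>y. \<bar>N (\<tau>n n) y - N \<tau> y\<bar> \<partial>lborel) \<longlonglongrightarrow> 0"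
  proof -
    have "continuous (at \<tau> within {0..}) (\<lambda>s. \<integral>y. \<bar>N s y - N \<tau> y\<bar> \<partial>lborel)"
      unfolding continuous_within using cont[OF pos(1)] by simp
    from continuous_within_tendsto_compose'[OF this _ tn] pos(3) show ?thesis by simp
  qed
  have 1: "(\<lambda>n. heat_op \<sigma> (t - \<tau>n n) (\<lambda>y. N (\<tau>n n) y - N \<tau> y) (xn n)) \<longlonglongrightarrow> 0"
  proof (rule Lim_null_comparison)
    show "(\<lambda>n. kernel_sup \<sigma> TYPE('a) * M * (\<integral>y. \<bar>N (\<tau>n n) y - N \<tau> y\<bar> \<partial>lborel)) \<longlonglongrightarrow> 0"
      by (rule tendsto_mult_right_zero[OF dist0])
    show "\<forall>\<^sub>F n in sequentially. norm (heat_op \<sigma> (t - \<tau>n n) (\<lambda>y. N (\<tau>n n) y - N \<tau> y) (xn n))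
        \<le> kernel_sup \<sigma> TYPE('a) * M * (\<integral>y. \<bar>N (\<tau>n n) y - N \<tau> y\<bar> \<partial>lborel)"
    proof (intro always_eventually allI)
      fix n
      have "\<bar>heat_op \<sigma> (t - \<tau>n n) (\<lambda>y. N (\<tau>n n) y - N \<tau> y) (xn n)\<bar>
          \<le> kernel_sup \<sigma> TYPE('a) * (t - \<tau>n n) powr (- (real DIM('a) / (2 * \<sigma>))) * (\<integral>y. \<bar>N (\<tau>n n) y - N \<tau> y\<bar> \<partial>lborel)"
        by (intro heat_op_sup_bound_L1 \<sigma> pos Bochner_Integration.integrable_diff source_integrable)
      also have "\<dots> \<le> kernel_sup \<sigma> TYPE('a) * M * (\<integral>y. \<bar>N (\<tau>n n) y - N \<tau> y\<bar> \<partial>lborel)"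
        by (intro mult_right_mono mult_left_mono M kernel_sup_nonneg) simp
      finally show "norm (heat_op \<sigma> (t - \<tau>n n) (\<lambda>y. N (\<tau>n n) y - N \<tau> y) (xn n))
        \<le> kernel_sup \<sigma> TYPE('a) * M * (\<integral>y. \<bar>N (\<tau>n n) y - N \<tau> y\<bar> \<partial>lborel)" by simp
    qed
  qed
  have 2: "(\<lambda>n. \<integral>y. heat_kernel \<sigma> (t - \<tau>n n) (xn n - y) * N \<tau> y \<partial>lborel)
      \<longlonglongrightarrow> (\<integral>y. heat_kernel \<sigma> (t - \<tau>) (x - y) * N \<tau> y \<partial>lborel)"
  proof (rule integral_dominated_convergence[where w = "\<lambda>y. kernel_sup \<sigma> TYPE('a) * M * \<bar>N \<tau> y\<bar>"])
    note [measurable] = heat_kernel_measurable[OF \<sigma> pos(2), where 'a = 'a] heat_kernel_measurable[OF \<sigma> pos(4), where 'a = 'a]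
    show "(\<lambda>y. heat_kernel \<sigma> (t - \<tau>) (x - y) * N \<tau> y) \<in> borel_measurable lborel" by measurable
    show "(\<lambda>y. heat_kernel \<sigma> (t - \<tau>n n) (xn n - y) * N \<tau> y) \<in> borel_measurable lborel" for n by measurable
    show "integrable lborel (\<lambda>y. kernel_sup \<sigma> TYPE('a) * M * \<bar>N \<tau> y\<bar>)"
      by (intro integrable_mult_right integrable_abs source_integrable pos)
    show "AE y in lborel. (\<lambda>n. heat_kernel \<sigma> (t - \<tau>n n) (xn n - y) * N \<tau> y) \<longlonglongrightarrow> heat_kernel \<sigma> (t - \<tau>) (x - y) * N \<tau> y"
    proof (rule AE_I2)
      fix y
      have "(\<lambda>n. heat_kernel \<sigma> (fst (t - \<tau>n n, xn n - y)) (snd (t - \<tau>n n, xn n - y)))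
          \<longlonglongrightarrow> heat_kernel \<sigma> (fst (t - \<tau>, x - y)) (snd (t - \<tau>, x - y))"
      proof (rule continuous_on_tendsto_compose[OF continuous_on_heat_kernel[OF \<sigma>]])
        show "(\<lambda>n. (t - \<tau>n n, xn n - y)) \<longlonglongrightarrow> (t - \<tau>, x - y)" by (intro tendsto_intros s xn)
      qed (use pos in auto)
      then show "(\<lambda>n. heat_kernel \<sigma> (t - \<tau>n n) (xn n - y) * N \<tau> y) \<longlonglongrightarrow> heat_kernel \<sigma> (t - \<tau>) (x - y) * N \<tau> y"
        unfolding fst_conv snd_conv by (rule tendsto_mult_right)
    qed
    show "AE y in lborel. norm (heat_kernel \<sigma> (t - \<tau>n n) (xn n - y) * N \<tau> y) \<le> kernel_sup \<sigma> TYPE('a) * M * \<bar>N \<tau> y\<bar>" for n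
    proof (rule AE_I2)
      fix y
      have "\<bar>heat_kernel \<sigma> (t - \<tau>n n) (xn n - y)\<bar> \<le> kernel_sup \<sigma> TYPE('a) * M"
        by (rule order_trans[OF heat_kernel_bounded[OF \<sigma> pos(4)]]) (intro mult_left_mono M kernel_sup_nonneg)
      from mult_right_mono[OF this abs_ge_zero[of "N \<tau> y"]]
      show "norm (heat_kernel \<sigma> (t - \<tau>n n) (xn n - y) * N \<tau> y) \<le> kernel_sup \<sigma> TYPE('a) * M * \<bar>N \<tau> y\<bar>"
        unfolding real_norm_def abs_mult .
    qed
  qed
  have eq: "heat_op \<sigma> (t - \<tau>n n) (N (\<tau>n n)) (xn n) = heat_op \<sigma> (t - \<tau>n n) (\<lambda>y. N (\<tau>n n) y - N \<tau> y) (xn n)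
      + (\<integral>y. heat_kernel \<sigma> (t - \<tau>n n) (xn n - y) * N \<tau> y \<partial>lborel)" for n
  proof -
    have "heat_op \<sigma> (t - \<tau>n n) (\<lambda>y. N (\<tau>n n) y - N \<tau> y) (xn n)
        = (\<integral>y. heat_kernel \<sigma> (t - \<tau>n n) (xn n - y) * N (\<tau>n n) y - heat_kernel \<sigma> (t - \<tau>n n) (xn n - y) * N \<tau> y \<partial>lborel)"
      by (subst heat_op_eq_convolution[OF \<sigma> pos(4)]) (simp_all add: right_diff_distrib)
    also have "\<dots> = (\<integral>y. heat_kernel \<sigma> (t - \<tau>n n) (xn n - y) * N (\<tau>n n) y \<partial>lborel)
        - (\<integral>y. heat_kernel \<sigma> (t - \<tau>n n) (xn n - y) * N \<tau> y \<partial>lborel)"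
      by (intro Bochner_Integration.integral_diff integrable_heat_convolution \<sigma> pos source_integrable)
    finally show ?thesis using heat_op_eq_convolution[OF \<sigma> pos(4) meas[OF pos(3)]] by simp
  qed
  have "(\<lambda>n. heat_op \<sigma> (t - \<tau>n n) (N (\<tau>n n)) (xn n)) \<longlonglongrightarrow> heat_op \<sigma> (t - \<tau>) (N \<tau>) x"
    unfolding eq heat_op_eq_convolution[OF \<sigma> pos(2) meas[OF pos(1)]] using tendsto_add[OF 1 2] by simp
  then show "((\<lambda>p. heat_op \<sigma> (t - fst p) (N (fst p)) (snd p)) \<circ> X) \<longlonglongrightarrow> heat_op \<sigma> (t - fst p) (N (fst p)) (snd p)"
    by (simp add: comp_def \<tau>_def x_def \<tau>n_def xn_def)
qed

text \<open>
  The second bound is the domination at \<open>L\<^sup>\<infinity>\<close>. For \<open>\<tau> \<le> t/2\<close> the kernel provides the factor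
  \<open>t\<^bsup>-n/(2\<sigma>)\<^esup>\<close>, acting from \<open>L\<^sup>1\<close> to \<open>L\<^sup>\<infinity>\<close>; for \<open>\<tau> > t/2\<close> the source itself provides it.
\<close>

lemma heat_op_source_bound:
  assumes "0 \<le> \<tau>" "\<tau> < t"
  shows "\<bar>heat_op \<sigma> (t - \<tau>) (N \<tau>) x\<bar> \<le> kernel_L1 \<sigma> TYPE('a) * B"
    and "\<bar>heat_op \<sigma> (t - \<tau>) (N \<tau>) x\<bar> \<le> 2 powr (real DIM('a) / (2 * \<sigma>)) * B * (kernel_sup \<sigma> TYPE('a) + kernel_L1 \<sigma> TYPE('a)) * (1 + \<tau>) powr (- \<kappa>) * t powr (- (real DIM('a) / (2 * \<sigma>)))"
    and "l1norm (heat_op \<sigma> (t - \<tau>) (N \<tau>)) \<le> ennreal (kernel_L1 \<sigma> TYPE('a) * B * (1 + \<tau>) powr (- \<kappa>))"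
proof -
  have st: "t - \<tau> > 0" and t: "t > 0" using assms by auto
  have Dpos: "(real DIM('a) / (2 * \<sigma>)) > 0" using \<sigma> by simp
  have L0: "kernel_L1 \<sigma> TYPE('a) \<ge> 0" and S0: "kernel_sup \<sigma> TYPE('a) \<ge> 0" by (rule kernel_L1_nonneg, rule kernel_sup_nonneg)
  have p1: "(1 + \<tau>) powr (- \<kappa>) \<le> 1" "(1 + \<tau>) powr (- (real DIM('a) / (2 * \<sigma>))) \<le> 1"
    using assms \<kappa> Dpos powr_mono2'[of "- \<kappa>" 1 "1 + \<tau>"] powr_mono2'[of "- (real DIM('a) / (2 * \<sigma>))" 1 "1 + \<tau>"] by auto
  have Linf': "\<bar>heat_op \<sigma> (t - \<tau>) (N \<tau>) x\<bar> \<le> kernel_L1 \<sigma> TYPE('a) * (B * ((1 + \<tau>) powr (- \<kappa>) * (1 + \<tau>) powr (- (real DIM('a) / (2 * \<sigma>)))))"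
    by (rule heat_op_sup_bound_sup[OF \<sigma> st meas[OF assms(1)] Linf[OF assms(1)]]) (use B in simp)
  also have "\<dots> \<le> kernel_L1 \<sigma> TYPE('a) * (B * (1 * 1))"
    using p1 B L0 by (intro mult_left_mono mult_mono) auto
  finally show "\<bar>heat_op \<sigma> (t - \<tau>) (N \<tau>) x\<bar> \<le> kernel_L1 \<sigma> TYPE('a) * B" by simp
  show "\<bar>heat_op \<sigma> (t - \<tau>) (N \<tau>) x\<bar> \<le> 2 powr (real DIM('a) / (2 * \<sigma>)) * B * (kernel_sup \<sigma> TYPE('a) + kernel_L1 \<sigma> TYPE('a)) * (1 + \<tau>) powr (- \<kappa>) * t powr (- (real DIM('a) / (2 * \<sigma>)))"
  proof (cases "\<tau> \<le> t / 2")
    case True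
    have "(t - \<tau>) powr (- (real DIM('a) / (2 * \<sigma>))) \<le> (t / 2) powr (- (real DIM('a) / (2 * \<sigma>)))" using True t Dpos by (intro powr_mono2') auto
    also have "\<dots> = 2 powr (real DIM('a) / (2 * \<sigma>)) * t powr (- (real DIM('a) / (2 * \<sigma>)))"
      using powr_minus_divide[of 2 "(real DIM('a) / (2 * \<sigma>))"] t by (simp add: powr_divide)
    finally have p: "(t - \<tau>) powr (- (real DIM('a) / (2 * \<sigma>))) \<le> 2 powr (real DIM('a) / (2 * \<sigma>)) * t powr (- (real DIM('a) / (2 * \<sigma>)))" .
    have "\<bar>heat_op \<sigma> (t - \<tau>) (N \<tau>) x\<bar> \<le> kernel_sup \<sigma> TYPE('a) * (t - \<tau>) powr (- (real DIM('a) / (2 * \<sigma>))) * (\<integral>y. \<bar>N \<tau> y\<bar> \<partial>lborel)"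
      by (rule heat_op_sup_bound_L1[OF \<sigma> st source_integrable[OF assms(1)]])
    also have "\<dots> \<le> kernel_sup \<sigma> TYPE('a) * (2 powr (real DIM('a) / (2 * \<sigma>)) * t powr (- (real DIM('a) / (2 * \<sigma>)))) * (B * (1 + \<tau>) powr (- \<kappa>))"
      by (intro mult_mono mult_left_mono p source_L1 assms S0 mult_nonneg_nonneg B) auto
    also have "\<dots> = 2 powr (real DIM('a) / (2 * \<sigma>)) * B * kernel_sup \<sigma> TYPE('a) * (1 + \<tau>) powr (- \<kappa>) * t powr (- (real DIM('a) / (2 * \<sigma>)))" by (simp only: mult_ac)
    also have "\<dots> \<le> 2 powr (real DIM('a) / (2 * \<sigma>)) * B * (kernel_sup \<sigma> TYPE('a) + kernel_L1 \<sigma> TYPE('a)) * (1 + \<tau>) powr (- \<kappa>) * t powr (- (real DIM('a) / (2 * \<sigma>)))"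
      using B L0 by (intro mult_right_mono mult_left_mono) auto
    finally show ?thesis .
  next
    case False
    have "(1 + \<tau>) powr (- (real DIM('a) / (2 * \<sigma>))) \<le> (t / 2) powr (- (real DIM('a) / (2 * \<sigma>)))" using False t Dpos by (intro powr_mono2') auto
    also have "\<dots> = 2 powr (real DIM('a) / (2 * \<sigma>)) * t powr (- (real DIM('a) / (2 * \<sigma>)))"
      using powr_minus_divide[of 2 "(real DIM('a) / (2 * \<sigma>))"] t by (simp add: powr_divide)
    finally have p: "(1 + \<tau>) powr (- (real DIM('a) / (2 * \<sigma>))) \<le> 2 powr (real DIM('a) / (2 * \<sigma>)) * t powr (- (real DIM('a) / (2 * \<sigma>)))" .
    have "\<bar>heat_op \<sigma> (t - \<tau>) (N \<tau>) x\<bar> \<le> kernel_L1 \<sigma> TYPE('a) * (B * ((1 + \<tau>) powr (- \<kappa>) * (2 powr (real DIM('a) / (2 * \<sigma>)) * t powr (- (real DIM('a) / (2 * \<sigma>))))))"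
      by (rule order_trans[OF Linf']) (intro mult_left_mono p L0 B powr_ge_zero)
    also have "\<dots> = 2 powr (real DIM('a) / (2 * \<sigma>)) * B * kernel_L1 \<sigma> TYPE('a) * (1 + \<tau>) powr (- \<kappa>) * t powr (- (real DIM('a) / (2 * \<sigma>)))" by (simp only: mult_ac)
    also have "\<dots> \<le> 2 powr (real DIM('a) / (2 * \<sigma>)) * B * (kernel_sup \<sigma> TYPE('a) + kernel_L1 \<sigma> TYPE('a)) * (1 + \<tau>) powr (- \<kappa>) * t powr (- (real DIM('a) / (2 * \<sigma>)))"
      using B S0 by (intro mult_right_mono mult_left_mono) auto
    finally show ?thesis .
  qed
  have "l1norm (heat_op \<sigma> (t - \<tau>) (N \<tau>)) \<le> ennreal (kernel_L1 \<sigma> TYPE('a)) * l1norm (N \<tau>)"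
    by (rule heat_op_L1_bound[OF \<sigma> st meas[OF assms(1)]])
  also have "\<dots> \<le> ennreal (kernel_L1 \<sigma> TYPE('a)) * ennreal (B * (1 + \<tau>) powr (- \<kappa>))"
    by (rule mult_left_mono[OF L1[OF assms(1)]]) simp
  also have "\<dots> = ennreal (kernel_L1 \<sigma> TYPE('a) * B * (1 + \<tau>) powr (- \<kappa>))"
    using L0 B by (subst ennreal_mult[symmetric]) (auto simp: mult.assoc)
  finally show "l1norm (heat_op \<sigma> (t - \<tau>) (N \<tau>)) \<le> ennreal (kernel_L1 \<sigma> TYPE('a) * B * (1 + \<tau>) powr (- \<kappa>))" .
qed

lemma integrable_time_weight: "integrable lborel (\<lambda>\<tau>::real. indicator {0..} \<tau> * (1 + \<tau>) powr (- \<kappa>))"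
proof -
  have "(\<lambda>x. x powr (- \<kappa>)) integrable_on {1..}"
    using has_integral_powr_to_inf[of "- \<kappa>" 1] \<kappa> by (auto simp: integrable_on_def)
  then have "set_integrable lebesgue {1..} (\<lambda>x. x powr (- \<kappa>))"
    by (intro nonnegative_absolutely_integrable_1) auto
  then have "integrable lborel (\<lambda>x. indicat_real {1..} x *\<^sub>R x powr (- \<kappa>))"
    unfolding set_integrable_def by (subst (asm) integrable_completion) auto
  from integrable_lborel_translation[OF this, of 1]
  have "integrable lborel (\<lambda>x. indicat_real {1..} (x + 1) *\<^sub>R (x + 1) powr (- \<kappa>))" .
  also have "(\<lambda>x. indicat_real {1..} (x + 1) *\<^sub>R (x + 1) powr (- \<kappa>)) = (\<lambda>\<tau>. indicator {0..} \<tau> * (1 + \<tau>) powr (- \<kappa>))"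
    by (auto simp: fun_eq_iff indicator_def add.commute)
  finally show ?thesis .
qed

end

text \<open>
  Uniform smallness in \<open>x\<close> follows from smallness along every choice \<open>x = X(t)\<close>. Dominated convergence
  can thus be applied to ordinary integrands, with no supremum over \<open>x\<close> under the integral sign.
\<close>

lemma eventually_all_if_choices_tendsto_0:
  fixes g :: "real \<Rightarrow> 'b \<Rightarrow> real"
  assumes "\<And>X. ((\<lambda>t. g t (X t)) \<longlongrightarrow> 0) at_top" and e: "e > 0"
  shows "\<forall>\<^sub>F t in at_top. \<forall>x. \<bar>g t x\<bar> < e"
proof -
  define X where "X t = (SOME x. \<not> \<bar>g t x\<bar> < e)" for t
  have "\<forall>\<^sub>F t in at_top. \<bar>g t (X t)\<bar> < e"
    using tendstoD[OF assms(1)[of X] e] by (simp add: dist_real_def)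
  then show ?thesis
  proof eventually_elim
    case (elim t)
    show ?case
    proof (rule ccontr)
      assume "\<not> (\<forall>x. \<bar>g t x\<bar> < e)"
      then have "\<exists>x. \<not> \<bar>g t x\<bar> < e" by blast
      from someI_ex[OF this] elim show False unfolding X_def by blast
    qed
  qed
qed

locale duhamel_source = decaying_source \<sigma> \<kappa> B N
  for \<sigma> \<kappa> B :: real and N :: "real \<Rightarrow> 'a::euclidean_space \<Rightarrow> real" +
  fixes a :: "real \<Rightarrow> real" and \<alpha> A :: real
  assumes a_cont: "continuous_on {0..} a"
    and a_bound: "\<And>t. t \<ge> 0 \<Longrightarrow> \<bar>a t\<bar> \<le> A"
    and a_lim: "(a \<longlongrightarrow> \<alpha>) at_top"
begin

text \<open>
  The half-open interval leaves out \<open>\<tau> = t\<close>, where \<open>heat_op\<close> is the identity and continuity may fail.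
\<close>

definition retarded :: "real \<Rightarrow> real \<Rightarrow> 'a \<Rightarrow> real" where
  "retarded t \<tau> x = indicator {0..<t} \<tau> * (a (t - \<tau>) * heat_op \<sigma> (t - \<tau>) (N \<tau>) x)"

definition mass :: "real \<Rightarrow> real" where
  "mass \<tau> = indicator {0..} \<tau> * (\<integral>x. N \<tau> x \<partial>lborel)"

lemma A_nonneg: "A \<ge> 0" using a_bound[of 0] by linarith

lemma retarded_measurable: "(\<lambda>(\<tau>, x). retarded t \<tau> x) \<in> borel_measurable (borel \<Otimes>\<^sub>M borel)"
proof -
  have c: "continuous_on ({0..<t} \<times> UNIV) (\<lambda>p. a (t - fst p) * heat_op \<sigma> (t - fst p) (N (fst p)) (snd p :: 'a))"
    by (intro continuous_on_mult continuous_heat_op_source continuous_on_compose2[OF a_cont] continuous_intros) auto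
  have "{0..<t} \<times> (UNIV :: 'a set) \<in> sets borel" by (intro borel_Times) auto
  from borel_measurable_continuous_on_indicator[OF this c]
  have "(\<lambda>p. indicator ({0..<t} \<times> UNIV) p *\<^sub>R (a (t - fst p) * heat_op \<sigma> (t - fst p) (N (fst p)) (snd p :: 'a)))
      \<in> borel_measurable (borel \<Otimes>\<^sub>M borel)" by (simp add: borel_prod)
  also have "(\<lambda>p. indicator ({0..<t} \<times> UNIV) p *\<^sub>R (a (t - fst p) * heat_op \<sigma> (t - fst p) (N (fst p)) (snd p :: 'a)))
      = (\<lambda>(\<tau>, x). retarded t \<tau> x)"
    by (auto simp: fun_eq_iff retarded_def indicator_def)
  finally show ?thesis .
qed

lemma retarded_measurable_time [measurable]: "(\<lambda>\<tau>. retarded t \<tau> x) \<in> borel_measurable borel"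
  using measurable_compose[OF _ retarded_measurable, of "\<lambda>\<tau>. (\<tau>, x)" borel] by simp

lemma mass_measurable [measurable]: "mass \<in> borel_measurable borel"
  using borel_measurable_continuous_on_indicator[OF _ continuous_source_mass] by (simp add: mass_def[abs_def])

lemma mass_bound: "\<bar>mass \<tau>\<bar> \<le> B * (indicator {0..} \<tau> * (1 + \<tau>) powr (- \<kappa>))"
  using source_mass_bound[of \<tau>] by (auto simp: mass_def indicator_def)

lemma integrable_mass: "integrable lborel mass"
proof (rule Bochner_Integration.integrable_bound)
  show "integrable lborel (\<lambda>\<tau>. B * (indicator {0..} \<tau> * (1 + \<tau>) powr (- \<kappa>)))"
    by (rule integrable_mult_right[OF integrable_time_weight])
  show "AE \<tau> in lborel. norm (mass \<tau>) \<le> norm (B * (indicator {0..} \<tau> * (1 + \<tau>) powr (- \<kappa>)))"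
    unfolding real_norm_def by (intro AE_I2 order_trans[OF mass_bound abs_ge_self])
qed measurable

lemma integrable_retarded: "integrable lborel (\<lambda>\<tau>. retarded t \<tau> x)"
proof (rule Bochner_Integration.integrable_bound)
  show "integrable lborel (\<lambda>\<tau>. indicat_real {0..<t} \<tau> * (A * (kernel_L1 \<sigma> TYPE('a) * B)))"
  proof (intro integrable_mult_left integrable_real_indicator)
    have "bounded {0..<t}" by (rule bounded_subset[OF bounded_closed_interval[of 0 t]]) auto
    then show "emeasure lborel {0..<t} < \<infinity>" by (rule emeasure_bounded_finite)
  qed simp
  have "\<bar>retarded t \<tau> x\<bar> \<le> indicat_real {0..<t} \<tau> * (A * (kernel_L1 \<sigma> TYPE('a) * B))" for \<tau>
  proof (cases "\<tau> \<in> {0..<t}")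
    case True
    then have "\<bar>a (t - \<tau>)\<bar> * \<bar>heat_op \<sigma> (t - \<tau>) (N \<tau>) x\<bar> \<le> A * (kernel_L1 \<sigma> TYPE('a) * B)"
      by (intro mult_mono a_bound heat_op_source_bound A_nonneg) auto
    then show ?thesis using True by (simp add: retarded_def abs_mult)
  qed (simp add: retarded_def)
  then show "AE \<tau> in lborel. norm (retarded t \<tau> x) \<le> norm (indicat_real {0..<t} \<tau> * (A * (kernel_L1 \<sigma> TYPE('a) * B)))"
    unfolding real_norm_def by (intro AE_I2) (rule order_trans[OF _ abs_ge_self])
qed measurable

lemma retarded_sup_bound:
  assumes t: "t > 0"
  shows "\<bar>retarded t \<tau> x - \<alpha> * heat_kernel \<sigma> t x * mass \<tau>\<bar>
    \<le> (A * (2 powr (real DIM('a) / (2 * \<sigma>)) * B * (kernel_sup \<sigma> TYPE('a) + kernel_L1 \<sigma> TYPE('a))) + \<bar>\<alpha>\<bar> * kernel_sup \<sigma> TYPE('a) * B) * (indicator {0..} \<tau> * (1 + \<tau>) powr (- \<kappa>)) * t powr (- (real DIM('a) / (2 * \<sigma>)))"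
proof -
  let ?w = "indicat_real {0..} \<tau> * (1 + \<tau>) powr (- \<kappa>)"
  have S0: "kernel_sup \<sigma> TYPE('a) \<ge> 0" and L0: "kernel_L1 \<sigma> TYPE('a) \<ge> 0" by (rule kernel_sup_nonneg, rule kernel_L1_nonneg)
  have 1: "\<bar>retarded t \<tau> x\<bar> \<le> A * (2 powr (real DIM('a) / (2 * \<sigma>)) * B * (kernel_sup \<sigma> TYPE('a) + kernel_L1 \<sigma> TYPE('a)) * ?w * t powr (- (real DIM('a) / (2 * \<sigma>))))"
  proof (cases "\<tau> \<in> {0..<t}")
    case True
    then have "\<bar>a (t - \<tau>)\<bar> * \<bar>heat_op \<sigma> (t - \<tau>) (N \<tau>) x\<bar>
        \<le> A * (2 powr (real DIM('a) / (2 * \<sigma>)) * B * (kernel_sup \<sigma> TYPE('a) + kernel_L1 \<sigma> TYPE('a)) * (1 + \<tau>) powr (- \<kappa>) * t powr (- (real DIM('a) / (2 * \<sigma>))))"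
      by (intro mult_mono a_bound heat_op_source_bound(2) A_nonneg) auto
    then show ?thesis using True by (simp add: retarded_def abs_mult)
  next
    case False
    then show ?thesis using A_nonneg B S0 L0 by (simp add: retarded_def)
  qed
  have "\<bar>heat_kernel \<sigma> t x\<bar> * \<bar>mass \<tau>\<bar> \<le> (kernel_sup \<sigma> TYPE('a) * t powr (- (real DIM('a) / (2 * \<sigma>)))) * (B * ?w)"
    by (intro mult_mono heat_kernel_bounded[OF \<sigma> t] mass_bound mult_nonneg_nonneg S0) auto
  from mult_left_mono[OF this abs_ge_zero[of \<alpha>]]
  have 2: "\<bar>\<alpha> * heat_kernel \<sigma> t x * mass \<tau>\<bar> \<le> \<bar>\<alpha>\<bar> * ((kernel_sup \<sigma> TYPE('a) * t powr (- (real DIM('a) / (2 * \<sigma>)))) * (B * ?w))"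
    by (simp only: abs_mult mult.assoc)
  have "\<bar>retarded t \<tau> x - \<alpha> * heat_kernel \<sigma> t x * mass \<tau>\<bar>
      \<le> A * (2 powr (real DIM('a) / (2 * \<sigma>)) * B * (kernel_sup \<sigma> TYPE('a) + kernel_L1 \<sigma> TYPE('a)) * ?w * t powr (- (real DIM('a) / (2 * \<sigma>)))) + \<bar>\<alpha>\<bar> * ((kernel_sup \<sigma> TYPE('a) * t powr (- (real DIM('a) / (2 * \<sigma>)))) * (B * ?w))"
    using 1 2 by linarith
  also have "\<dots> = (A * (2 powr (real DIM('a) / (2 * \<sigma>)) * B * (kernel_sup \<sigma> TYPE('a) + kernel_L1 \<sigma> TYPE('a))) + \<bar>\<alpha>\<bar> * kernel_sup \<sigma> TYPE('a) * B) * ?w * t powr (- (real DIM('a) / (2 * \<sigma>)))"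
    by (simp only: distrib_right distrib_left mult_ac add_ac)
  finally show ?thesis .
qed

lemma retarded_asymptotics:
  assumes "\<tau> \<ge> 0"
  shows "vanishing_profile \<sigma> (\<lambda>t x. retarded t \<tau> x - \<alpha> * heat_kernel \<sigma> t x * mass \<tau>)"
proof -
  have v: "vanishing_profile \<sigma> (\<lambda>t x. a (t - \<tau>) * heat_op \<sigma> (t - \<tau>) (N \<tau>) x - \<alpha> * heat_kernel \<sigma> t x * (\<integral>y. N \<tau> y \<partial>lborel))"
    by (rule heat_op_asymptotics[OF \<sigma> source_integrable[OF assms] a_lim assms])
  have eq: "(\<lambda>x. retarded t \<tau> x - \<alpha> * heat_kernel \<sigma> t x * mass \<tau>)
      = (\<lambda>x. a (t - \<tau>) * heat_op \<sigma> (t - \<tau>) (N \<tau>) x - \<alpha> * heat_kernel \<sigma> t x * (\<integral>y. N \<tau> y \<partial>lborel))" if "t > \<tau>" for t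
    using that assms by (simp add: retarded_def mass_def)
  show ?thesis
    unfolding vanishing_profile_def
  proof (intro allI impI)
    fix e :: real assume "e > 0"
    from v[unfolded vanishing_profile_def, rule_format, OF this] eventually_gt_at_top[of \<tau>]
    show "\<forall>\<^sub>F t in at_top. (\<lambda>x. retarded t \<tau> x - \<alpha> * heat_kernel \<sigma> t x * mass \<tau>) \<in> borel_measurable borel \<and>
       (\<forall>x. \<bar>retarded t \<tau> x - \<alpha> * heat_kernel \<sigma> t x * mass \<tau>\<bar> \<le> e * t powr (- (real DIM('a) / (2 * \<sigma>)))) \<and>
       l1norm (\<lambda>x. retarded t \<tau> x - \<alpha> * heat_kernel \<sigma> t x * mass \<tau>) \<le> ennreal e"
    proof eventually_elim
      case (elim t)
      show ?case using elim(1) unfolding fun_cong[OF eq[OF elim(2)]] by simp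
    qed
  qed
qed

lemma retarded_L1_bound:
  assumes t: "t > 0"
  shows "l1norm (\<lambda>x. retarded t \<tau> x - \<alpha> * heat_kernel \<sigma> t x * mass \<tau>)
    \<le> ennreal ((A * kernel_L1 \<sigma> TYPE('a) * B + \<bar>\<alpha>\<bar> * kernel_L1 \<sigma> TYPE('a) * B) * (indicator {0..} \<tau> * (1 + \<tau>) powr (- \<kappa>)))"
proof -
  let ?w = "indicat_real {0..} \<tau> * (1 + \<tau>) powr (- \<kappa>)"
  have L0: "kernel_L1 \<sigma> TYPE('a) \<ge> 0" by (rule kernel_L1_nonneg)
  note [measurable] = heat_kernel_measurable[OF \<sigma> t, where 'a = 'a]
  have [measurable]: "(\<lambda>x. retarded t \<tau> x) \<in> borel_measurable borel"
    using measurable_compose[OF _ retarded_measurable, of "\<lambda>x. (\<tau>, x)" borel] by simp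
  have 1: "l1norm (retarded t \<tau>) \<le> ennreal (A * (kernel_L1 \<sigma> TYPE('a) * B * ?w))"
  proof (cases "\<tau> \<in> {0..<t}")
    case True
    then have st: "0 \<le> \<tau>" "\<tau> < t" by auto
    note [measurable] = heat_op_measurable[OF \<sigma> _ meas[OF st(1)], of "t - \<tau>"]
    have "l1norm (retarded t \<tau>) = ennreal \<bar>a (t - \<tau>)\<bar> * l1norm (heat_op \<sigma> (t - \<tau>) (N \<tau>))"
      using True st by (subst nn_integral_cmult[symmetric]) (auto simp: retarded_def abs_mult ennreal_mult)
    also have "\<dots> \<le> ennreal A * ennreal (kernel_L1 \<sigma> TYPE('a) * B * (1 + \<tau>) powr (- \<kappa>))"
      using st by (intro mult_mono ennreal_leI a_bound heat_op_source_bound(3)) auto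
    also have "\<dots> = ennreal (A * (kernel_L1 \<sigma> TYPE('a) * B * ?w))" using A_nonneg st L0 B by (subst ennreal_mult[symmetric]) auto
    finally show ?thesis .
  next
    case False then show ?thesis by (simp add: retarded_def)
  qed
  have 2: "l1norm (\<lambda>x. \<alpha> * heat_kernel \<sigma> t (x::'a) * mass \<tau>) \<le> ennreal (\<bar>\<alpha>\<bar> * (kernel_L1 \<sigma> TYPE('a) * (B * ?w)))"
  proof -
    have "l1norm (\<lambda>x. \<alpha> * heat_kernel \<sigma> t (x::'a) * mass \<tau>)
        = ennreal (\<bar>\<alpha>\<bar> * \<bar>mass \<tau>\<bar>) * l1norm (\<lambda>x. heat_kernel \<sigma> t (x::'a))"
      by (subst nn_integral_cmult[symmetric]) (auto simp: abs_mult ennreal_mult[symmetric] mult_ac)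
    also have "\<dots> = ennreal (\<bar>\<alpha>\<bar> * (kernel_L1 \<sigma> TYPE('a) * \<bar>mass \<tau>\<bar>))"
      unfolding heat_kernel_L1_norm[OF \<sigma> t] using L0 by (simp add: ennreal_mult[symmetric] mult_ac)
    also have "\<dots> \<le> ennreal (\<bar>\<alpha>\<bar> * (kernel_L1 \<sigma> TYPE('a) * (B * ?w)))"
      by (intro ennreal_leI mult_left_mono mass_bound L0 abs_ge_zero)
    finally show ?thesis .
  qed
  have 3: "l1norm (\<lambda>x. retarded t \<tau> x - \<alpha> * heat_kernel \<sigma> t x * mass \<tau>)
      \<le> l1norm (retarded t \<tau>) + l1norm (\<lambda>x. \<alpha> * heat_kernel \<sigma> t (x::'a) * mass \<tau>)"
    by (subst nn_integral_add[symmetric])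
       (auto intro!: nn_integral_mono simp flip: ennreal_plus simp: abs_triangle_ineq4)
  have "l1norm (\<lambda>x. retarded t \<tau> x - \<alpha> * heat_kernel \<sigma> t x * mass \<tau>)
      \<le> ennreal (A * (kernel_L1 \<sigma> TYPE('a) * B * ?w)) + ennreal (\<bar>\<alpha>\<bar> * (kernel_L1 \<sigma> TYPE('a) * (B * ?w)))"
    by (rule order_trans[OF 3 add_mono[OF 1 2]])
  also have "\<dots> = ennreal (A * (kernel_L1 \<sigma> TYPE('a) * B * ?w) + \<bar>\<alpha>\<bar> * (kernel_L1 \<sigma> TYPE('a) * (B * ?w)))"
    using A_nonneg L0 B by (intro ennreal_plus[symmetric]) auto
  also have "A * (kernel_L1 \<sigma> TYPE('a) * B * ?w) + \<bar>\<alpha>\<bar> * (kernel_L1 \<sigma> TYPE('a) * (B * ?w)) = (A * kernel_L1 \<sigma> TYPE('a) * B + \<bar>\<alpha>\<bar> * kernel_L1 \<sigma> TYPE('a) * B) * ?w"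
    by (simp only: distrib_right distrib_left mult_ac add_ac)
  finally show ?thesis .
qed

text \<open>
  Both terms are integrals over \<open>\<tau> \<in> [0, \<infinity>)\<close>. For each fixed \<open>\<tau>\<close> the difference of the integrands
  vanishes by the asymptotics of a single flow. Its \<open>L\<^sup>1\<close> norm in \<open>x\<close>, and \<open>t\<^bsup>n/(2\<sigma>)\<^esup>\<close> times its
  supremum, are dominated by multiples of \<open>(1 + \<tau>)\<^bsup>-\<kappa>\<^esup>\<close> uniformly in \<open>t\<close>.
\<close>

lemma duhamel_asymptotics:
  "vanishing_profile \<sigma> (\<lambda>t x. (\<integral>\<tau>. retarded t \<tau> x \<partial>lborel) - \<alpha> * heat_kernel \<sigma> t x * (\<integral>\<tau>. mass \<tau> \<partial>lborel))"
proof -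
  define F where "F t \<tau> x = retarded t \<tau> x - \<alpha> * heat_kernel \<sigma> t x * mass \<tau>" for t \<tau> x
  define E where "E t x = (\<integral>\<tau>. F t \<tau> x \<partial>lborel)" for t x
  have E: "(\<integral>\<tau>. retarded t \<tau> x \<partial>lborel) - \<alpha> * heat_kernel \<sigma> t x * (\<integral>\<tau>. mass \<tau> \<partial>lborel) = E t x" for t x
    unfolding E_def F_def
    by (subst Bochner_Integration.integral_diff[OF integrable_retarded integrable_mult_right[OF integrable_mass]]) simp
  have Fm: "(\<lambda>(\<tau>, x). F t \<tau> x) \<in> borel_measurable (borel \<Otimes>\<^sub>M borel)" if t: "t > 0" for t
  proof -
    note [measurable] = retarded_measurable heat_kernel_measurable[OF \<sigma> t, where 'a = 'a]
    show ?thesis unfolding F_def by measurable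
  qed
  have Ftm [measurable]: "(\<lambda>\<tau>. F t \<tau> x) \<in> borel_measurable borel" for t x
    unfolding F_def by measurable
  define C1 where "C1 = A * (2 powr (real DIM('a) / (2 * \<sigma>)) * B * (kernel_sup \<sigma> TYPE('a) + kernel_L1 \<sigma> TYPE('a))) + \<bar>\<alpha>\<bar> * kernel_sup \<sigma> TYPE('a) * B"
  define C2 where "C2 = A * kernel_L1 \<sigma> TYPE('a) * B + \<bar>\<alpha>\<bar> * kernel_L1 \<sigma> TYPE('a) * B"
  define w where "w \<tau> = indicat_real {0..} \<tau> * (1 + \<tau>) powr (- \<kappa>)" for \<tau>
  have w: "integrable lborel w" unfolding w_def by (rule integrable_time_weight)
  have C2w: "C2 * w \<tau> \<ge> 0" for \<tau>
    using A_nonneg B kernel_L1_nonneg[of \<sigma>, where 'a = 'a] by (simp add: C2_def w_def)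
  have zero: "F t \<tau> x = 0" if "\<tau> < 0" for t \<tau> x using that by (simp add: F_def retarded_def mass_def)
  have sup: "((\<lambda>t. t powr (real DIM('a) / (2 * \<sigma>)) * E t (X t)) \<longlongrightarrow> 0) at_top" for X
  proof -
    have "((\<lambda>t. \<integral>\<tau>. t powr (real DIM('a) / (2 * \<sigma>)) * F t \<tau> (X t) \<partial>lborel) \<longlongrightarrow> integral\<^sup>L (lborel :: real measure) (\<lambda>_. 0)) at_top"
    proof (rule integral_dominated_convergence_at_top[where w = "\<lambda>\<tau>. C1 * w \<tau>"])
      show "integrable lborel (\<lambda>\<tau>. C1 * w \<tau>)" by (rule integrable_mult_right[OF w])
      show "(\<lambda>\<tau>. t powr (real DIM('a) / (2 * \<sigma>)) * F t \<tau> (X t)) \<in> borel_measurable lborel" for t by measurable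
      show "AE \<tau> in lborel. ((\<lambda>t. t powr (real DIM('a) / (2 * \<sigma>)) * F t \<tau> (X t)) \<longlongrightarrow> 0) at_top"
      proof (rule AE_I2)
        fix \<tau> :: real
        show "((\<lambda>t. t powr (real DIM('a) / (2 * \<sigma>)) * F t \<tau> (X t)) \<longlongrightarrow> 0) at_top"
        proof (cases "\<tau> \<ge> 0")
          case True
          show ?thesis unfolding F_def by (rule vanishing_profile_sup_tendsto[OF retarded_asymptotics[OF True]])
        qed (simp add: zero)
      qed
      show "\<forall>\<^sub>F t in at_top. AE \<tau> in lborel. norm (t powr (real DIM('a) / (2 * \<sigma>)) * F t \<tau> (X t)) \<le> C1 * w \<tau>"
        using eventually_gt_at_top[of 0]
      proof eventually_elim
        case (elim t)
        have "norm (t powr (real DIM('a) / (2 * \<sigma>)) * F t \<tau> (X t)) \<le> C1 * w \<tau>" for \<tau>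
        proof -
          have "t powr (real DIM('a) / (2 * \<sigma>)) * \<bar>F t \<tau> (X t)\<bar> \<le> t powr (real DIM('a) / (2 * \<sigma>)) * (C1 * w \<tau> * t powr (- (real DIM('a) / (2 * \<sigma>))))"
            unfolding F_def C1_def w_def by (intro mult_left_mono retarded_sup_bound elim) simp
          also have "\<dots> = C1 * w \<tau> * (t powr (real DIM('a) / (2 * \<sigma>)) * t powr (- (real DIM('a) / (2 * \<sigma>))))" by (simp only: mult_ac)
          also have "t powr (real DIM('a) / (2 * \<sigma>)) * t powr (- (real DIM('a) / (2 * \<sigma>))) = 1" using elim by (simp flip: powr_add)
          finally show ?thesis by (simp add: abs_mult)
        qed
        then show ?case by (intro AE_I2)
      qed
    qed simp
    then show ?thesis by (simp add: E_def)
  qed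
  define Z where "Z t \<tau> = enn2real (l1norm (F t \<tau>))" for t \<tau>
  have Zb: "l1norm (F t \<tau>) \<le> ennreal (C2 * w \<tau>)" if "t > 0" for t \<tau>
    unfolding F_def C2_def w_def by (rule retarded_L1_bound[OF that])
  have Ze: "l1norm (F t \<tau>) = ennreal (Z t \<tau>)" if "t > 0" for t \<tau>
    unfolding Z_def using le_less_trans[OF Zb[OF that, of \<tau>] ennreal_less_top] by simp
  have Zle: "Z t \<tau> \<le> C2 * w \<tau>" if "t > 0" for t \<tau>
    unfolding Z_def by (rule enn2real_leI[OF C2w Zb[OF that]])
  have Z0: "Z t \<tau> \<ge> 0" for t \<tau> by (simp add: Z_def)
  have Zm: "Z t \<in> borel_measurable borel" if "t > 0" for t
  proof -
    have [measurable]: "(\<lambda>(\<tau>, x). F t \<tau> x) \<in> borel_measurable (borel \<Otimes>\<^sub>M borel)" by (rule Fm[OF that])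
    show ?thesis unfolding Z_def[abs_def] by measurable
  qed
  define Zt where "Zt t = (if t > 0 then Z t else (\<lambda>_. 0))" for t
  have Zlim: "((\<lambda>t. \<integral>\<tau>. Zt t \<tau> \<partial>lborel) \<longlongrightarrow> 0) at_top"
  proof -
    have "((\<lambda>t. \<integral>\<tau>. Zt t \<tau> \<partial>lborel) \<longlongrightarrow> integral\<^sup>L (lborel :: real measure) (\<lambda>_. 0)) at_top"
    proof (rule integral_dominated_convergence_at_top[where w = "\<lambda>\<tau>. C2 * w \<tau>"])
      show "integrable lborel (\<lambda>\<tau>. C2 * w \<tau>)" by (rule integrable_mult_right[OF w])
      show "Zt t \<in> borel_measurable lborel" for t using Zm[of t] by (simp add: Zt_def)
      show "AE \<tau> in lborel. ((\<lambda>t. Zt t \<tau>) \<longlongrightarrow> 0) at_top"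
      proof (rule AE_I2)
        fix \<tau> :: real
        have "((\<lambda>t. Z t \<tau>) \<longlongrightarrow> 0) at_top"
        proof (cases "\<tau> \<ge> 0")
          case True
          show ?thesis unfolding Z_def F_def by (rule vanishing_profile_L1_tendsto[OF retarded_asymptotics[OF True]])
        qed (simp add: Z_def zero)
        moreover have "\<forall>\<^sub>F t in at_top. Z t \<tau> = Zt t \<tau>"
          using eventually_gt_at_top[of 0] by eventually_elim (simp add: Zt_def)
        ultimately show "((\<lambda>t. Zt t \<tau>) \<longlongrightarrow> 0) at_top" by (rule Lim_transform_eventually)
      qed
      show "\<forall>\<^sub>F t in at_top. AE \<tau> in lborel. norm (Zt t \<tau>) \<le> C2 * w \<tau>"
        using eventually_gt_at_top[of 0]
        by eventually_elim (use Zle Z0 in \<open>auto simp: Zt_def\<close>)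
    qed simp
    then show ?thesis by simp
  qed
  have L1: "l1norm (E t) \<le> ennreal (\<integral>\<tau>. Zt t \<tau> \<partial>lborel)" if t: "t > 0" for t
  proof -
    have "(\<lambda>(x, \<tau>). F t \<tau> x) \<in> borel_measurable (borel \<Otimes>\<^sub>M borel)"
      using measurable_compose[OF measurable_Pair[OF measurable_snd measurable_fst] Fm[OF t]]
      by (simp add: case_prod_beta')
    then have "l1norm (E t) \<le> (\<integral>\<^sup>+ \<tau>. l1norm (F t \<tau>) \<partial>lborel)"
      unfolding E_def by (rule nn_integral_abs_integral_le)
    also have "\<dots> = (\<integral>\<^sup>+ \<tau>. ennreal (Zt t \<tau>) \<partial>lborel)"
      using t by (simp add: Ze Zt_def)
    also have "\<dots> = ennreal (\<integral>\<tau>. Zt t \<tau> \<partial>lborel)"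
    proof (rule nn_integral_eq_integral)
      show "integrable lborel (Zt t)"
      proof (rule Bochner_Integration.integrable_bound[OF integrable_mult_right[OF w]])
        show "AE \<tau> in lborel. norm (Zt t \<tau>) \<le> norm (C2 * w \<tau>)"
          using Zle[OF t] Z0 t by (intro AE_I2) (auto simp: Zt_def intro: order_trans[OF _ abs_ge_self])
      qed (use Zm t in \<open>simp add: Zt_def\<close>)
    qed (use t Z0 in \<open>simp add: Zt_def\<close>)
    finally show ?thesis .
  qed
  have "vanishing_profile \<sigma> E"
    unfolding vanishing_profile_def
  proof (intro allI impI)
    fix e :: real assume e: "e > 0"
    show "\<forall>\<^sub>F t in at_top. E t \<in> borel_measurable borel \<and> (\<forall>x. \<bar>E t x\<bar> \<le> e * t powr (- (real DIM('a) / (2 * \<sigma>)))) \<and>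
       l1norm (E t) \<le> ennreal e"
      using eventually_gt_at_top[of 0] order_tendstoD(2)[OF Zlim e]
        eventually_all_if_choices_tendsto_0[of "\<lambda>t x. t powr (real DIM('a) / (2 * \<sigma>)) * E t x", OF sup e]
    proof eventually_elim
      case (elim t)
      have "(\<lambda>(x, \<tau>). F t \<tau> x) \<in> borel_measurable (borel \<Otimes>\<^sub>M borel)"
        using measurable_compose[OF measurable_Pair[OF measurable_snd measurable_fst] Fm[OF elim(1)]]
        by (simp add: case_prod_beta')
      then have "(\<lambda>x. \<integral>\<tau>. F t \<tau> x \<partial>lborel) \<in> borel_measurable borel"
        by (intro lborel.borel_measurable_lebesgue_integral) (simp cong: measurable_cong_sets)
      then have "E t \<in> borel_measurable borel" by (simp add: E_def[abs_def])
      moreover have "\<bar>E t x\<bar> \<le> e * t powr (- (real DIM('a) / (2 * \<sigma>)))" for x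
      proof -
        have "t powr (real DIM('a) / (2 * \<sigma>)) * \<bar>E t x\<bar> < e" using elim(3)[rule_format, of x] by (simp add: abs_mult)
        moreover have "t powr (real DIM('a) / (2 * \<sigma>)) > 0" using elim(1) by simp
        ultimately have "\<bar>E t x\<bar> \<le> e / t powr (real DIM('a) / (2 * \<sigma>))"
          by (simp only: pos_le_divide_eq mult.commute less_imp_le)
        then show ?thesis by (simp only: powr_minus divide_inverse)
      qed
      moreover have "l1norm (E t) \<le> ennreal e"
        by (rule order_trans[OF L1[OF elim(1)] ennreal_leI]) (use elim(2) in simp)
      ultimately show ?case by blast
    qed
  qed
  then show ?thesis unfolding E .
qed

text \<open>
  At \<open>\<tau> = t\<close> the heat operator is the identity and the integrand may jump; this single point, of measure
  zero, is split off.
\<close>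

lemma duhamel_time_integral:
  shows "set_integrable lebesgue {0..t} (\<lambda>\<tau>. a (t - \<tau>) * heat_op \<sigma> (t - \<tau>) (N \<tau>) x)"
    and "(LINT \<tau>:{0..t}|lebesgue. a (t - \<tau>) * heat_op \<sigma> (t - \<tau>) (N \<tau>) x) = (\<integral>\<tau>. retarded t \<tau> x \<partial>lborel)"
proof -
  let ?f = "\<lambda>\<tau>. a (t - \<tau>) * heat_op \<sigma> (t - \<tau>) (N \<tau>) x"
  let ?g = "\<lambda>\<tau>. retarded t \<tau> x"
  have eq: "(\<lambda>\<tau>. indicat_real {0..t} \<tau> *\<^sub>R ?f \<tau>) = (\<lambda>\<tau>. ?g \<tau> + (if t \<ge> 0 then ?f t else 0) * indicator {t} \<tau>)"
    by (auto simp: fun_eq_iff retarded_def indicator_def)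
  have 1: "integrable lebesgue ?g" using integrable_retarded[of t x] by (subst integrable_completion) auto
  have 2: "integrable lebesgue (\<lambda>\<tau>. (if t \<ge> 0 then ?f t else 0) * indicat_real {t} \<tau>)"
    by (intro integrable_mult_right integrable_real_indicator) auto
  show "set_integrable lebesgue {0..t} ?f"
    unfolding set_integrable_def eq by (rule Bochner_Integration.integrable_add[OF 1 2])
  have "(LINT \<tau>:{0..t}|lebesgue. ?f \<tau>) = (\<integral>\<tau>. ?g \<tau> \<partial>lebesgue) + (\<integral>\<tau>. (if t \<ge> 0 then ?f t else 0) * indicat_real {t} \<tau> \<partial>lebesgue)"
    unfolding set_lebesgue_integral_def eq by (rule Bochner_Integration.integral_add[OF 1 2])
  also have "(\<integral>\<tau>. ?g \<tau> \<partial>lebesgue) = (\<integral>\<tau>. ?g \<tau> \<partial>lborel)" by (subst integral_completion) auto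
  finally show "(LINT \<tau>:{0..t}|lebesgue. ?f \<tau>) = (\<integral>\<tau>. ?g \<tau> \<partial>lborel)" by simp
qed

lemma mass_time_integral:
  shows "set_integrable lebesgue {0..} (\<lambda>\<tau>. \<integral>x. N \<tau> x \<partial>lborel)"
    and "(LINT \<tau>:{0..}|lebesgue. \<integral>x. N \<tau> x \<partial>lborel) = (\<integral>\<tau>. mass \<tau> \<partial>lborel)"
proof -
  have eq: "(\<lambda>\<tau>. indicat_real {0..} \<tau> *\<^sub>R (\<integral>x. N \<tau> x \<partial>lborel)) = mass" by (auto simp: mass_def)
  show "set_integrable lebesgue {0..} (\<lambda>\<tau>. \<integral>x. N \<tau> x \<partial>lborel)"
    unfolding set_integrable_def eq using integrable_mass by (subst integrable_completion) auto
  show "(LINT \<tau>:{0..}|lebesgue. \<integral>x. N \<tau> x \<partial>lborel) = (\<integral>\<tau>. mass \<tau> \<partial>lborel)"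
    unfolding set_lebesgue_integral_def eq by (subst integral_completion) auto
qed

end

section \<open>From the endpoint estimates to all Lebesgue norms\<close>

lemma Lnorm_one: "Lnorm 1 f = (\<integral>\<^sup>+ x. ennreal \<bar>f x\<bar> \<partial>lebesgue)"
  by (simp add: Lnorm_def Let_def less_top)

lemma AE_abs_le_of_Lnorm_infinity:
  assumes "Lnorm \<infinity> f \<le> ennreal c" "c \<ge> 0"
  shows "AE x in lebesgue. \<bar>f x\<bar> \<le> c"
proof -
  have "AE x in lebesgue. ennreal \<bar>f x\<bar> \<le> esssup lebesgue (\<lambda>x. ennreal \<bar>f x\<bar>)" by (rule esssup_AE)
  then show ?thesis
  proof eventually_elim
    case (elim x)
    also have "esssup lebesgue (\<lambda>x. ennreal \<bar>f x\<bar>) \<le> ennreal c" using assms(1) by (simp add: Lnorm_def)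
    finally show ?case using assms(2) by simp
  qed
qed

lemma ennreal_exponent_cases:
  fixes m :: ennreal
  assumes "1 \<le> m"
  obtains "m = \<infinity>" | r where "m = ennreal r" "1 \<le> r" "m \<noteq> \<infinity>" "enn2real m = r" "enn2real (1 / m) = 1 / r"
proof (cases m)
  case (real r)
  then have r: "1 \<le> r" using assms by (metis ennreal_1 ennreal_le_iff)
  have "1 / m = ennreal (1 / r)" using r real divide_ennreal[of 1 r] by simp
  then have "enn2real (1 / m) = 1 / r" using r by simp
  then show ?thesis using that(2)[of r] real r by simp
next
  case top then show ?thesis using that(1) by simp
qed

text \<open>
  \<open>|f|\<^sup>r\<close> is at most the \<open>(r - 1)\<close>-th power of its bound times \<open>|f|\<close>.
\<close>

lemma Lnorm_interpolation:
  assumes f: "f \<in> borel_measurable lebesgue" and S: "S > 0" and Q: "Q > 0"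
    and sup: "AE x in lebesgue. \<bar>f x\<bar> \<le> S * Q"
    and L1: "(\<integral>\<^sup>+ x. ennreal \<bar>f x\<bar> \<partial>lebesgue) \<le> ennreal S"
    and m: "1 \<le> m"
  shows "Lnorm m f \<le> ennreal (S * Q powr (1 - enn2real (1 / m)))"
  using m
proof (cases rule: ennreal_exponent_cases)
  case 1
  have "Lnorm \<infinity> f \<le> ennreal (S * Q)"
    unfolding Lnorm_def using f sup by (auto intro!: esssup_I)
  then show ?thesis using 1 Q by simp
next
  case (2 r)
  define I where "I = (\<integral>\<^sup>+ x. ennreal (\<bar>f x\<bar> powr r) \<partial>lebesgue)"
  have "I \<le> (\<integral>\<^sup>+ x. ennreal ((S * Q) powr (r - 1)) * ennreal \<bar>f x\<bar> \<partial>lebesgue)"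
    unfolding I_def
  proof (rule nn_integral_mono_AE)
    show "AE x in lebesgue. ennreal (\<bar>f x\<bar> powr r) \<le> ennreal ((S * Q) powr (r - 1)) * ennreal \<bar>f x\<bar>"
      using sup
    proof eventually_elim
      case (elim x)
      have "\<bar>f x\<bar> powr r = \<bar>f x\<bar> powr (r - 1) * \<bar>f x\<bar>"
        using powr_add[of "\<bar>f x\<bar>" "r - 1" 1] by simp
      also have "\<dots> \<le> (S * Q) powr (r - 1) * \<bar>f x\<bar>"
        using elim 2 by (intro mult_right_mono powr_mono2) auto
      finally show ?case by (simp add: ennreal_mult[symmetric] ennreal_leI)
    qed
  qed
  also have "\<dots> = ennreal ((S * Q) powr (r - 1)) * (\<integral>\<^sup>+ x. ennreal \<bar>f x\<bar> \<partial>lebesgue)"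
    using f by (intro nn_integral_cmult) auto
  also have "\<dots> \<le> ennreal ((S * Q) powr (r - 1)) * ennreal S" by (rule mult_left_mono[OF L1]) simp
  also have "\<dots> = ennreal ((S * Q) powr (r - 1) * S)" using S by (simp add: ennreal_mult)
  finally have I: "I \<le> ennreal ((S * Q) powr (r - 1) * S)" .
  have fin: "I \<noteq> \<infinity>" using le_less_trans[OF I ennreal_less_top] by simp
  have Ir: "enn2real I \<le> (S * Q) powr (r - 1) * S" by (rule enn2real_leI[OF _ I]) (use S in simp)
  have "enn2real I powr (1 / r) \<le> ((S * Q) powr (r - 1) * S) powr (1 / r)"
    by (rule powr_mono2[OF _ _ Ir]) (use 2 in auto)
  also have "(S * Q) powr (r - 1) * S = S powr r * Q powr (r - 1)"
    using S Q powr_add[of S "r - 1" 1] by (simp add: powr_mult mult_ac)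
  also have "(S powr r * Q powr (r - 1)) powr (1 / r) = S * Q powr (1 - 1 / r)"
    using S Q 2 by (simp add: powr_mult powr_powr diff_divide_distrib)
  finally have "ennreal (enn2real I powr (1 / r)) \<le> ennreal (S * Q powr (1 - enn2real (1 / m)))"
    using 2 by (simp add: ennreal_leI)
  then show ?thesis
    using 2 fin unfolding Lnorm_def Let_def by (simp add: I_def)
qed

lemma vanishing_profile_Lnorm:
  fixes w E :: "real \<Rightarrow> 'a::euclidean_space \<Rightarrow> real"
  assumes E: "vanishing_profile \<sigma> E" and m: "1 \<le> m"
    and w: "\<And>t. t > 0 \<Longrightarrow> w t \<in> borel_measurable lebesgue"
    and eq: "\<And>t. t > 0 \<Longrightarrow> AE x in lebesgue. w t x = E t x"
  shows "((\<lambda>t. ennreal (t powr decay_exponent \<sigma> DIM('a) m) * Lnorm m (w t)) \<longlongrightarrow> 0) at_top"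
proof (rule order_tendstoI)
  fix b :: ennreal assume "0 < b"
  then obtain b' where b': "0 < b'" "b' < b" using dense by blast
  then obtain e where e: "b' = ennreal e" "e > 0"
    by (cases b') (auto simp: top.extremum_strict)
  let ?D = "real DIM('a) / (2 * \<sigma>)"
  show "\<forall>\<^sub>F t in at_top. ennreal (t powr decay_exponent \<sigma> DIM('a) m) * Lnorm m (w t) < b"
    using E[unfolded vanishing_profile_def, rule_format, OF e(2)] eventually_gt_at_top[of 0]
  proof eventually_elim
    case (elim t)
    have "Lnorm m (w t) \<le> ennreal (e * (t powr (- ?D)) powr (1 - enn2real (1 / m)))"
    proof (rule Lnorm_interpolation[OF w[OF elim(2)] e(2) _ _ _ m])
      show "0 < t powr (- ?D)" using elim by simp
      show "AE x in lebesgue. \<bar>w t x\<bar> \<le> e * t powr (- ?D)"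
        using eq[OF elim(2)] by eventually_elim (use elim in auto)
      have "(\<integral>\<^sup>+ x. ennreal \<bar>w t x\<bar> \<partial>lebesgue) = (\<integral>\<^sup>+ x. ennreal \<bar>E t x\<bar> \<partial>lebesgue)"
        by (rule nn_integral_cong_AE) (use eq[OF elim(2)] in auto)
      also have "\<dots> = l1norm (E t)" by (rule nn_integral_completion)
      also have "\<dots> \<le> ennreal e" using elim by simp
      finally show "(\<integral>\<^sup>+ x. ennreal \<bar>w t x\<bar> \<partial>lebesgue) \<le> ennreal e" .
    qed
    also have "(t powr (- ?D)) powr (1 - enn2real (1 / m)) = t powr (- decay_exponent \<sigma> DIM('a) m)"
      by (simp add: powr_powr decay_exponent_def)
    finally have "ennreal (t powr decay_exponent \<sigma> DIM('a) m) * Lnorm m (w t)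
        \<le> ennreal (t powr decay_exponent \<sigma> DIM('a) m) * ennreal (e * t powr (- decay_exponent \<sigma> DIM('a) m))"
      by (rule mult_left_mono) simp
    also have "\<dots> = ennreal (e * (t powr decay_exponent \<sigma> DIM('a) m * t powr (- decay_exponent \<sigma> DIM('a) m)))"
      using e by (subst ennreal_mult[symmetric]) (auto simp: mult_ac)
    also have "t powr decay_exponent \<sigma> DIM('a) m * t powr (- decay_exponent \<sigma> DIM('a) m) = 1"
      using elim by (simp flip: powr_add)
    finally show ?case using b' e by (simp add: le_less_trans)
  qed
qed simp

section \<open>Power nonlinearities\<close>

text \<open>
  The mean value theorem on intervals away from the origin; on \<open>[0, b]\<close> the factor
  \<open>b\<^bsup>p-1\<^esup> \<le> R\<^bsup>p-1\<^esup>\<close> is split off directly.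
\<close>

lemma powr_Lipschitz:
  fixes a b p R :: real
  assumes "0 \<le> a" "0 \<le> b" "a \<le> R" "b \<le> R" "p > 1"
  shows "\<bar>a powr p - b powr p\<bar> \<le> p * R powr (p - 1) * \<bar>a - b\<bar>"
proof -
  have main: "b powr p - a powr p \<le> p * R powr (p - 1) * (b - a)" if ab: "0 \<le> a" "a < b" "b \<le> R" for a b
  proof (cases "a = 0")
    case True
    have "b powr p = b powr (p - 1) * b" using ab powr_add[of b "p - 1" 1] by simp
    also have "\<dots> \<le> (p * R powr (p - 1)) * b"
    proof (rule mult_right_mono)
      have "b powr (p - 1) \<le> R powr (p - 1)" using ab assms by (intro powr_mono2) auto
      also have "\<dots> \<le> p * R powr (p - 1)" using assms mult_right_mono[of 1 p "R powr (p - 1)"] by simp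
      finally show "b powr (p - 1) \<le> p * R powr (p - 1)" .
    qed (use ab in simp)
    finally show ?thesis using True by simp
  next
    case False
    then have a: "a > 0" using ab by simp
    have "\<exists>z>a. z < b \<and> b powr p - a powr p = (b - a) * (p * z powr (p - 1))"
      by (rule MVT2[OF ab(2)]) (use a in \<open>auto intro!: derivative_eq_intros\<close>)
    then obtain z where z: "a < z" "z < b" "b powr p - a powr p = (b - a) * (p * z powr (p - 1))" by blast
    have "p * z powr (p - 1) \<le> p * R powr (p - 1)"
      using z a ab assms by (intro mult_left_mono powr_mono2) auto
    from mult_left_mono[OF this, of "b - a"] show ?thesis using z ab by (simp add: mult.commute)
  qed
  have mono: "a powr p \<le> b powr p" if "0 \<le> a" "a \<le> b" for a b :: real
    using that assms by (intro powr_mono2) auto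
  consider "a < b" | "a = b" | "b < a" by linarith
  then show ?thesis
  proof cases
    case 1 then show ?thesis using main[of a b] mono[of a b] assms by simp
  next
    case 3 then show ?thesis using main[of b a] mono[of b a] assms by simp
  qed simp
qed

lemma power_reading_bound:
  assumes "N \<in> power_readings p"
  shows "\<bar>N s\<bar> \<le> \<bar>s\<bar> powr p"
  using assms powr_add[of "\<bar>s\<bar>" "p - 1" 1] by (auto simp: power_readings_def abs_mult)

lemma power_reading_measurable:
  assumes "N \<in> power_readings p" shows "N \<in> borel_measurable borel"
proof -
  have "(\<lambda>s::real. \<bar>s\<bar> powr p) \<in> borel_measurable borel" "(\<lambda>s::real. \<bar>s\<bar> powr (p - 1) * s) \<in> borel_measurable borel"
    by measurable
  then show ?thesis using assms by (auto simp: power_readings_def)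
qed

lemma power_reading_Lipschitz:
  assumes N: "N \<in> power_readings p" and p: "p > 1" and ab: "\<bar>a\<bar> \<le> R" "\<bar>b\<bar> \<le> R"
  shows "\<bar>N a - N b\<bar> \<le> p * R powr (p - 1) * \<bar>a - b\<bar>"
proof -
  have R: "R \<ge> 0" using ab by linarith
  have k: "p * R powr (p - 1) \<ge> 0" using p by simp
  have L: "\<bar>\<bar>a\<bar> powr p - \<bar>b\<bar> powr p\<bar> \<le> p * R powr (p - 1) * \<bar>\<bar>a\<bar> - \<bar>b\<bar>\<bar>"
    using ab p by (intro powr_Lipschitz) auto
  have pw: "\<bar>s\<bar> powr (p - 1) * s = (if s \<ge> 0 then \<bar>s\<bar> powr p else - (\<bar>s\<bar> powr p))" for s :: real
    using powr_add[of "\<bar>s\<bar>" "p - 1" 1] by auto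
  consider "N = (\<lambda>s. \<bar>s\<bar> powr p)" | "N = (\<lambda>s. \<bar>s\<bar> powr (p - 1) * s)" "a \<ge> 0 \<longleftrightarrow> b \<ge> 0"
    | "N = (\<lambda>s. \<bar>s\<bar> powr (p - 1) * s)" "(a \<ge> 0) \<noteq> (b \<ge> 0)"
    using N by (auto simp: power_readings_def)
  then show ?thesis
  proof cases
    case 1
    have "p * R powr (p - 1) * \<bar>\<bar>a\<bar> - \<bar>b\<bar>\<bar> \<le> p * R powr (p - 1) * \<bar>a - b\<bar>"
      by (intro mult_left_mono k) linarith
    then show ?thesis using L unfolding 1 by linarith
  next
    case 2
    then have "\<bar>N a - N b\<bar> = \<bar>\<bar>a\<bar> powr p - \<bar>b\<bar> powr p\<bar>" by (auto simp: pw)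
    moreover have "\<bar>\<bar>a\<bar> - \<bar>b\<bar>\<bar> = \<bar>a - b\<bar>" using 2 by auto
    ultimately show ?thesis using L by simp
  next
    case 3
    have b: "\<bar>s\<bar> powr p \<le> p * R powr (p - 1) * \<bar>s\<bar>" if "\<bar>s\<bar> \<le> R" for s
      using powr_Lipschitz[of "\<bar>s\<bar>" 0 R p] that p R by simp
    have "N a - N b = \<bar>a\<bar> powr p + \<bar>b\<bar> powr p \<or> N a - N b = - (\<bar>a\<bar> powr p + \<bar>b\<bar> powr p)"
      using 3 by (auto simp: pw)
    then have "\<bar>N a - N b\<bar> = \<bar>a\<bar> powr p + \<bar>b\<bar> powr p"
      using powr_ge_zero[of "\<bar>a\<bar>" p] powr_ge_zero[of "\<bar>b\<bar>" p] by linarith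
    also have "\<dots> \<le> p * R powr (p - 1) * \<bar>a\<bar> + p * R powr (p - 1) * \<bar>b\<bar>"
      by (intro add_mono b ab)
    also have "\<dots> = p * R powr (p - 1) * (\<bar>a\<bar> + \<bar>b\<bar>)" by (simp only: distrib_left)
    also have "\<bar>a\<bar> + \<bar>b\<bar> = \<bar>a - b\<bar>" using 3 by auto
    finally show ?thesis .
  qed
qed

text \<open>
  Write \<open>|w|\<^sup>p = |w|\<^bsup>p-1\<^esup> |w|\<close> and use the decay of \<open>w\<close> in \<open>L\<^sup>\<infinity>\<close> for the first factor and in
  \<open>L\<^sup>1\<close> for the second; \<open>\<kappa> > 1\<close> is the hypothesis on \<open>p\<close>. Continuity in \<open>L\<^sup>1\<close> is inherited from \<open>w\<close>
  because the power is Lipschitz on the bounded range of \<open>w\<close>. A Borel representative is chosen at each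
  time.
\<close>

lemma nonlinearity_is_decaying_source:
  fixes w :: "real \<Rightarrow> 'a::euclidean_space \<Rightarrow> real"
  assumes \<sigma>: "\<sigma> > 0" and p: "p > 1 + 2 * \<sigma> / real DIM('a)" and N: "N \<in> power_readings p"
    and w_cont: "continuous_in_L 1 {0..} w" and decay: "decay_estimate \<sigma> C u0 v0 \<epsilon> w"
    and data: "data_norm u0 v0 < \<infinity>" and \<epsilon>: "\<epsilon> > 0"
  obtains \<kappa> B N' where "decaying_source \<sigma> \<kappa> B N'"
    and "\<And>\<tau>. \<tau> \<ge> 0 \<Longrightarrow> AE x in lebesgue. N (w \<tau> x) = N' \<tau> x"
proof -
  define D where "D = real DIM('a) / (2 * \<sigma>)"
  have D: "D > 0" using \<sigma> by (simp add: D_def)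
  have "0 \<le> 2 * \<sigma> / real DIM('a)" using \<sigma> by simp
  then have p1: "p > 1" using p by linarith
  define \<kappa> where "\<kappa> = D * (p - 1)"
  have "1 < D * (p - 1)"
  proof -
    have "2 * \<sigma> / real DIM('a) < p - 1" using p by linarith
    from mult_strict_left_mono[OF this D] have "D * (2 * \<sigma> / real DIM('a)) < D * (p - 1)" .
    moreover have "D * (2 * \<sigma> / real DIM('a)) = 1" using \<sigma> by (simp add: D_def)
    ultimately show ?thesis by linarith
  qed
  then have \<kappa>: "\<kappa> > 1" by (simp add: \<kappa>_def)
  obtain K where K: "data_norm u0 v0 = ennreal K" "K \<ge> 0"
  proof -
    have "data_norm u0 v0 = ennreal (enn2real (data_norm u0 v0))"
      using data by (intro ennreal_enn2real[symmetric]) simp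
    then show ?thesis by (rule that) simp
  qed
  \<comment> \<open>one bound for \<open>w\<close> at both endpoints \<open>m = 1\<close> and \<open>m = \<infinity>\<close>\<close>
  define R where "R = max (\<bar>C 1\<bar> * \<epsilon> * K) (\<bar>C \<infinity>\<bar> * \<epsilon> * K)"
  have "0 \<le> \<bar>C 1\<bar> * \<epsilon> * K" using \<epsilon> K(2) by simp
  then have R: "R \<ge> 0" unfolding R_def by linarith
  have wm: "w t \<in> borel_measurable lebesgue" if "t \<ge> 0" for t
  proof -
    have "w t \<in> Lspace 1"
      using conjunct1[OF w_cont[unfolded continuous_in_L_def]] that by blast
    then show ?thesis by (simp only: Lspace_def mem_Collect_eq)
  qed
  have w1: "(\<integral>\<^sup>+ x. ennreal \<bar>w t x\<bar> \<partial>lebesgue) \<le> ennreal R" if t: "t \<ge> 0" for t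
  proof -
    have "Lnorm 1 (w t) \<le> ennreal (C 1 * \<epsilon> * (1 + t) powr (- decay_exponent \<sigma> DIM('a) 1)) * data_norm u0 v0"
      by (rule decay[unfolded decay_estimate_def, rule_format, OF order_refl t])
    also have "decay_exponent \<sigma> DIM('a) 1 = 0" by (simp add: decay_exponent_def)
    also have "ennreal (C 1 * \<epsilon> * (1 + t) powr (- 0)) * data_norm u0 v0 \<le> ennreal (\<bar>C 1\<bar> * \<epsilon>) * ennreal K"
      unfolding K(1)
    proof (intro mult_right_mono ennreal_leI)
      have "(1 + t) powr (- 0) = 1" using t by simp
      moreover have "C 1 * \<epsilon> \<le> \<bar>C 1\<bar> * \<epsilon>" using \<epsilon> by (intro mult_right_mono) auto
      ultimately show "C 1 * \<epsilon> * (1 + t) powr (- 0) \<le> \<bar>C 1\<bar> * \<epsilon>" by (simp only: mult_1_right)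
    qed simp
    also have "\<dots> = ennreal (\<bar>C 1\<bar> * \<epsilon> * K)" using \<epsilon> K(2) by (intro ennreal_mult[symmetric]) auto
    also have "\<dots> \<le> ennreal R" by (intro ennreal_leI) (simp add: R_def)
    finally show ?thesis unfolding Lnorm_one .
  qed
  have winf: "AE x in lebesgue. \<bar>w t x\<bar> \<le> R * (1 + t) powr (- D)" if t: "t \<ge> 0" for t
  proof (rule AE_abs_le_of_Lnorm_infinity)
    have "Lnorm \<infinity> (w t) \<le> ennreal (C \<infinity> * \<epsilon> * (1 + t) powr (- decay_exponent \<sigma> DIM('a) \<infinity>)) * data_norm u0 v0"
      by (rule decay[unfolded decay_estimate_def, rule_format, OF _ t]) simp
    also have "decay_exponent \<sigma> DIM('a) \<infinity> = D" by (simp add: decay_exponent_def D_def)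
    also have "ennreal (C \<infinity> * \<epsilon> * (1 + t) powr (- D)) * data_norm u0 v0 \<le> ennreal (\<bar>C \<infinity>\<bar> * \<epsilon> * (1 + t) powr (- D)) * ennreal K"
      unfolding K(1) using \<epsilon> by (intro mult_right_mono ennreal_leI) auto
    also have "\<dots> = ennreal (\<bar>C \<infinity>\<bar> * \<epsilon> * K * (1 + t) powr (- D))"
      using \<epsilon> K(2) by (subst ennreal_mult[symmetric]) (auto simp: mult_ac)
    also have "\<dots> \<le> ennreal (R * (1 + t) powr (- D))"
      by (intro ennreal_leI mult_right_mono) (auto simp: R_def)
    finally show "Lnorm \<infinity> (w t) \<le> ennreal (R * (1 + t) powr (- D))" .
  qed (use R in simp)
  have "\<forall>t\<in>{0..}. \<exists>g. g \<in> borel_measurable lborel \<and> (AE x in lborel. w t x = g x)"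
  proof
    fix t :: real assume "t \<in> {0..}"
    then have "w t \<in> borel_measurable lebesgue" using wm by simp
    from completion_ex_borel_measurable_real[OF this]
    show "\<exists>g. g \<in> borel_measurable lborel \<and> (AE x in lborel. w t x = g x)" by blast
  qed
  from bchoice[OF this] obtain w' where
    w'0: "\<forall>t\<in>{0..}. w' t \<in> borel_measurable lborel \<and> (AE x in lborel. w t x = w' t x)" by blast
  have w': "w' t \<in> borel_measurable lborel" "AE x in lborel. w t x = w' t x" if "t \<ge> 0" for t
    using w'0 that by auto
  have eqc: "AE x in lebesgue. w t x = w' t x" if "t \<ge> 0" for t
    by (rule AE_completion[OF w'(2)[OF that]])
  have w1': "l1norm (w' t) \<le> ennreal R" if t: "t \<ge> 0" for t
  proof -
    have "l1norm (w' t) = (\<integral>\<^sup>+ x. ennreal \<bar>w' t x\<bar> \<partial>lebesgue)"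
      by (rule nn_integral_completion[symmetric])
    also have "\<dots> = (\<integral>\<^sup>+ x. ennreal \<bar>w t x\<bar> \<partial>lebesgue)"
      by (rule nn_integral_cong_AE) (use eqc[OF t] in auto)
    finally show ?thesis using w1[OF t] by simp
  qed
  have winf': "AE x in lborel. \<bar>w' t x\<bar> \<le> R * (1 + t) powr (- D)" if t: "t \<ge> 0" for t
  proof -
    have "AE x in lebesgue. \<bar>w' t x\<bar> \<le> R * (1 + t) powr (- D)"
      using winf[OF t] eqc[OF t] by eventually_elim simp
    then show ?thesis by (rule AE_completion_iff[THEN iffD1])
  qed
  have wR: "AE x in lborel. \<bar>w' t x\<bar> \<le> R" if t: "t \<ge> 0" for t
    using winf'[OF t]
  proof eventually_elim
    case (elim x)
    have "(1 + t) powr (- D) \<le> 1" using t D powr_mono2'[of "- D" 1 "1 + t"] by simp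
    from mult_left_mono[OF this R] elim show ?case by linarith
  qed
  have iw: "integrable lborel (w' t)" if t: "t \<ge> 0" for t
    using w'(1)[OF t] le_less_trans[OF w1'[OF t] ennreal_less_top] by (simp add: integrable_iff_bounded)
  note Nm = power_reading_measurable[OF N]
  define N' where "N' t x = N (w' t x)" for t x
  have N'm: "N' t \<in> borel_measurable borel" if "t \<ge> 0" for t
    unfolding N'_def[abs_def] using measurable_compose[OF w'(1)[OF that] Nm] by simp
  have pw: "s powr p = s powr (p - 1) * s" if "s \<ge> 0" for s :: real
    using powr_add[of s "p - 1" 1] that by simp
  have dec: "((1 + t) powr (- D)) powr (p - 1) = (1 + t) powr (- \<kappa>)" for t
    by (simp add: powr_powr \<kappa>_def)
  have "decaying_source \<sigma> \<kappa> (R powr p) N'"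
  proof
    fix t :: real assume t: "t \<ge> 0"
    show "N' t \<in> borel_measurable borel" by (rule N'm[OF t])
    have q: "(R * (1 + t) powr (- D)) powr (p - 1) = R powr (p - 1) * (1 + t) powr (- \<kappa>)"
      using R t by (simp add: powr_mult dec)
    have "l1norm (N' t) \<le> (\<integral>\<^sup>+ x. ennreal (R powr (p - 1) * (1 + t) powr (- \<kappa>)) * ennreal \<bar>w' t x\<bar> \<partial>lborel)"
    proof (rule nn_integral_mono_AE)
      show "AE x in lborel. ennreal \<bar>N' t x\<bar> \<le> ennreal (R powr (p - 1) * (1 + t) powr (- \<kappa>)) * ennreal \<bar>w' t x\<bar>"
        using winf'[OF t]
      proof eventually_elim
        case (elim x)
        have "\<bar>N' t x\<bar> \<le> \<bar>w' t x\<bar> powr p" unfolding N'_def by (rule power_reading_bound[OF N])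
        also have "\<dots> = \<bar>w' t x\<bar> powr (p - 1) * \<bar>w' t x\<bar>" by (rule pw) simp
        also have "\<dots> \<le> (R * (1 + t) powr (- D)) powr (p - 1) * \<bar>w' t x\<bar>"
          using elim p1 by (intro mult_right_mono powr_mono2) auto
        finally show ?case unfolding q by (simp add: ennreal_mult[symmetric] ennreal_leI)
      qed
    qed
    also have "\<dots> = ennreal (R powr (p - 1) * (1 + t) powr (- \<kappa>)) * l1norm (w' t)"
      using w'(1)[OF t] by (intro nn_integral_cmult) auto
    also have "\<dots> \<le> ennreal (R powr (p - 1) * (1 + t) powr (- \<kappa>)) * ennreal R"
      by (rule mult_left_mono[OF w1'[OF t]]) simp
    also have "\<dots> = ennreal (R powr p * (1 + t) powr (- \<kappa>))"
      using R by (subst ennreal_mult[symmetric]) (auto simp: pw[OF R] mult_ac)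
    finally show "l1norm (N' t) \<le> ennreal (R powr p * (1 + t) powr (- \<kappa>))" .
    show "AE x in lborel. \<bar>N' t x\<bar> \<le> R powr p * ((1 + t) powr (- \<kappa>) * (1 + t) powr (- (real DIM('a) / (2 * \<sigma>))))"
      using winf'[OF t]
    proof eventually_elim
      case (elim x)
      have "\<bar>N' t x\<bar> \<le> \<bar>w' t x\<bar> powr p" unfolding N'_def by (rule power_reading_bound[OF N])
      also have "\<dots> \<le> (R * (1 + t) powr (- D)) powr p" using elim p1 by (intro powr_mono2) auto
      also have "\<dots> = R powr p * ((1 + t) powr (- D)) powr p" using R by (simp add: powr_mult)
      also have "((1 + t) powr (- D)) powr p = (1 + t) powr (- \<kappa>) * (1 + t) powr (- D)"
        by (subst pw) (simp_all add: dec)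
      finally show ?case unfolding D_def .
    qed
    show "((\<lambda>s. \<integral>x. \<bar>N' s x - N' t x\<bar> \<partial>lborel) \<longlongrightarrow> 0) (at t within {0..})"
    proof (rule Lim_null_comparison)
      have "((\<lambda>s. Lnorm 1 (\<lambda>x. w s x - w t x)) \<longlongrightarrow> ennreal 0) (at t within {0..})"
        using conjunct2[OF w_cont[unfolded continuous_in_L_def]] t by (simp only: ennreal_0 atLeast_iff Ball_def)
      from tendsto_mult_right_zero[OF tendsto_enn2real[OF this]]
      show "((\<lambda>s. p * R powr (p - 1) * enn2real (Lnorm 1 (\<lambda>x. w s x - w t x))) \<longlongrightarrow> 0) (at t within {0..})" by simp
      have "norm (\<integral>x. \<bar>N' s x - N' t x\<bar> \<partial>lborel) \<le> p * R powr (p - 1) * enn2real (Lnorm 1 (\<lambda>x. w s x - w t x))"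
        if s: "s \<ge> 0" for s
      proof -
        have wst: "integrable lborel (\<lambda>x. \<bar>w' s x - w' t x\<bar>)"
          by (intro integrable_abs Bochner_Integration.integrable_diff iw s t)
        have "norm (\<integral>x. \<bar>N' s x - N' t x\<bar> \<partial>lborel) = (\<integral>x. \<bar>N' s x - N' t x\<bar> \<partial>lborel)" by simp
        also have "\<dots> \<le> (\<integral>x. p * R powr (p - 1) * \<bar>w' s x - w' t x\<bar> \<partial>lborel)"
        proof (rule integral_mono_AE')
          show "integrable lborel (\<lambda>x. p * R powr (p - 1) * \<bar>w' s x - w' t x\<bar>)" by (rule integrable_mult_right[OF wst])
          show "AE x in lborel. \<bar>N' s x - N' t x\<bar> \<le> p * R powr (p - 1) * \<bar>w' s x - w' t x\<bar>"
            using wR[OF s] wR[OF t]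
          proof eventually_elim
            case (elim x)
            then show ?case unfolding N'_def by (rule power_reading_Lipschitz[OF N p1])
          qed
        qed (use p1 in \<open>auto intro!: mult_nonneg_nonneg\<close>)
        also have "\<dots> = p * R powr (p - 1) * (\<integral>x. \<bar>w' s x - w' t x\<bar> \<partial>lborel)" by (rule integral_mult_right_zero)
        also have "(\<integral>x. \<bar>w' s x - w' t x\<bar> \<partial>lborel) = enn2real (l1norm (\<lambda>x. w' s x - w' t x))"
          using wst by (intro integral_eq_nn_integral) auto
        also have "l1norm (\<lambda>x. w' s x - w' t x) = (\<integral>\<^sup>+ x. ennreal \<bar>w' s x - w' t x\<bar> \<partial>lebesgue)"
          by (rule nn_integral_completion[symmetric])
        also have "\<dots> = (\<integral>\<^sup>+ x. ennreal \<bar>w s x - w t x\<bar> \<partial>lebesgue)"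
        proof (rule nn_integral_cong_AE)
          show "AE x in lebesgue. ennreal \<bar>w' s x - w' t x\<bar> = ennreal \<bar>w s x - w t x\<bar>"
            using eqc[OF s] eqc[OF t] by eventually_elim simp
        qed
        finally show ?thesis unfolding Lnorm_one .
      qed
      then show "\<forall>\<^sub>F s in at t within {0..}. norm (\<integral>x. \<bar>N' s x - N' t x\<bar> \<partial>lborel)
          \<le> p * R powr (p - 1) * enn2real (Lnorm 1 (\<lambda>x. w s x - w t x))"
        by (simp add: eventually_at_filter)
    qed
  qed (use \<sigma> \<kappa> in auto)
  moreover have "AE x in lebesgue. N (w t x) = N' t x" if "t \<ge> 0" for t
    using eqc[OF that] by eventually_elim (simp add: N'_def)
  ultimately show ?thesis by (rule that)
qed

section \<open>The components of a solution\<close>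

lemma heat_op_AE_cong:
  fixes f g :: "'a::euclidean_space \<Rightarrow> real"
  assumes \<sigma>: "\<sigma> > 0" and t: "t > 0" and f: "f \<in> borel_measurable lebesgue" and g: "g \<in> borel_measurable lebesgue"
    and eq: "AE x in lebesgue. f x = g x"
  shows "heat_op \<sigma> t f x = heat_op \<sigma> t g x"
proof -
  have k: "(\<lambda>y. heat_kernel \<sigma> t (x - y)) \<in> borel_measurable lebesgue"
  proof (rule measurable_completion)
    note [measurable] = heat_kernel_measurable[OF \<sigma> t, where 'a = 'a]
    show "(\<lambda>y. heat_kernel \<sigma> t (x - y)) \<in> borel_measurable lborel" by measurable
  qed
  have "(\<integral>y. heat_kernel \<sigma> t (x - y) * f y \<partial>lebesgue) = (\<integral>y. heat_kernel \<sigma> t (x - y) * g y \<partial>lebesgue)"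
  proof (rule integral_cong_AE)
    show "AE y in lebesgue. heat_kernel \<sigma> t (x - y) * f y = heat_kernel \<sigma> t (x - y) * g y"
      using eq by eventually_elim simp
  qed (intro borel_measurable_times k f g)+
  then show ?thesis using t by (simp add: heat_op_def)
qed

lemma Lspace_one_borel_representative:
  fixes f :: "'a::euclidean_space \<Rightarrow> real"
  assumes "f \<in> Lspace 1"
  obtains g where "integrable lborel g" "AE x in lebesgue. f x = g x" "f \<in> borel_measurable lebesgue"
    "g \<in> borel_measurable lebesgue" "(\<integral>x. f x \<partial>lebesgue) = (\<integral>x. g x \<partial>lborel)" "integrable lebesgue f"
proof -
  have f: "f \<in> borel_measurable lebesgue" "(\<integral>\<^sup>+ x. ennreal \<bar>f x\<bar> \<partial>lebesgue) < \<infinity>"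
    using assms by (simp_all only: Lspace_def mem_Collect_eq Lnorm_one)
  obtain g where g: "g \<in> borel_measurable lborel" "AE x in lborel. f x = g x"
    using completion_ex_borel_measurable_real[OF f(1)] by blast
  have ae: "AE x in lebesgue. f x = g x" by (rule AE_completion[OF g(2)])
  have gl: "g \<in> borel_measurable lebesgue" by (rule measurable_completion[OF g(1)])
  have fi: "integrable lebesgue f" using f by (simp add: integrable_iff_bounded)
  have "integrable lebesgue g" using integrable_cong_AE_imp[OF fi gl] ae by (simp add: eq_commute)
  then have gi: "integrable lborel g" using integrable_completion[OF g(1)] by simp
  have "(\<integral>x. f x \<partial>lebesgue) = (\<integral>x. g x \<partial>lebesgue)" by (rule integral_cong_AE[OF f(1) gl ae])
  also have "\<dots> = (\<integral>x. g x \<partial>lborel)" by (rule integral_completion[OF g(1)])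
  finally show ?thesis using that gi ae f(1) gl fi by blast
qed

lemma (in decaying_source) representative:
  assumes \<tau>: "\<tau> \<ge> 0" and f: "f \<in> borel_measurable lebesgue" and eq: "AE x in lebesgue. f x = N \<tau> x"
  shows "integrable lebesgue f" and "(\<integral>x. f x \<partial>lebesgue) = (\<integral>x. N \<tau> x \<partial>lborel)"
    and "s > 0 \<Longrightarrow> heat_op \<sigma> s f x = heat_op \<sigma> s (N \<tau>) x"
proof -
  have Nm: "N \<tau> \<in> borel_measurable lborel" using meas[OF \<tau>] by simp
  have Nl: "N \<tau> \<in> borel_measurable lebesgue" by (rule measurable_completion[OF Nm])
  show "heat_op \<sigma> s f x = heat_op \<sigma> s (N \<tau>) x" if "s > 0" by (rule heat_op_AE_cong[OF \<sigma> that f Nl eq])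
  have "(\<integral>x. f x \<partial>lebesgue) = (\<integral>x. N \<tau> x \<partial>lebesgue)" by (rule integral_cong_AE[OF f Nl eq])
  also have "\<dots> = (\<integral>x. N \<tau> x \<partial>lborel)" by (rule integral_completion[OF Nm])
  finally show "(\<integral>x. f x \<partial>lebesgue) = (\<integral>x. N \<tau> x \<partial>lborel)" .
  have "integrable lebesgue (N \<tau>)" using source_integrable[OF \<tau>] integrable_completion[OF Nm] by simp
  then show "integrable lebesgue f" by (rule integrable_cong_AE_imp[OF _ f]) (use eq in \<open>simp add: eq_commute\<close>)
qed

text \<open>
  Each component is a sum of two linear flows and two Duhamel integrals whose coefficients have the same
  limit \<open>\<alpha>\<close>; the masses of the four terms add up to \<open>M\<close>.
\<close>

lemma component_asymptotics:
  fixes w :: "real \<Rightarrow> 'a::euclidean_space \<Rightarrow> real" and f0 f1 :: "'a \<Rightarrow> real"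
  assumes src0: "decaying_source \<sigma> \<kappa>0 B0 N0" and src1: "decaying_source \<sigma> \<kappa>1 B1 N1"
    and f: "integrable lborel f0" "integrable lborel f1"
    and a0: "continuous_on {0..} a0" "\<And>t. t \<ge> 0 \<Longrightarrow> \<bar>a0 t\<bar> \<le> A" "(a0 \<longlongrightarrow> \<alpha>) at_top"
    and a1: "continuous_on {0..} a1" "\<And>t. t \<ge> 0 \<Longrightarrow> \<bar>a1 t\<bar> \<le> A" "(a1 \<longlongrightarrow> \<alpha>) at_top"
    and eq: "\<And>t. t > 0 \<Longrightarrow> AE x in lebesgue. w t x =
        \<epsilon> * (a0 t * heat_op \<sigma> t f0 x) + \<epsilon> * (a1 t * heat_op \<sigma> t f1 x)
        + (LINT \<tau>:{0..t}|lebesgue. a0 (t - \<tau>) * heat_op \<sigma> (t - \<tau>) (N0 \<tau>) x + a1 (t - \<tau>) * heat_op \<sigma> (t - \<tau>) (N1 \<tau>) x)"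
    and M: "M = \<epsilon> * ((\<integral>x. f0 x \<partial>lborel) + (\<integral>x. f1 x \<partial>lborel))
        + (LINT \<tau>:{0..}|lebesgue. (\<integral>x. N0 \<tau> x \<partial>lborel) + (\<integral>x. N1 \<tau> x \<partial>lborel))"
  obtains E where "vanishing_profile \<sigma> E"
    and "\<And>t. t > 0 \<Longrightarrow> AE x in lebesgue. w t x - \<alpha> * heat_kernel \<sigma> t x * M = E t x"
proof -
  interpret d0: duhamel_source \<sigma> \<kappa>0 B0 N0 a0 \<alpha> A
    by (intro duhamel_source.intro duhamel_source_axioms.intro src0 a0)
  interpret d1: duhamel_source \<sigma> \<kappa>1 B1 N1 a1 \<alpha> A
    by (intro duhamel_source.intro duhamel_source_axioms.intro src1 a1)
  define L0 where "L0 t x = a0 (t - 0) * heat_op \<sigma> (t - 0) f0 x - \<alpha> * heat_kernel \<sigma> t x * (\<integral>y. f0 y \<partial>lborel)" for t x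
  define L1 where "L1 t x = a1 (t - 0) * heat_op \<sigma> (t - 0) f1 x - \<alpha> * heat_kernel \<sigma> t x * (\<integral>y. f1 y \<partial>lborel)" for t x
  define D0 where "D0 t x = (\<integral>\<tau>. d0.retarded t \<tau> x \<partial>lborel) - \<alpha> * heat_kernel \<sigma> t x * (\<integral>\<tau>. d0.mass \<tau> \<partial>lborel)" for t x
  define D1 where "D1 t x = (\<integral>\<tau>. d1.retarded t \<tau> x \<partial>lborel) - \<alpha> * heat_kernel \<sigma> t x * (\<integral>\<tau>. d1.mass \<tau> \<partial>lborel)" for t x
  have v: "vanishing_profile \<sigma> L0" "vanishing_profile \<sigma> L1" "vanishing_profile \<sigma> D0" "vanishing_profile \<sigma> D1"
    unfolding L0_def L1_def D0_def D1_def
    by (intro heat_op_asymptotics d0.duhamel_asymptotics d1.duhamel_asymptotics d0.\<sigma> f a0 a1 order_refl)+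
  define E where "E t x = (\<epsilon> * L0 t x + \<epsilon> * L1 t x) + (D0 t x + D1 t x)" for t x
  have "vanishing_profile \<sigma> E"
    unfolding E_def by (intro vanishing_profile_add vanishing_profile_cmult v)
  moreover have "AE x in lebesgue. w t x - \<alpha> * heat_kernel \<sigma> t x * M = E t x" if t: "t > 0" for t
    using eq[OF t]
  proof eventually_elim
    case (elim x)
    have i: "(LINT \<tau>:{0..t}|lebesgue. a0 (t - \<tau>) * heat_op \<sigma> (t - \<tau>) (N0 \<tau>) x + a1 (t - \<tau>) * heat_op \<sigma> (t - \<tau>) (N1 \<tau>) x)
        = (\<integral>\<tau>. d0.retarded t \<tau> x \<partial>lborel) + (\<integral>\<tau>. d1.retarded t \<tau> x \<partial>lborel)"
      by (subst set_integral_add(2)[OF d0.duhamel_time_integral(1) d1.duhamel_time_integral(1)])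
         (simp only: d0.duhamel_time_integral(2) d1.duhamel_time_integral(2))
    have m: "(LINT \<tau>:{0..}|lebesgue. (\<integral>x. N0 \<tau> x \<partial>lborel) + (\<integral>x. N1 \<tau> x \<partial>lborel))
        = (\<integral>\<tau>. d0.mass \<tau> \<partial>lborel) + (\<integral>\<tau>. d1.mass \<tau> \<partial>lborel)"
      by (subst set_integral_add(2)[OF d0.mass_time_integral(1) d1.mass_time_integral(1)])
         (simp only: d0.mass_time_integral(2) d1.mass_time_integral(2))
    show ?case
      unfolding elim i M m E_def L0_def L1_def D0_def D1_def by (simp add: algebra_simps)
  qed
  ultimately show ?thesis by (rule that)
qed

lemma solution_component_asymptotics:
  fixes w u v :: "real \<Rightarrow> 'a::euclidean_space \<Rightarrow> real" and u0 v0 :: "'a \<Rightarrow> real"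
  assumes \<sigma>: "\<sigma> > 0"
    and u0: "u0 \<in> Lspace 1" and v0: "v0 \<in> Lspace 1"
    and Np: "decaying_source \<sigma> \<kappa>0 B0 N0" "\<And>\<tau>. \<tau> \<ge> 0 \<Longrightarrow> AE x in lebesgue. Np (u \<tau> x) = N0 \<tau> x"
      "\<And>\<tau>. \<tau> \<ge> 0 \<Longrightarrow> (\<lambda>x. Np (u \<tau> x)) \<in> borel_measurable lebesgue"
    and Nq: "decaying_source \<sigma> \<kappa>1 B1 N1" "\<And>\<tau>. \<tau> \<ge> 0 \<Longrightarrow> AE x in lebesgue. Nq (v \<tau> x) = N1 \<tau> x"
      "\<And>\<tau>. \<tau> \<ge> 0 \<Longrightarrow> (\<lambda>x. Nq (v \<tau> x)) \<in> borel_measurable lebesgue"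
    and a0: "continuous_on {0..} a0" "\<And>t. t \<ge> 0 \<Longrightarrow> \<bar>a0 t\<bar> \<le> A" "(a0 \<longlongrightarrow> \<alpha>) at_top"
    and a1: "continuous_on {0..} a1" "\<And>t. t \<ge> 0 \<Longrightarrow> \<bar>a1 t\<bar> \<le> A" "(a1 \<longlongrightarrow> \<alpha>) at_top"
    and eq: "\<forall>t\<ge>0. AE x in lebesgue. w t x =
        \<epsilon> * (a0 t * heat_op \<sigma> t u0 x) + \<epsilon> * (a1 t * heat_op \<sigma> t v0 x)
        + (LINT \<tau>:{0..t}|lebesgue. a0 (t - \<tau>) * heat_op \<sigma> (t - \<tau>) (\<lambda>y. Np (u \<tau> y)) x
            + a1 (t - \<tau>) * heat_op \<sigma> (t - \<tau>) (\<lambda>y. Nq (v \<tau> y)) x)"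
  obtains E where "vanishing_profile \<sigma> E"
    and "\<And>t. t > 0 \<Longrightarrow> AE x in lebesgue. w t x - \<alpha> * heat_kernel \<sigma> t x * asymptotic_mass Np Nq u0 v0 \<epsilon> u v = E t x"
proof -
  obtain f0 where f0: "integrable lborel f0" "AE x in lebesgue. u0 x = f0 x" "u0 \<in> borel_measurable lebesgue"
      "f0 \<in> borel_measurable lebesgue" "(\<integral>x. u0 x \<partial>lebesgue) = (\<integral>x. f0 x \<partial>lborel)" "integrable lebesgue u0"
    by (rule Lspace_one_borel_representative[OF u0])
  obtain f1 where f1: "integrable lborel f1" "AE x in lebesgue. v0 x = f1 x" "v0 \<in> borel_measurable lebesgue"
      "f1 \<in> borel_measurable lebesgue" "(\<integral>x. v0 x \<partial>lebesgue) = (\<integral>x. f1 x \<partial>lborel)" "integrable lebesgue v0"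
    by (rule Lspace_one_borel_representative[OF v0])
  have i0: "integrable lebesgue (\<lambda>x. Np (u \<tau> x))" "(\<integral>x. Np (u \<tau> x) \<partial>lebesgue) = (\<integral>x. N0 \<tau> x \<partial>lborel)"
      "s > 0 \<Longrightarrow> heat_op \<sigma> s (\<lambda>y. Np (u \<tau> y)) x = heat_op \<sigma> s (N0 \<tau>) x" if "\<tau> \<ge> 0" for \<tau> s x
    by (rule decaying_source.representative[OF Np(1) that Np(3)[OF that] Np(2)[OF that]])+
  have i1: "integrable lebesgue (\<lambda>x. Nq (v \<tau> x))" "(\<integral>x. Nq (v \<tau> x) \<partial>lebesgue) = (\<integral>x. N1 \<tau> x \<partial>lborel)"
      "s > 0 \<Longrightarrow> heat_op \<sigma> s (\<lambda>y. Nq (v \<tau> y)) x = heat_op \<sigma> s (N1 \<tau>) x" if "\<tau> \<ge> 0" for \<tau> s x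
    by (rule decaying_source.representative[OF Nq(1) that Nq(3)[OF that] Nq(2)[OF that]])+
  show ?thesis
  proof (rule component_asymptotics[OF Np(1) Nq(1) f0(1) f1(1) a0 a1])
    show "AE x in lebesgue. w t x =
        \<epsilon> * (a0 t * heat_op \<sigma> t f0 x) + \<epsilon> * (a1 t * heat_op \<sigma> t f1 x)
        + (LINT \<tau>:{0..t}|lebesgue. a0 (t - \<tau>) * heat_op \<sigma> (t - \<tau>) (N0 \<tau>) x + a1 (t - \<tau>) * heat_op \<sigma> (t - \<tau>) (N1 \<tau>) x)"
      if t: "t > 0" for t
      using eq[rule_format, OF less_imp_le[OF t]] Np(2)[OF less_imp_le[OF t]] Nq(2)[OF less_imp_le[OF t]]
    proof eventually_elim
      case (elim x)
      have "(LINT \<tau>:{0..t}|lebesgue. a0 (t - \<tau>) * heat_op \<sigma> (t - \<tau>) (\<lambda>y. Np (u \<tau> y)) x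
            + a1 (t - \<tau>) * heat_op \<sigma> (t - \<tau>) (\<lambda>y. Nq (v \<tau> y)) x)
          = (LINT \<tau>:{0..t}|lebesgue. a0 (t - \<tau>) * heat_op \<sigma> (t - \<tau>) (N0 \<tau>) x + a1 (t - \<tau>) * heat_op \<sigma> (t - \<tau>) (N1 \<tau>) x)"
      proof (rule set_lebesgue_integral_cong)
        show "\<forall>\<tau>. \<tau> \<in> {0..t} \<longrightarrow> a0 (t - \<tau>) * heat_op \<sigma> (t - \<tau>) (\<lambda>y. Np (u \<tau> y)) x
            + a1 (t - \<tau>) * heat_op \<sigma> (t - \<tau>) (\<lambda>y. Nq (v \<tau> y)) x
          = a0 (t - \<tau>) * heat_op \<sigma> (t - \<tau>) (N0 \<tau>) x + a1 (t - \<tau>) * heat_op \<sigma> (t - \<tau>) (N1 \<tau>) x"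
        proof (intro allI impI)
          fix \<tau> assume \<tau>: "\<tau> \<in> {0..t}"
          show "a0 (t - \<tau>) * heat_op \<sigma> (t - \<tau>) (\<lambda>y. Np (u \<tau> y)) x
            + a1 (t - \<tau>) * heat_op \<sigma> (t - \<tau>) (\<lambda>y. Nq (v \<tau> y)) x
          = a0 (t - \<tau>) * heat_op \<sigma> (t - \<tau>) (N0 \<tau>) x + a1 (t - \<tau>) * heat_op \<sigma> (t - \<tau>) (N1 \<tau>) x"
          proof (cases "\<tau> = t")
            case True
            then show ?thesis using elim(2,3) by (simp add: heat_op_def)
          next
            case False
            then have "0 \<le> \<tau>" "0 < t - \<tau>" using \<tau> by auto
            then show ?thesis by (simp only: i0(3) i1(3))
          qed
        qed
      qed simp
      then show ?case
        using elim(1) heat_op_AE_cong[OF \<sigma> t f0(3,4,2), of x] heat_op_AE_cong[OF \<sigma> t f1(3,4,2), of x] by simp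
    qed
    have "(LINT \<tau>:{0..}|lebesgue. (\<integral>x. Np (u \<tau> x) + Nq (v \<tau> x) \<partial>lebesgue))
        = (LINT \<tau>:{0..}|lebesgue. (\<integral>x. N0 \<tau> x \<partial>lborel) + (\<integral>x. N1 \<tau> x \<partial>lborel))"
    proof (rule set_lebesgue_integral_cong)
      show "\<forall>\<tau>. \<tau> \<in> {0..} \<longrightarrow> (\<integral>x. Np (u \<tau> x) + Nq (v \<tau> x) \<partial>lebesgue) = (\<integral>x. N0 \<tau> x \<partial>lborel) + (\<integral>x. N1 \<tau> x \<partial>lborel)"
      proof (intro allI impI)
        fix \<tau> :: real assume "\<tau> \<in> {0..}"
        then have \<tau>: "\<tau> \<ge> 0" by simp
        show "(\<integral>x. Np (u \<tau> x) + Nq (v \<tau> x) \<partial>lebesgue) = (\<integral>x. N0 \<tau> x \<partial>lborel) + (\<integral>x. N1 \<tau> x \<partial>lborel)"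
          by (subst Bochner_Integration.integral_add[OF i0(1)[OF \<tau>] i1(1)[OF \<tau>]])
             (simp only: i0(2)[OF \<tau>] i1(2)[OF \<tau>])
      qed
    qed simp
    then show "asymptotic_mass Np Nq u0 v0 \<epsilon> u v = \<epsilon> * ((\<integral>x. f0 x \<partial>lborel) + (\<integral>x. f1 x \<partial>lborel))
        + (LINT \<tau>:{0..}|lebesgue. (\<integral>x. N0 \<tau> x \<partial>lborel) + (\<integral>x. N1 \<tau> x \<partial>lborel))"
      unfolding asymptotic_mass_def space_time_integral_def
      by (simp only: Bochner_Integration.integral_add[OF f0(6) f1(6)] f0(5) f1(5))
  qed (assumption, assumption, rule that)
qed

section \<open>The lower bound in the Hilbert space norm\<close>

definition kernel_L2_sq :: "real \<Rightarrow> 'a::euclidean_space itself \<Rightarrow> real" where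
  "kernel_L2_sq \<sigma> _ = (\<integral>x. (heat_kernel \<sigma> 1 (x::'a))\<^sup>2 \<partial>lborel)"

lemma integrable_heat_kernel_sq:
  assumes \<sigma>: "\<sigma> > 0"
  shows "integrable lborel (\<lambda>x::'a::euclidean_space. (heat_kernel \<sigma> 1 x)\<^sup>2)"
proof (rule Bochner_Integration.integrable_bound)
  note [measurable] = heat_kernel_measurable[OF \<sigma> zero_less_one, where 'a = 'a]
  show "(\<lambda>x::'a. (heat_kernel \<sigma> 1 x)\<^sup>2) \<in> borel_measurable lborel" by measurable
  show "integrable lborel (\<lambda>x::'a. kernel_sup \<sigma> TYPE('a) * \<bar>heat_kernel \<sigma> 1 x\<bar>)"
    by (intro integrable_mult_right integrable_abs integrable_heat_kernel_one \<sigma>)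
  show "AE x::'a in lborel. norm ((heat_kernel \<sigma> 1 x)\<^sup>2) \<le> norm (kernel_sup \<sigma> TYPE('a) * \<bar>heat_kernel \<sigma> 1 x\<bar>)"
  proof (rule AE_I2)
    fix x :: 'a
    have "\<bar>heat_kernel \<sigma> 1 x\<bar> \<le> kernel_sup \<sigma> TYPE('a)" using heat_kernel_bounded[OF \<sigma> zero_less_one, of x] by simp
    from mult_right_mono[OF this abs_ge_zero[of "heat_kernel \<sigma> 1 x"]]
    show "norm ((heat_kernel \<sigma> 1 x)\<^sup>2) \<le> norm (kernel_sup \<sigma> TYPE('a) * \<bar>heat_kernel \<sigma> 1 x\<bar>)"
      by (simp add: power2_eq_square abs_mult kernel_sup_nonneg)
  qed
qed

lemma kernel_L2_sq_pos:
  assumes \<sigma>: "\<sigma> > 0"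
  shows "kernel_L2_sq \<sigma> TYPE('a::euclidean_space) > 0"
proof -
  have "kernel_L2_sq \<sigma> TYPE('a) \<noteq> 0"
  proof
    assume "kernel_L2_sq \<sigma> TYPE('a) = 0"
    then have "AE x::'a in lborel. (heat_kernel \<sigma> 1 x)\<^sup>2 = 0"
      using integral_nonneg_eq_0_iff_AE[OF integrable_heat_kernel_sq[OF \<sigma>, where 'a = 'a]]
      by (simp add: kernel_L2_sq_def)
    then have "AE x::'a in lborel. x \<notin> {x. heat_kernel \<sigma> 1 x \<noteq> 0}" by simp
    moreover have op: "open {x::'a. heat_kernel \<sigma> 1 x \<noteq> 0}"
      by (intro open_Collect_neq continuous_heat_kernel_one[OF \<sigma>] continuous_on_const)
    ultimately have "{x::'a. heat_kernel \<sigma> 1 x \<noteq> 0} \<in> null_sets lborel"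
      using AE_iff_null_sets[of "{x::'a. heat_kernel \<sigma> 1 x \<noteq> 0}" lborel] by (simp add: borel_open)
    then have "negligible {x::'a. heat_kernel \<sigma> 1 x \<noteq> 0}"
      by (simp add: negligible_iff_null_sets null_sets_completionI)
    moreover have "(0::'a) \<in> {x. heat_kernel \<sigma> 1 x \<noteq> 0}" using heat_kernel_zero_pos[OF \<sigma>, where 'a = 'a] by simp
    ultimately show False using open_not_negligible[OF op] by blast
  qed
  moreover have "kernel_L2_sq \<sigma> TYPE('a) \<ge> 0" by (simp add: kernel_L2_sq_def)
  ultimately show ?thesis by linarith
qed

lemma heat_kernel_L2_norm:
  assumes \<sigma>: "\<sigma> > 0" and t: "t > 0"
  shows "(\<integral>\<^sup>+ x. ennreal ((heat_kernel \<sigma> t (x::'a::euclidean_space))\<^sup>2) \<partial>lborel)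
    = ennreal (t powr (- (real DIM('a) / (2 * \<sigma>))) * kernel_L2_sq \<sigma> TYPE('a))"
proof -
  note [measurable] = heat_kernel_measurable[OF \<sigma> zero_less_one, where 'a = 'a]
  define c where "c = t powr (- (1 / (2 * \<sigma>)))"
  have c: "c > 0" using t by (simp add: c_def)
  have cn: "c ^ DIM('a) = t powr (- (real DIM('a) / (2 * \<sigma>)))" unfolding c_def by (rule powr_neg_power_dim[OF t])
  have "ennreal (kernel_L2_sq \<sigma> TYPE('a)) = (\<integral>\<^sup>+ x. ennreal ((heat_kernel \<sigma> 1 (x::'a))\<^sup>2) \<partial>lborel)"
    unfolding kernel_L2_sq_def by (rule nn_integral_eq_integral[symmetric, OF integrable_heat_kernel_sq[OF \<sigma>]]) simp
  also have "\<dots> = ennreal (c ^ DIM('a)) * (\<integral>\<^sup>+ x. ennreal ((heat_kernel \<sigma> 1 (c *\<^sub>R (x::'a)))\<^sup>2) \<partial>lborel)"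
    by (rule nn_integral_lborel_scale[OF _ c]) measurable
  finally have k: "ennreal (kernel_L2_sq \<sigma> TYPE('a))
      = ennreal (c ^ DIM('a)) * (\<integral>\<^sup>+ x. ennreal ((heat_kernel \<sigma> 1 (c *\<^sub>R (x::'a)))\<^sup>2) \<partial>lborel)" .
  have "(\<integral>\<^sup>+ x. ennreal ((heat_kernel \<sigma> t (x::'a))\<^sup>2) \<partial>lborel)
      = (\<integral>\<^sup>+ x. ennreal (c ^ DIM('a)) * (ennreal (c ^ DIM('a)) * ennreal ((heat_kernel \<sigma> 1 (c *\<^sub>R (x::'a)))\<^sup>2)) \<partial>lborel)"
  proof (rule nn_integral_cong)
    fix x :: 'a
    have "(heat_kernel \<sigma> t x)\<^sup>2 = c ^ DIM('a) * (c ^ DIM('a) * (heat_kernel \<sigma> 1 (c *\<^sub>R x))\<^sup>2)"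
      unfolding heat_kernel_scaling_one[OF \<sigma> t, of x] cn c_def[symmetric] by (simp only: power2_eq_square mult_ac)
    then show "ennreal ((heat_kernel \<sigma> t x)\<^sup>2)
        = ennreal (c ^ DIM('a)) * (ennreal (c ^ DIM('a)) * ennreal ((heat_kernel \<sigma> 1 (c *\<^sub>R x))\<^sup>2))"
      using c by (simp add: ennreal_mult)
  qed
  also have "\<dots> = ennreal (c ^ DIM('a)) * (ennreal (c ^ DIM('a)) * (\<integral>\<^sup>+ x. ennreal ((heat_kernel \<sigma> 1 (c *\<^sub>R (x::'a)))\<^sup>2) \<partial>lborel))"
    by (subst nn_integral_cmult, measurable)+
  also have "\<dots> = ennreal (c ^ DIM('a)) * ennreal (kernel_L2_sq \<sigma> TYPE('a))" by (simp only: k)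
  also have "\<dots> = ennreal (t powr (- (real DIM('a) / (2 * \<sigma>))) * kernel_L2_sq \<sigma> TYPE('a))"
    using c kernel_L2_sq_pos[OF \<sigma>, where 'a = 'a] unfolding cn[symmetric] by (intro ennreal_mult[symmetric]) auto
  finally show ?thesis .
qed

lemma Lnorm_two_ge:
  assumes "ennreal (b\<^sup>2) \<le> (\<integral>\<^sup>+ x. ennreal ((f x)\<^sup>2) \<partial>lebesgue)" and b: "b \<ge> 0"
  shows "ennreal b \<le> Lnorm 2 f"
proof -
  define I where "I = (\<integral>\<^sup>+ x. ennreal (\<bar>f x\<bar> powr 2) \<partial>lebesgue)"
  have "I = (\<integral>\<^sup>+ x. ennreal ((f x)\<^sup>2) \<partial>lebesgue)" unfolding I_def by simp
  with assms have bI: "ennreal (b\<^sup>2) \<le> I" by simp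
  have L: "Lnorm 2 f = (if I = \<infinity> then \<infinity> else ennreal (enn2real I powr (1 / 2)))"
    by (simp add: Lnorm_def Let_def I_def)
  show ?thesis
  proof (cases "I = \<infinity>")
    case False
    then have "I = ennreal (enn2real I)" by (intro ennreal_enn2real[symmetric]) (simp add: less_top)
    with bI have "ennreal (b\<^sup>2) \<le> ennreal (enn2real I)" by simp
    then have "b\<^sup>2 \<le> enn2real I" by (simp add: ennreal_le_iff)
    then have "(b\<^sup>2) powr (1 / 2) \<le> enn2real I powr (1 / 2)" by (intro powr_mono2) auto
    moreover have "(b\<^sup>2) powr (1 / 2) = b" using b by (simp add: powr_half_sqrt)
    ultimately show ?thesis using False by (simp add: L ennreal_leI)
  qed (simp add: L)
qed

text \<open>
  The profile \<open>\<alpha> M G(t, \<cdot>)\<close> has squared norm \<open>4 e\<^sup>2 t\<^bsup>-n/(2\<sigma>)\<^esup>\<close> for the \<open>e\<close> chosen below, and the error has squared norm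
  at most \<open>e\<^sup>2 t\<^bsup>-n/(2\<sigma>)\<^esup>\<close>. From \<open>(a - b)\<^sup>2 \<le> 2 a\<^sup>2 + 2 b\<^sup>2\<close> the solution keeps at least
  \<open>e\<^sup>2 t\<^bsup>-n/(2\<sigma>)\<^esup>\<close>.
\<close>

lemma L2_lower_bound:
  fixes w E :: "real \<Rightarrow> 'a::euclidean_space \<Rightarrow> real"
  assumes \<sigma>: "\<sigma> > 0" and E: "vanishing_profile \<sigma> E" and \<alpha>: "\<alpha> > 0" and M: "M \<noteq> 0"
    and w: "\<And>t. t > 0 \<Longrightarrow> w t \<in> borel_measurable lebesgue"
    and eq: "\<And>t. t > 0 \<Longrightarrow> AE x in lebesgue. w t x - \<alpha> * heat_kernel \<sigma> t x * M = E t x"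
  shows "\<forall>\<^sub>F t in at_top. ennreal (\<alpha> * (sqrt (kernel_L2_sq \<sigma> TYPE('a)) / 2) * t powr (- real DIM('a) / (4 * \<sigma>)) * \<bar>M\<bar>) \<le> Lnorm 2 (w t)"
proof -
  define k where "k = kernel_L2_sq \<sigma> TYPE('a)"
  have k: "k > 0" unfolding k_def by (rule kernel_L2_sq_pos[OF \<sigma>])
  \<comment> \<open>half of the \<open>L\<^sup>2\<close> norm of the profile \<open>\<alpha> M G(1, \<cdot>)\<close>\<close>
  define e where "e = \<alpha> * (sqrt k / 2) * \<bar>M\<bar>"
  have e: "e > 0" using \<alpha> M k by (simp add: e_def)
  have e2: "e\<^sup>2 = (\<alpha> * M)\<^sup>2 * k / 4" using k by (simp add: e_def power_mult_distrib power_divide)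
  let ?D = "real DIM('a) / (2 * \<sigma>)"
  show ?thesis
    using E[unfolded vanishing_profile_def, rule_format, OF e] eventually_gt_at_top[of 0]
  proof eventually_elim
    case (elim t)
    then have t: "t > 0" and Em: "E t \<in> borel_measurable borel" and Es: "\<And>x. \<bar>E t x\<bar> \<le> e * t powr (- ?D)"
      and E1: "l1norm (E t) \<le> ennreal e" by auto
    note [measurable] = heat_kernel_measurable[OF \<sigma> t, where 'a = 'a] Em w[OF t]
    define T where "T = t powr (- ?D)"
    have T: "T > 0" using t by (simp add: T_def)
    define W where "W = (\<integral>\<^sup>+ x. ennreal ((w t x)\<^sup>2) \<partial>lebesgue)"
    define Y where "Y = (\<integral>\<^sup>+ x. ennreal ((E t x)\<^sup>2) \<partial>lborel)"
    have "Y \<le> (\<integral>\<^sup>+ x. ennreal (e * T) * ennreal \<bar>E t x\<bar> \<partial>lborel)"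
      unfolding Y_def
    proof (rule nn_integral_mono)
      fix x
      have "(E t x)\<^sup>2 = \<bar>E t x\<bar> * \<bar>E t x\<bar>" by (simp add: power2_eq_square)
      also have "\<dots> \<le> (e * T) * \<bar>E t x\<bar>" unfolding T_def by (intro mult_right_mono Es) simp
      finally show "ennreal ((E t x)\<^sup>2) \<le> ennreal (e * T) * ennreal \<bar>E t x\<bar>"
        using e T by (simp add: ennreal_mult[symmetric] ennreal_leI)
    qed
    also have "\<dots> = ennreal (e * T) * l1norm (E t)" by (rule nn_integral_cmult) measurable
    also have "\<dots> \<le> ennreal (e * T) * ennreal e" by (rule mult_left_mono[OF E1]) simp
    also have "\<dots> = ennreal (e\<^sup>2 * T)"
      using e T by (subst ennreal_mult[symmetric]) (auto simp: power2_eq_square mult_ac)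
    finally have Y: "Y \<le> ennreal (e\<^sup>2 * T)" .
    have "ennreal (4 * e\<^sup>2 * T) = ennreal ((\<alpha> * M)\<^sup>2) * ennreal (T * k)"
      using T k by (subst ennreal_mult[symmetric]) (auto simp: e2)
    also have "ennreal (T * k) = (\<integral>\<^sup>+ x. ennreal ((heat_kernel \<sigma> t (x::'a))\<^sup>2) \<partial>lborel)"
      unfolding T_def k_def by (rule heat_kernel_L2_norm[OF \<sigma> t, symmetric])
    also have "ennreal ((\<alpha> * M)\<^sup>2) * \<dots> = (\<integral>\<^sup>+ x. ennreal ((\<alpha> * M)\<^sup>2) * ennreal ((heat_kernel \<sigma> t (x::'a))\<^sup>2) \<partial>lborel)"
      by (rule nn_integral_cmult[symmetric]) measurable
    also have "\<dots> = (\<integral>\<^sup>+ x. ennreal ((\<alpha> * M)\<^sup>2) * ennreal ((heat_kernel \<sigma> t (x::'a))\<^sup>2) \<partial>lebesgue)"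
      by (rule nn_integral_completion[symmetric])
    also have "\<dots> \<le> (\<integral>\<^sup>+ x. 2 * ennreal ((w t x)\<^sup>2) + 2 * ennreal ((E t x)\<^sup>2) \<partial>lebesgue)"
    proof (rule nn_integral_mono_AE)
      show "AE x in lebesgue. ennreal ((\<alpha> * M)\<^sup>2) * ennreal ((heat_kernel \<sigma> t x)\<^sup>2) \<le> 2 * ennreal ((w t x)\<^sup>2) + 2 * ennreal ((E t x)\<^sup>2)"
        using eq[OF t]
      proof eventually_elim
        case (elim x)
        have "\<alpha> * M * heat_kernel \<sigma> t x = w t x - E t x" using elim by (simp add: mult_ac)
        then have "(\<alpha> * M)\<^sup>2 * (heat_kernel \<sigma> t x)\<^sup>2 = (w t x - E t x)\<^sup>2" by (metis power_mult_distrib)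
        also have "\<dots> \<le> 2 * (w t x)\<^sup>2 + 2 * (E t x)\<^sup>2"
          using zero_le_power2[of "w t x + E t x"] by (simp add: power2_sum power2_diff)
        finally have "ennreal ((\<alpha> * M)\<^sup>2 * (heat_kernel \<sigma> t x)\<^sup>2) \<le> ennreal (2 * (w t x)\<^sup>2 + 2 * (E t x)\<^sup>2)" by (rule ennreal_leI)
        then show ?case by (simp add: ennreal_mult)
      qed
    qed
    also have "\<dots> = 2 * W + 2 * (\<integral>\<^sup>+ x. ennreal ((E t x)\<^sup>2) \<partial>lebesgue)"
    proof -
      have "(\<lambda>x. ennreal ((E t x)\<^sup>2)) \<in> borel_measurable lebesgue" by (rule measurable_completion) measurable
      moreover have "(\<lambda>x. ennreal ((w t x)\<^sup>2)) \<in> borel_measurable lebesgue" by measurable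
      ultimately show ?thesis unfolding W_def by (subst nn_integral_add) (auto simp: nn_integral_cmult)
    qed
    also have "(\<integral>\<^sup>+ x. ennreal ((E t x)\<^sup>2) \<partial>lebesgue) = Y" unfolding Y_def by (rule nn_integral_completion)
    finally have X: "ennreal (4 * e\<^sup>2 * T) \<le> 2 * W + 2 * Y" .
    have W: "ennreal (e\<^sup>2 * T) \<le> W"
    proof (cases "W = \<infinity>")
      case False
      then obtain a where a: "W = ennreal a" "a \<ge> 0" by (cases W) auto
      obtain b where b: "Y = ennreal b" "b \<ge> 0" using le_less_trans[OF Y ennreal_less_top] by (cases Y) auto
      have "b \<le> e\<^sup>2 * T" using Y b e T by (simp add: ennreal_le_iff)
      have "2 * W + 2 * Y = ennreal (2 * a + 2 * b)" using a b by (simp add: ennreal_mult)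
      with X have "ennreal (4 * e\<^sup>2 * T) \<le> ennreal (2 * a + 2 * b)" by (simp only:)
      then have "4 * e\<^sup>2 * T \<le> 2 * a + 2 * b"
        by (rule ennreal_le_iff[THEN iffD1, rotated]) (use a b in simp)
      then have "e\<^sup>2 * T \<le> a" using \<open>b \<le> e\<^sup>2 * T\<close> by linarith
      then show ?thesis using a by (simp add: ennreal_leI)
    qed simp
    have "ennreal (e * t powr (- real DIM('a) / (4 * \<sigma>))) \<le> Lnorm 2 (w t)"
    proof (rule Lnorm_two_ge)
      have "(t powr (- real DIM('a) / (4 * \<sigma>)))\<^sup>2 = T"
        using t \<sigma> by (simp add: T_def powr_power)
      then show "ennreal ((e * t powr (- real DIM('a) / (4 * \<sigma>)))\<^sup>2) \<le> (\<integral>\<^sup>+ x. ennreal ((w t x)\<^sup>2) \<partial>lebesgue)"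
        using W unfolding W_def power_mult_distrib by simp
    qed (use e in simp)
    then show ?case unfolding e_def k_def by (simp add: mult_ac)
  qed
qed

lemma propagator_coefficient:
  fixes c d s :: real
  assumes s: "s > 0" and cd: "\<bar>c\<bar> \<le> s" "\<bar>d\<bar> \<le> s"
  shows "continuous_on {0..} (\<lambda>t. (c + d * exp (- s * t)) / s)"
    and "\<And>t. t \<ge> 0 \<Longrightarrow> \<bar>(c + d * exp (- s * t)) / s\<bar> \<le> 2"
    and "((\<lambda>t. (c + d * exp (- s * t)) / s) \<longlongrightarrow> c / s) at_top"
proof -
  show "continuous_on {0..} (\<lambda>t. (c + d * exp (- s * t)) / s)" using s by (intro continuous_intros) auto
  show "\<bar>(c + d * exp (- s * t)) / s\<bar> \<le> 2" if "t \<ge> 0" for t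
  proof -
    have "\<bar>d * exp (- s * t)\<bar> \<le> s * 1" unfolding abs_mult using that s cd by (intro mult_mono) auto
    then have "\<bar>c + d * exp (- s * t)\<bar> \<le> 2 * s" using cd abs_triangle_ineq[of c "d * exp (- s * t)"] by linarith
    then show ?thesis using s by (simp add: abs_divide field_simps)
  qed
  have "((\<lambda>t. exp (- s * t)) \<longlongrightarrow> 0) at_top" using s by real_asymp
  from tendsto_divide[OF tendsto_add[OF tendsto_const tendsto_mult_right_zero[OF this, of d]] tendsto_const, of s c] s
  show "((\<lambda>t. (c + d * exp (- s * t)) / s) \<longlongrightarrow> c / s) at_top" by simp
qed

section \<open>Large time behaviour of small data solutions\<close>

theorem theorem2p2:
  fixes \<sigma> \<mu> \<nu> p q :: real
    and Np Nq :: "real \<Rightarrow> real"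
    and C0 :: "ennreal \<Rightarrow> real"
  assumes "\<sigma> > 0" "\<mu> > 0" "\<nu> > 0" "p > 1" "q > 1"
    and "Np \<in> power_readings p" "Nq \<in> power_readings q"
    and "min p q > 1 + 2 * \<sigma> / real CARD('n::finite)"
    and "\<And>m. 1 \<le> m \<Longrightarrow> C0 m > 0"
  shows "\<exists>c>0. \<exists>C>0. \<forall>(u0 :: real ^ 'n \<Rightarrow> real) v0 \<epsilon>0.
    u0 \<in> Lspace \<infinity> \<inter> Lspace 1 \<longrightarrow>
    v0 \<in> Lspace \<infinity> \<inter> Lspace 1 \<longrightarrow>
    admissible_smallness \<sigma> \<mu> \<nu> Np Nq C0 u0 v0 \<epsilon>0 \<longrightarrow>
    (\<forall>\<epsilon>\<in>{0<..\<epsilon>0}. \<forall>u v. small_data_solution \<sigma> \<mu> \<nu> Np Nq C0 u0 v0 \<epsilon> u v \<longrightarrow>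
      (let M = asymptotic_mass Np Nq u0 v0 \<epsilon> u v in
        (\<forall>m1 m2. 1 \<le> m1 \<longrightarrow> 1 \<le> m2 \<longrightarrow>
          (\<forall>(w, m, \<gamma>)\<in>{(u, m1, \<nu>), (v, m2, \<mu>)}.
            ((\<lambda>t. ennreal (t powr decay_exponent \<sigma> CARD('n) m) *
                  Lnorm m (\<lambda>x. w t x - \<gamma> / (\<mu> + \<nu>) * heat_kernel \<sigma> t x * M)) \<longlongrightarrow> 0) at_top)) \<and>
        (M \<noteq> 0 \<longrightarrow>
          (\<forall>w\<in>{u, v}. \<forall>\<^sub>F t in at_top.
            ennreal (c * t powr (- real CARD('n) / (4 * \<sigma>)) * \<bar>M\<bar>) \<le> Lnorm 2 (w t) \<and>
            Lnorm 2 (w t)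
              \<le> ennreal (C * \<epsilon> * t powr (- real CARD('n) / (4 * \<sigma>))) * data_norm u0 v0))))"
proof -
  let ?n = "real CARD('n)"
  define s where "s = \<mu> + \<nu>"
  have s: "s > 0" using assms by (simp add: s_def)
  define k where "k = kernel_L2_sq \<sigma> TYPE(real ^ 'n)"
  have k: "k > 0" unfolding k_def by (rule kernel_L2_sq_pos[OF assms(1)])
  \<comment> \<open>the minimum makes the constant serve both components\<close>
  define c where "c = min \<mu> \<nu> / s * (sqrt k / 2)"
  have c: "c > 0" using assms s k by (simp add: c_def)
  have C: "C0 2 > 0" by (rule assms(9)) simp
  have pq: "p > 1 + 2 * \<sigma> / real DIM(real ^ 'n)" "q > 1 + 2 * \<sigma> / real DIM(real ^ 'n)"
    using assms(8) by auto
  show ?thesis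
  proof (rule exI[of _ c], rule conjI[OF c], rule exI[of _ "C0 2"], rule conjI[OF C], intro allI impI ballI)
    fix u0 v0 :: "real ^ 'n \<Rightarrow> real" and \<epsilon>0 \<epsilon> :: real and u v
    assume u0: "u0 \<in> Lspace \<infinity> \<inter> Lspace 1" and v0: "v0 \<in> Lspace \<infinity> \<inter> Lspace 1"
      and "\<epsilon> \<in> {0<..\<epsilon>0}" and sol: "small_data_solution \<sigma> \<mu> \<nu> Np Nq C0 u0 v0 \<epsilon> u v"
    then have \<epsilon>: "\<epsilon> > 0" by simp
    have data: "data_norm u0 v0 < \<infinity>"
      using u0 v0 by (simp add: data_norm_def Lspace_def)
    have solw: "(\<forall>m. 1 \<le> m \<and> m < \<infinity> \<longrightarrow> continuous_in_L m {0..} w) \<and> decay_estimate \<sigma> C0 u0 v0 \<epsilon> w"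
      if "w \<in> {u, v}" for w
      using sol that unfolding small_data_solution_def by blast
    have cont: "continuous_in_L 1 {0..} w" and decay: "decay_estimate \<sigma> C0 u0 v0 \<epsilon> w" if "w \<in> {u, v}" for w
      using solw[OF that] by auto
    have meas: "w t \<in> borel_measurable lebesgue" if "w \<in> {u, v}" "t \<ge> 0" for w t
    proof -
      have "w t \<in> Lspace 1" using conjunct1[OF cont[OF that(1), unfolded continuous_in_L_def]] that(2) by blast
      then show ?thesis by (simp only: Lspace_def mem_Collect_eq)
    qed
    obtain \<kappa>0 B0 N0 where N0: "decaying_source \<sigma> \<kappa>0 B0 N0" "\<And>\<tau>. \<tau> \<ge> 0 \<Longrightarrow> AE x in lebesgue. Np (u \<tau> x) = N0 \<tau> x"
      by (rule nonlinearity_is_decaying_source[OF assms(1) pq(1) assms(6) cont decay data \<epsilon>, of u]) auto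
    obtain \<kappa>1 B1 N1 where N1: "decaying_source \<sigma> \<kappa>1 B1 N1" "\<And>\<tau>. \<tau> \<ge> 0 \<Longrightarrow> AE x in lebesgue. Nq (v \<tau> x) = N1 \<tau> x"
      by (rule nonlinearity_is_decaying_source[OF assms(1) pq(2) assms(7) cont decay data \<epsilon>, of v]) auto
    have Npm: "(\<lambda>x. Np (u \<tau> x)) \<in> borel_measurable lebesgue" if "\<tau> \<ge> 0" for \<tau>
      by (rule measurable_compose[OF meas[OF _ that] power_reading_measurable[OF assms(6)]]) simp
    have Nqm: "(\<lambda>x. Nq (v \<tau> x)) \<in> borel_measurable lebesgue" if "\<tau> \<ge> 0" for \<tau>
      by (rule measurable_compose[OF meas[OF _ that] power_reading_measurable[OF assms(7)]]) simp
    have u01: "u0 \<in> Lspace 1" and v01: "v0 \<in> Lspace 1" using u0 v0 by auto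
    note ie = sol[unfolded small_data_solution_def integral_equations_def K0u_def K1u_def K0v_def K1v_def, THEN conjunct2]
    have bounds: "\<bar>\<nu>\<bar> \<le> s" "\<bar>\<mu>\<bar> \<le> s" "\<bar>- \<nu>\<bar> \<le> s" "\<bar>- \<mu>\<bar> \<le> s" using assms by (auto simp: s_def)
    have minus: "x + - y * z = x - y * z" for x y z :: real by simp
    note co = propagator_coefficient[OF s, unfolded s_def]
    define M where "M = asymptotic_mass Np Nq u0 v0 \<epsilon> u v"
    obtain Eu where Eu: "vanishing_profile \<sigma> Eu"
        "\<And>t. t > 0 \<Longrightarrow> AE x in lebesgue. u t x - \<nu> / (\<mu> + \<nu>) * heat_kernel \<sigma> t x * M = Eu t x"
    proof (rule solution_component_asymptotics[where Np = Np and Nq = Nq and u = u and v = v,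
          OF assms(1) u01 v01 N0 Npm N1 Nqm
          co[OF bounds(1,2)[unfolded s_def]] co[OF bounds(1,3)[unfolded s_def], unfolded minus] conjunct1[OF ie]])
      fix E assume "vanishing_profile \<sigma> E"
        and "\<And>t. t > 0 \<Longrightarrow> AE x in lebesgue. u t x - \<nu> / (\<mu> + \<nu>) * heat_kernel \<sigma> t x * asymptotic_mass Np Nq u0 v0 \<epsilon> u v = E t x"
      then show thesis by (rule that[unfolded M_def])
    qed
    obtain Ev where Ev: "vanishing_profile \<sigma> Ev"
        "\<And>t. t > 0 \<Longrightarrow> AE x in lebesgue. v t x - \<mu> / (\<mu> + \<nu>) * heat_kernel \<sigma> t x * M = Ev t x"
    proof (rule solution_component_asymptotics[where Np = Np and Nq = Nq and u = u and v = v,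
          OF assms(1) u01 v01 N0 Npm N1 Nqm
          co[OF bounds(2,4)[unfolded s_def], unfolded minus] co[OF bounds(2,1)[unfolded s_def]] conjunct2[OF ie]])
      fix E assume "vanishing_profile \<sigma> E"
        and "\<And>t. t > 0 \<Longrightarrow> AE x in lebesgue. v t x - \<mu> / (\<mu> + \<nu>) * heat_kernel \<sigma> t x * asymptotic_mass Np Nq u0 v0 \<epsilon> u v = E t x"
      then show thesis by (rule that[unfolded M_def])
    qed
    have diff_meas: "(\<lambda>x. w t x - \<gamma> * heat_kernel \<sigma> t x * M) \<in> borel_measurable lebesgue"
      if "w \<in> {u, v}" "t > 0" for w t \<gamma>
    proof -
      have "(heat_kernel \<sigma> t :: real ^ 'n \<Rightarrow> real) \<in> borel_measurable lebesgue"
        using heat_kernel_measurable[OF assms(1) that(2), where 'a = "real ^ 'n"] by (intro measurable_completion) simp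
      moreover have "w t \<in> borel_measurable lebesgue" using meas that by simp
      ultimately show ?thesis
        by (intro borel_measurable_diff borel_measurable_times borel_measurable_const)
    qed
    have lim: "((\<lambda>t. ennreal (t powr decay_exponent \<sigma> CARD('n) m) *
        Lnorm m (\<lambda>x. w t x - \<gamma> / (\<mu> + \<nu>) * heat_kernel \<sigma> t x * M)) \<longlongrightarrow> 0) at_top"
      if m: "1 \<le> m" and wg: "(w, \<gamma>) \<in> {(u, \<nu>), (v, \<mu>)}" for m w \<gamma>
    proof -
      obtain E where E: "vanishing_profile \<sigma> E"
          "\<And>t. t > 0 \<Longrightarrow> AE x in lebesgue. w t x - \<gamma> / (\<mu> + \<nu>) * heat_kernel \<sigma> t x * M = E t x"
        using wg Eu Ev by blast
      have "w \<in> {u, v}" using wg by auto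
      then have dm: "(\<lambda>x. w t x - \<gamma> / (\<mu> + \<nu>) * heat_kernel \<sigma> t x * M) \<in> borel_measurable lebesgue"
        if "t > 0" for t using that by (rule diff_meas)
      show ?thesis
        using vanishing_profile_Lnorm[where w = "\<lambda>t x. w t x - \<gamma> / (\<mu> + \<nu>) * heat_kernel \<sigma> t x * M" and E = E,
            OF E(1) m dm E(2)]
        by simp
    qed
    have lower: "\<forall>\<^sub>F t in at_top. ennreal (c * t powr (- ?n / (4 * \<sigma>)) * \<bar>M\<bar>) \<le> Lnorm 2 (w t)"
      if M0: "M \<noteq> 0" and wg: "(w, \<gamma>) \<in> {(u, \<nu>), (v, \<mu>)}" for w \<gamma>
    proof -
      obtain E where E: "vanishing_profile \<sigma> E"
          "\<And>t. t > 0 \<Longrightarrow> AE x in lebesgue. w t x - \<gamma> / (\<mu> + \<nu>) * heat_kernel \<sigma> t x * M = E t x"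
        using wg Eu Ev by blast
      have w: "w \<in> {u, v}" and g: "\<gamma> \<ge> min \<mu> \<nu>" "\<gamma> / (\<mu> + \<nu>) > 0" using wg assms by auto
      have "\<forall>\<^sub>F t in at_top. ennreal (\<gamma> / (\<mu> + \<nu>) * (sqrt k / 2) * t powr (- ?n / (4 * \<sigma>)) * \<bar>M\<bar>) \<le> Lnorm 2 (w t)"
        using L2_lower_bound[OF assms(1) E(1) g(2) M0 meas[OF w less_imp_le] E(2)] by (simp add: k_def)
      then show ?thesis
      proof eventually_elim
        case (elim t)
        have "c \<le> \<gamma> / (\<mu> + \<nu>) * (sqrt k / 2)"
          unfolding c_def s_def using g(1) assms k by (intro mult_right_mono divide_right_mono) auto
        then have "c * t powr (- ?n / (4 * \<sigma>)) * \<bar>M\<bar> \<le> \<gamma> / (\<mu> + \<nu>) * (sqrt k / 2) * t powr (- ?n / (4 * \<sigma>)) * \<bar>M\<bar>"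
          by (intro mult_right_mono) auto
        then show ?case using elim by (meson ennreal_leI order_trans)
      qed
    qed
    have upper: "\<forall>\<^sub>F t in at_top. Lnorm 2 (w t) \<le> ennreal (C0 2 * \<epsilon> * t powr (- ?n / (4 * \<sigma>))) * data_norm u0 v0"
      if w: "w \<in> {u, v}" for w
      using eventually_gt_at_top[of 0]
    proof eventually_elim
      case (elim t)
      have half: "enn2real (1 / 2) = 1 / 2"
        by (rule ennreal_exponent_cases[of 2]) auto
      have ex: "- decay_exponent \<sigma> DIM(real ^ 'n) 2 = - ?n / (4 * \<sigma>)"
        unfolding decay_exponent_def half by simp
      have "Lnorm 2 (w t) \<le> ennreal (C0 2 * \<epsilon> * (1 + t) powr (- decay_exponent \<sigma> DIM(real ^ 'n) 2)) * data_norm u0 v0"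
        by (rule decay[OF w, unfolded decay_estimate_def, rule_format]) (use elim in auto)
      also have "\<dots> \<le> ennreal (C0 2 * \<epsilon> * t powr (- ?n / (4 * \<sigma>))) * data_norm u0 v0"
        unfolding ex using elim C \<epsilon> assms(1)
        by (intro mult_right_mono ennreal_leI mult_left_mono powr_mono2') (auto simp: divide_nonpos_pos)
      finally show ?case .
    qed
    show "let M = asymptotic_mass Np Nq u0 v0 \<epsilon> u v in
        (\<forall>m1 m2. 1 \<le> m1 \<longrightarrow> 1 \<le> m2 \<longrightarrow>
          (\<forall>(w, m, \<gamma>)\<in>{(u, m1, \<nu>), (v, m2, \<mu>)}.
            ((\<lambda>t. ennreal (t powr decay_exponent \<sigma> CARD('n) m) *
                  Lnorm m (\<lambda>x. w t x - \<gamma> / (\<mu> + \<nu>) * heat_kernel \<sigma> t x * M)) \<longlongrightarrow> 0) at_top)) \<and>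
        (M \<noteq> 0 \<longrightarrow>
          (\<forall>w\<in>{u, v}. \<forall>\<^sub>F t in at_top.
            ennreal (c * t powr (- real CARD('n) / (4 * \<sigma>)) * \<bar>M\<bar>) \<le> Lnorm 2 (w t) \<and>
            Lnorm 2 (w t)
              \<le> ennreal (C0 2 * \<epsilon> * t powr (- real CARD('n) / (4 * \<sigma>))) * data_norm u0 v0))"
      unfolding M_def[symmetric] Let_def
    proof (intro conjI allI impI)
      fix m1 m2 :: ennreal assume m: "1 \<le> m1" "1 \<le> m2"
      show "\<forall>(w, m, \<gamma>)\<in>{(u, m1, \<nu>), (v, m2, \<mu>)}.
            ((\<lambda>t. ennreal (t powr decay_exponent \<sigma> CARD('n) m) *
                  Lnorm m (\<lambda>x. w t x - \<gamma> / (\<mu> + \<nu>) * heat_kernel \<sigma> t x * M)) \<longlongrightarrow> 0) at_top"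
        using lim[OF m(1), of u \<nu>] lim[OF m(2), of v \<mu>] by simp
    next
      assume M0: "M \<noteq> 0"
      show "\<forall>w\<in>{u, v}. \<forall>\<^sub>F t in at_top.
            ennreal (c * t powr (- real CARD('n) / (4 * \<sigma>)) * \<bar>M\<bar>) \<le> Lnorm 2 (w t) \<and>
            Lnorm 2 (w t)
              \<le> ennreal (C0 2 * \<epsilon> * t powr (- real CARD('n) / (4 * \<sigma>))) * data_norm u0 v0"
      proof
        fix w assume w: "w \<in> {u, v}"
        then obtain \<gamma> where "(w, \<gamma>) \<in> {(u, \<nu>), (v, \<mu>)}" by blast
        then show "\<forall>\<^sub>F t in at_top.
            ennreal (c * t powr (- real CARD('n) / (4 * \<sigma>)) * \<bar>M\<bar>) \<le> Lnorm 2 (w t) \<and>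
            Lnorm 2 (w t)
              \<le> ennreal (C0 2 * \<epsilon> * t powr (- real CARD('n) / (4 * \<sigma>))) * data_norm u0 v0"
          by (intro eventually_conj lower[OF M0] upper[OF w])
      qed
    qed
  qed
qed

end
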